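(* Consider a geometrical structure with $N=2$ and $\ell_1=\ell_2$ with a non-degenerate corresponding band structure. Then the (non-Hermitian) Zak phase has, for $j=1,2$, the following asymptotic expansion: $$\varphi_j^{\mathrm{zak}}=(-1)^{j+1}\,\frac{s_1+s_2}{2s_1s_2}\,\Im\left((v_2^2-v_1^2)\int_\gamma\frac{1}{z\sqrt{f(z)}}\,dz\right)+\pi\,\mathbf 1_{\{x<s_1\}}(s_2)+O(\delta),$$ where $\gamma$ is the closed path $$\gamma(t)=s_1^{-1}+s_2^{-1}e^{\mathrm iLt},$$ and $f$ is defined along $\gamma$ as $$f(z)=\left(s_1^{-1}+s_2^{-1}\right)^2(v_1^2-v_2^2)^2+4v_1^2v_2^2|z|^2 .$$ Here $\mathbf 1_{\{x<s_1\}}(s_2)$ equals $1$ if $s_2<s_1$ and $0$ otherwise.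
   Context: Geometry: points $0=x_1^{\mathsf L}<x_1^{\mathsf R}<x_2^{\mathsf L}<x_2^{\mathsf R}$ (so $N=2$ resonators per unit cell), period $L>x_2^{\mathsf R}$, extended to $i\in\mathbb Z$ by $x_{i+2}^{\mathsf L}=x_i^{\mathsf L}+L$, $x_{i+2}^{\mathsf R}=x_i^{\mathsf R}+L$; $D_i=(x_i^{\mathsf L},x_i^{\mathsf R})$, $\ell_i=x_i^{\mathsf R}-x_i^{\mathsf L}$ (resonator lengths), $s_i=x_{i+1}^{\mathsf L}-x_i^{\mathsf R}$ (spacings), $\mathfrak C=\bigcup_{i\in\mathbb Z}D_i$, $Y^*=\mathbb R/\frac{2\pi}{L}\mathbb Z=(-\frac\pi L,\frac\pi L]$. The path parameter $t$ of $\gamma$ runs over $Y^*$. Material parameters: $\rho,\rho_b,\kappa>0$ and $\kappa_1,\kappa_2\in\mathbb C$ nonzero; $\kappa(x)=\kappa_i$ on $D_i+L\mathbb Z$ and $\kappa(x)=\kappa$ off $\mathfrak C$; $\rho(x)=\rho_b$ on $\mathfrak C$ and $\rho(x)=\rho$ off $\mathfrak C$. Set $v_i=\sqrt{\kappa_i/\rho_b}$, $v=\sqrt{\kappa/\rho}$, $\delta=\rho_b/\rho$; the regime is $\delta\to0$. Bands: for $\alpha\in Y^*$, the resonances are the $\omega$ for which $-\frac{\omega^2}{\kappa(x)}u-\frac{d}{dx}\left(\frac1{\rho(x)}\frac{du}{dx}\right)=0$ has a nontrivial solution with $u(x+L)=e^{\mathrm i\alpha L}u(x)$; $\alpha\mapsto\omega_1^\alpha,\omega_2^\alpha$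 denote the two subwavelength bands (those with $\omega\to0$ as $\delta\to0$). A band is non-degenerate if it does not intersect any other band. To leading order $(\omega_j^\alpha)^2/\delta$ is an eigenvalue of $\frac1{\ell_1}\begin{pmatrix} v_1^2 a & v_1^2 b(\alpha) \\ v_2^2\overline{b(\alpha)} & v_2^2 a \end{pmatrix}$ with $a=\frac1{s_1}+\frac1{s_2}$, $b(\alpha)=-\frac1{s_1}-\frac{e^{-\mathrm iL\alpha}}{s_2}$; the indices $j=1$ and $j=2$ correspond to the eigenvectors $\bigl(-a(v_2^2-v_1^2)\mp\sqrt{f},\ 2v_2^2\overline{b(\alpha)}\bigr)^T$, with sign $-$ for $j=1$ and $+$ for $j=2$, where $f$ is evaluated at $\overline{b(\alpha)}$ (equivalently at $\gamma(\alpha)=-\overline{b(\alpha)}$) and $\sqrt f$ is the same square root as in the integral. Non-Hermitian Zak phase: $$\varphi_j^{\mathrm{zak}}=\frac{\mathrm i}{2}\int_{Y^*}\left(\left\langle v_j^\alpha,\frac{\partial u_j^\alpha}{\partial\alpha}\right\rangle+\left\langle u_j^\alpha,\frac{\partial v_j^\alpha}{\partial\alpha}\right\rangle\right)d\alpha,$$ where $u_j^\alpha$ and $v_j^\alpha$ are respectively the left and right eigenmodes of band $j$, taken bi-orthogonal ($\langle v_i^\alpha,u_j^\alpha\rangle=\delta_{ij}$, the Kronecker delta), and $\langle\cdot,\cdot\rangle$ is the usual $L^2$ inner product.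
   Formalization: The expansion holds modulo 2π (rescaling the modes shifts the phase by 2πn); s_1≠s_2 is assumed so that the integral over γ exists; non-degeneracy is also required at leading order (the limits of ω²/δ stay distinct, so f does not vanish on γ). *)

theory Defs
  imports "HOL-Complex_Analysis.Complex_Analysis" "HOL-Library.Landau_Symbols"
begin

section \<open>Geometry and material parameters\<close>

definition dimer_chain :: "real \<Rightarrow> (int \<Rightarrow> real) \<Rightarrow> (int \<Rightarrow> real) \<Rightarrow> bool" where
  "dimer_chain L xL xR \<longleftrightarrow>
     xL 1 = 0 \<and> xL 1 < xR 1 \<and> xR 1 < xL 2 \<and> xL 2 < xR 2 \<and> xR 2 < L \<and>
     (\<forall>i. xL (i + 2) = xL i + L \<and> xR (i + 2) = xR i + L)"

definition resonator :: "(int \<Rightarrow> real) \<Rightarrow> (int \<Rightarrow> real) \<Rightarrow> int \<Rightarrow> real set" where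
  "resonator xL xR i = {xL i <..< xR i}"

definition res_length :: "(int \<Rightarrow> real) \<Rightarrow> (int \<Rightarrow> real) \<Rightarrow> int \<Rightarrow> real" where
  "res_length xL xR i = xR i - xL i"

definition spacing :: "(int \<Rightarrow> real) \<Rightarrow> (int \<Rightarrow> real) \<Rightarrow> int \<Rightarrow> real" where
  "spacing xL xR i = xL (i + 1) - xR i"

definition interfaces :: "(int \<Rightarrow> real) \<Rightarrow> (int \<Rightarrow> real) \<Rightarrow> real set" where
  "interfaces xL xR = range xL \<union> range xR"

definition density_at ::
  "(int \<Rightarrow> real) \<Rightarrow> (int \<Rightarrow> real) \<Rightarrow> real \<Rightarrow> real \<Rightarrow> real \<Rightarrow> real" where
  "density_at xL xR rho_b rho x = (if x \<in> (\<Union>i. resonator xL xR i) then rho_b else rho)"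

definition bulk_at ::
  "real \<Rightarrow> (int \<Rightarrow> real) \<Rightarrow> (int \<Rightarrow> real) \<Rightarrow> complex \<Rightarrow> complex \<Rightarrow> real \<Rightarrow> real \<Rightarrow> complex" where
  "bulk_at L xL xR kappa1 kappa2 kappa x =
     (if \<exists>n::int. x - of_int n * L \<in> resonator xL xR 1 then kappa1
      else if \<exists>n::int. x - of_int n * L \<in> resonator xL xR 2 then kappa2
      else complex_of_real kappa)"

text \<open>
  The regime of vanishing contrast, with all wave speeds fixed: the five material parameters
  are functions of the contrast \<open>\<delta> = rho_b / rho\<close>, while \<open>v1\<close>, \<open>v2\<close> and \<open>v\<close> do not depend on it.
  Only the squares of the wave speeds are prescribed, so no branch of the square root is chosen.
\<close>

definition high_contrast_family ::
  "complex \<Rightarrow> complex \<Rightarrow> real \<Rightarrow> (real \<Rightarrow> real) \<Rightarrow> (real \<Rightarrow> real) \<Rightarrow> (real \<Rightarrow> real)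
     \<Rightarrow> (real \<Rightarrow> complex) \<Rightarrow> (real \<Rightarrow> complex) \<Rightarrow> bool" where
  "high_contrast_family v1 v2 v rho rho_b kappa kappa1 kappa2 \<longleftrightarrow>
     (\<forall>\<delta>>0. rho \<delta> > 0 \<and> rho_b \<delta> > 0 \<and> kappa \<delta> > 0 \<and> kappa1 \<delta> \<noteq> 0 \<and> kappa2 \<delta> \<noteq> 0 \<and>
        rho_b \<delta> / rho \<delta> = \<delta> \<and>
        v1\<^sup>2 = kappa1 \<delta> / complex_of_real (rho_b \<delta>) \<and>
        v2\<^sup>2 = kappa2 \<delta> / complex_of_real (rho_b \<delta>) \<and>
        v\<^sup>2 = kappa \<delta> / rho \<delta>)"

section \<open>Bloch eigenmodes\<close>

text \<open>
  Solutions of \<open>- \<omega>\<^sup>2 / \<kappa>(x) u - (u' / \<rho>(x))' = 0\<close> for coefficients that are constant between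
  the points of \<open>I\<close>.  The flux \<open>p = u' / \<rho>\<close> is required to be continuous across \<open>I\<close>, which is
  the transmission condition contained in the divergence form of the equation.
\<close>

definition wave_solution ::
  "real set \<Rightarrow> (real \<Rightarrow> real) \<Rightarrow> (real \<Rightarrow> complex) \<Rightarrow> complex \<Rightarrow> (real \<Rightarrow> complex) \<Rightarrow> bool" where
  "wave_solution I \<rho> \<kappa> \<omega> u \<longleftrightarrow>
     continuous_on UNIV u \<and>
     (\<exists>p. continuous_on UNIV p \<and>
        (\<forall>x. x \<notin> I \<longrightarrow>
           (u has_vector_derivative complex_of_real (\<rho> x) * p x) (at x) \<and>
           (p has_vector_derivative - (\<omega>\<^sup>2 / \<kappa> x) * u x) (at x)))"

definition right_mode ::
  "real \<Rightarrow> real set \<Rightarrow> (real \<Rightarrow> real) \<Rightarrow> (real \<Rightarrow> complex) \<Rightarrow> real \<Rightarrow> complex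
     \<Rightarrow> (real \<Rightarrow> complex) \<Rightarrow> bool" where
  "right_mode L I \<rho> \<kappa> \<alpha> \<omega> u \<longleftrightarrow>
     wave_solution I \<rho> \<kappa> \<omega> u \<and>
     (\<forall>x. u (x + L) = exp (\<i> * complex_of_real (\<alpha> * L)) * u x) \<and>
     (\<exists>x. u x \<noteq> 0)"

text \<open>
  Right modes are the eigenfunctions, with eigenvalue \<open>\<omega>\<^sup>2\<close>, of \<open>A u = - \<kappa> (u' / \<rho>)'\<close>.  Its
  adjoint in the unweighted \<open>L\<^sup>2\<close> space of a period is \<open>A* v = - ((cnj \<kappa> v)' / \<rho>)'\<close>, so that
  \<open>A* v = cnj (\<omega>\<^sup>2) v\<close> says that \<open>w = cnj \<kappa> v\<close> solves the conjugated problem.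
\<close>

definition left_mode ::
  "real \<Rightarrow> real set \<Rightarrow> (real \<Rightarrow> real) \<Rightarrow> (real \<Rightarrow> complex) \<Rightarrow> real \<Rightarrow> complex
     \<Rightarrow> (real \<Rightarrow> complex) \<Rightarrow> bool" where
  "left_mode L I \<rho> \<kappa> \<alpha> \<omega> v \<longleftrightarrow>
     right_mode L I \<rho> (\<lambda>x. cnj (\<kappa> x)) \<alpha> (cnj \<omega>) (\<lambda>x. cnj (\<kappa> x) * v x)"

definition resonance ::
  "real \<Rightarrow> real set \<Rightarrow> (real \<Rightarrow> real) \<Rightarrow> (real \<Rightarrow> complex) \<Rightarrow> real \<Rightarrow> complex \<Rightarrow> bool" where
  "resonance L I \<rho> \<kappa> \<alpha> \<omega> \<longleftrightarrow> (\<exists>u. right_mode L I \<rho> \<kappa> \<alpha> \<omega> u)"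

section \<open>Subwavelength bands\<close>

text \<open>
  From here on \<open>\<rho>\<close>, \<open>\<kappa>\<close>, \<open>\<omega>\<close> take the contrast \<open>\<delta>\<close> as first argument.  Functions on
  \<open>Y* = \<real> / (2 \<pi> / L) \<int>\<close> are represented as \<open>2 \<pi> / L\<close>-periodic functions of a real \<open>\<alpha>\<close>.
\<close>

definition subwavelength_band ::
  "real \<Rightarrow> real set \<Rightarrow> (real \<Rightarrow> real \<Rightarrow> real) \<Rightarrow> (real \<Rightarrow> real \<Rightarrow> complex)
     \<Rightarrow> (real \<Rightarrow> real \<Rightarrow> complex) \<Rightarrow> bool" where
  "subwavelength_band L I \<rho> \<kappa> \<omega> \<longleftrightarrow>
     (\<forall>\<^sub>F \<delta> in at_right 0.
        continuous_on UNIV (\<omega> \<delta>) \<and>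
        (\<forall>\<alpha>. \<omega> \<delta> (\<alpha> + 2 * pi / L) = \<omega> \<delta> \<alpha> \<and> resonance L I (\<rho> \<delta>) (\<kappa> \<delta>) \<alpha> (\<omega> \<delta> \<alpha>))) \<and>
     (\<forall>\<alpha>. ((\<lambda>\<delta>. \<omega> \<delta> \<alpha>) \<longlongrightarrow> 0) (at_right 0))"

text \<open>
  The bands do not intersect for small \<open>\<delta>\<close>, and at no \<open>\<alpha>\<close> do they merge in the limit: subwavelength
  resonances satisfy \<open>\<omega>\<^sup>2 = O(\<delta>)\<close>, and the difference of the squares is not \<open>o(\<delta>)\<close>.  Squares
  are compared because \<open>\<omega>\<close> and \<open>- \<omega>\<close> belong to the same eigenvalue \<open>\<omega>\<^sup>2\<close>.
\<close>

definition nondegenerate_bands :: "(nat \<Rightarrow> real \<Rightarrow> real \<Rightarrow> complex) \<Rightarrow> bool" where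
  "nondegenerate_bands \<omega> \<longleftrightarrow>
     (\<forall>\<^sub>F \<delta> in at_right 0. \<forall>\<alpha>. (\<omega> 1 \<delta> \<alpha>)\<^sup>2 \<noteq> (\<omega> 2 \<delta> \<alpha>)\<^sup>2) \<and>
     (\<forall>\<alpha>. \<not> ((\<lambda>\<delta>. ((\<omega> 1 \<delta> \<alpha>)\<^sup>2 - (\<omega> 2 \<delta> \<alpha>)\<^sup>2) / complex_of_real \<delta>) \<longlongrightarrow> 0) (at_right 0))"

definition cap_a :: "real \<Rightarrow> real \<Rightarrow> complex" where
  "cap_a s1 s2 = complex_of_real (1 / s1 + 1 / s2)"

definition cap_b :: "real \<Rightarrow> real \<Rightarrow> real \<Rightarrow> real \<Rightarrow> complex" where
  "cap_b L s1 s2 \<alpha> = - complex_of_real (1 / s1)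
     - exp (- (\<i> * complex_of_real (L * \<alpha>))) / complex_of_real s2"

definition cap_matrix ::
  "real \<Rightarrow> real \<Rightarrow> real \<Rightarrow> real \<Rightarrow> complex \<Rightarrow> complex \<Rightarrow> real \<Rightarrow> complex^2^2" where
  "cap_matrix L l1 s1 s2 v1 v2 \<alpha> = (\<chi> i j. (1 / complex_of_real l1) *
     (vector [vector [v1\<^sup>2 * cap_a s1 s2, v1\<^sup>2 * cap_b L s1 s2 \<alpha>],
              vector [v2\<^sup>2 * cnj (cap_b L s1 s2 \<alpha>), v2\<^sup>2 * cap_a s1 s2]] :: complex^2^2) $ i $ j)"

definition gamma :: "real \<Rightarrow> real \<Rightarrow> real \<Rightarrow> real \<Rightarrow> complex" where
  "gamma L s1 s2 t = complex_of_real (1 / s1)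
     + complex_of_real (1 / s2) * exp (\<i> * complex_of_real (L * t))"

text \<open>The library parametrises paths over \<open>[0, 1]\<close>, here mapped affinely to \<open>[-\<pi>/L, \<pi>/L]\<close>.\<close>

definition gamma_path :: "real \<Rightarrow> real \<Rightarrow> real \<Rightarrow> real \<Rightarrow> complex" where
  "gamma_path L s1 s2 = gamma L s1 s2 \<circ> linepath (- (pi / L)) (pi / L)"

definition zak_f :: "real \<Rightarrow> real \<Rightarrow> complex \<Rightarrow> complex \<Rightarrow> complex \<Rightarrow> complex" where
  "zak_f s1 s2 v1 v2 z =
     (complex_of_real (1 / s1 + 1 / s2))\<^sup>2 * (v1\<^sup>2 - v2\<^sup>2)\<^sup>2
       + 4 * v1\<^sup>2 * v2\<^sup>2 * complex_of_real ((cmod z)\<^sup>2)"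

text \<open>
  A continuous branch of \<open>sqrt f\<close> along \<open>\<gamma>\<close>.  The principal branch need not be continuous there.
\<close>

definition sqrt_branch ::
  "real \<Rightarrow> real \<Rightarrow> real \<Rightarrow> complex \<Rightarrow> complex \<Rightarrow> (complex \<Rightarrow> complex) \<Rightarrow> bool" where
  "sqrt_branch L s1 s2 v1 v2 sqf \<longleftrightarrow>
     continuous_on (path_image (gamma_path L s1 s2)) sqf \<and>
     (\<forall>z \<in> path_image (gamma_path L s1 s2). (sqf z)\<^sup>2 = zak_f s1 s2 v1 v2 z)"

definition cap_vector ::
  "real \<Rightarrow> real \<Rightarrow> real \<Rightarrow> complex \<Rightarrow> complex \<Rightarrow> (complex \<Rightarrow> complex) \<Rightarrow> nat \<Rightarrow> real \<Rightarrow> complex^2" where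
  "cap_vector L s1 s2 v1 v2 sqf j \<alpha> =
     vector [- cap_a s1 s2 * (v2\<^sup>2 - v1\<^sup>2) + (- 1) ^ j * sqf (gamma L s1 s2 \<alpha>),
             2 * v2\<^sup>2 * cnj (cap_b L s1 s2 \<alpha>)]"

text \<open>
  The labelling of the bands: to leading order \<open>\<omega>\<^sup>2 / \<delta>\<close> is the eigenvalue of the matrix above
  for the \<open>j\<close>-th of its two eigenvectors.
\<close>

definition labelled_band ::
  "real \<Rightarrow> real \<Rightarrow> real \<Rightarrow> real \<Rightarrow> complex \<Rightarrow> complex \<Rightarrow> (complex \<Rightarrow> complex) \<Rightarrow> nat
     \<Rightarrow> (real \<Rightarrow> real \<Rightarrow> complex) \<Rightarrow> bool" where
  "labelled_band L l1 s1 s2 v1 v2 sqf j \<omega> \<longleftrightarrow>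
     (\<forall>\<alpha>. \<exists>\<mu>.
        cap_matrix L l1 s1 s2 v1 v2 \<alpha> *v cap_vector L s1 s2 v1 v2 sqf j \<alpha>
          = \<mu> *s cap_vector L s1 s2 v1 v2 sqf j \<alpha> \<and>
        ((\<lambda>\<delta>. (\<omega> \<delta> \<alpha>)\<^sup>2 / complex_of_real \<delta>) \<longlongrightarrow> \<mu>) (at_right 0))"

section \<open>The Zak phase\<close>

text \<open>The inner product of a unit cell, antilinear in the first argument.\<close>

definition cell_inner :: "real \<Rightarrow> (real \<Rightarrow> complex) \<Rightarrow> (real \<Rightarrow> complex) \<Rightarrow> complex" where
  "cell_inner L g h = integral {0..L} (\<lambda>x. cnj (g x) * h x)"

definition d_alpha :: "(real \<Rightarrow> real \<Rightarrow> complex) \<Rightarrow> real \<Rightarrow> real \<Rightarrow> complex" where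
  "d_alpha u \<alpha> x = vector_derivative (\<lambda>\<beta>. u \<beta> x) (at \<alpha>)"

definition zak_phase ::
  "real \<Rightarrow> (real \<Rightarrow> real \<Rightarrow> complex) \<Rightarrow> (real \<Rightarrow> real \<Rightarrow> complex) \<Rightarrow> complex" where
  "zak_phase L u v = (\<i> / 2) * integral {- (pi / L)..pi / L}
     (\<lambda>\<alpha>. cell_inner L (v \<alpha>) (d_alpha u \<alpha>) + cell_inner L (u \<alpha>) (d_alpha v \<alpha>))"

text \<open>
  A choice of eigenmodes of the two bands at a fixed contrast, continuously differentiable over
  \<open>Y*\<close> and bi-orthogonal.  The remaining freedom multiplies \<open>u j\<close> by a nowhere vanishing function
  on the circle \<open>Y*\<close>, whose winding number makes the Zak phase unique only modulo \<open>2 \<pi>\<close>.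
\<close>

definition biorthogonal_modes ::
  "real \<Rightarrow> real set \<Rightarrow> (real \<Rightarrow> real) \<Rightarrow> (real \<Rightarrow> complex) \<Rightarrow> (nat \<Rightarrow> real \<Rightarrow> complex)
     \<Rightarrow> (nat \<Rightarrow> real \<Rightarrow> real \<Rightarrow> complex) \<Rightarrow> (nat \<Rightarrow> real \<Rightarrow> real \<Rightarrow> complex) \<Rightarrow> bool" where
  "biorthogonal_modes L I \<rho> \<kappa> \<omega> u v \<longleftrightarrow>
     (\<forall>j \<in> {1, 2}. \<forall>\<alpha>. right_mode L I \<rho> \<kappa> \<alpha> (\<omega> j \<alpha>) (u j \<alpha>) \<and>
                        left_mode L I \<rho> \<kappa> \<alpha> (\<omega> j \<alpha>) (v j \<alpha>) \<and>
                        u j (\<alpha> + 2 * pi / L) = u j \<alpha> \<and> v j (\<alpha> + 2 * pi / L) = v j \<alpha>) \<and>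
     (\<forall>j \<in> {1, 2}. \<forall>x. (\<lambda>\<alpha>. u j \<alpha> x) C1_differentiable_on UNIV \<and>
                        (\<lambda>\<alpha>. v j \<alpha> x) C1_differentiable_on UNIV) \<and>
     (\<forall>i \<in> {1, 2}. \<forall>j \<in> {1, 2}. \<forall>\<alpha>.
        cell_inner L (v i \<alpha>) (u j \<alpha>) = (if i = j then 1 else 0))"

end

theory Submission
  imports Defs
begin

text \<open>
  With \<open>q = \<rho> p\<close> (\<open>\<rho>\<close> the background density, \<open>p\<close> the flux) and \<open>\<mu> = \<omega>\<^sup>2 / \<delta>\<close>, the wave equation reads
  \<open>u' = \<delta> q, q' = - \<mu> u / v\<^sub>i\<^sup>2\<close> in the resonators and \<open>u' = q, q' = - \<delta> \<mu> u / v\<^sup>2\<close> in the gaps, which is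
  analytic in \<open>(\<delta>, \<mu>)\<close> up to \<open>\<delta> = 0\<close>.  The dispersion relation equates the trace of the transfer
  matrix of a cell with \<open>2 cos (\<alpha> L)\<close>; at \<open>\<delta> = 0\<close> it is the characteristic equation of the
  capacitance matrix, whose roots are simple.  Hence \<open>\<mu>\<close>, and with it the modes normalised by
  \<open>u 0 = 1\<close>, differ from their limits by \<open>O(\<delta>)\<close> in \<open>C\<^sup>1\<close>.  The normalisation changes the Zak phase by
  a multiple of \<open>2 \<pi>\<close> only.  In the pairing of left and right modes the gaps have weight
  \<open>O(\<delta>)\<close>, so the Zak phase is, up to \<open>O(\<delta>)\<close>, that of the eigenvectors of the capacitance matrix, where
  the parts of the integrand odd in \<open>\<alpha>\<close> drop out and the logarithmic derivative of \<open>\<gamma>\<close> remains.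
\<close>

section \<open>The functions cos and sinc of a square root\<close>

text \<open>The hypotheses control bands and modes at one contrast at a time: the bands converge
  only pointwise in \<alpha>, and the modes carry a gauge that need not vary regularly with
  \<delta>. Hence the gauge is divided out for each \<delta> separately, which leaves an integer
  depending on \<delta>. The normalisation is possible because the entry T12 of the transfer matrix
  stays away from 0: its limit is a multiple of A - (-1)^j sqrt f with A = a (v2^2 - v1^2), and the
  product of this factor with A + (-1)^j sqrt f is -4 v1^2 v2^2 |\<gamma>|^2, nonzero since \<gamma>
  avoids the origin. For a left mode w at \<alpha>, the function \<kappa> cnj w is a right mode at
  -\<alpha> with the same \<omega>, so one family of waves, with Bloch factors exp(\<plusminus>i
  \<alpha> L), serves both sides. In the limit the second resonator has the share (1 + (-1)^j A /
  sqrt f) / 2 of the pairing: the constant part yields the winding number of \<gamma>, hence the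
  term \<pi>, and the rest yields the contour integral. The sign of \<pi> is immaterial modulo 2
  \<pi>.\<close>

definition cos_sqrt :: "complex \<Rightarrow> complex" where
  "cos_sqrt w = (\<Sum>n. (- 1) ^ n / fact (2 * n) * w ^ n)"

text \<open>The series of cos x and sin x / x contain even powers of x only, so both are entire in w
  = x^2. No branch of a square root is chosen, and w = 0, the value reached at zero contrast, is a
  regular point.\<close>

definition sinc_sqrt :: "complex \<Rightarrow> complex" where
  "sinc_sqrt w = (\<Sum>n. (- 1) ^ n / fact (2 * n + 1) * w ^ n)"

lemma summable_alternating_over_fact:
  fixes w :: complex
  assumes "\<And>n. n \<le> p n"
  shows "summable (\<lambda>n. (- 1) ^ n / fact (p n) * w ^ n)"
proof (rule summable_comparison_test')
  show "summable (\<lambda>n. inverse (fact n) * norm w ^ n)"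
    by (rule summable_exp)
  fix n :: nat
  have "norm ((- 1) ^ n / fact (p n) * w ^ n) = inverse (fact (p n)) * norm w ^ n"
    by (simp add: norm_mult norm_divide norm_power field_simps)
  also have "\<dots> \<le> inverse (fact n) * norm w ^ n"
    using fact_mono[OF assms, where 'a = real]
    by (intro mult_right_mono le_imp_inverse_le) auto
  finally show "norm ((- 1) ^ n / fact (p n) * w ^ n) \<le> inverse (fact n) * norm w ^ n" .
qed

lemma cos_sqrt_0 [simp]: "cos_sqrt 0 = 1"
  unfolding cos_sqrt_def by (subst powser_zero) auto

lemma sinc_sqrt_0 [simp]: "sinc_sqrt 0 = 1"
  unfolding sinc_sqrt_def by (subst powser_zero) auto

lemma cos_sqrt_has_field_derivative:
  "(cos_sqrt has_field_derivative - sinc_sqrt w / 2) (at w)"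
proof -
  let ?c = "\<lambda>n. (- 1) ^ n / fact (2 * n) :: complex"
  have "(cos_sqrt has_field_derivative (\<Sum>n. diffs ?c n * w ^ n)) (at w)"
    unfolding cos_sqrt_def[abs_def]
    by (rule termdiffs_strong_converges_everywhere) (rule summable_alternating_over_fact, simp)
  moreover have "diffs ?c n = (- 1 / 2) * ((- 1) ^ n / fact (2 * n + 1))" for n
  proof -
    have "fact (2 * Suc n) = (2 * (of_nat (Suc n)) * fact (2 * n + 1) :: complex)"
      using fact_Suc[of "2 * n + 1", where 'a = complex] by (simp add: algebra_simps)
    moreover have "of_nat (Suc n) \<noteq> (0::complex)" by (metis of_nat_neq_0)
    ultimately show ?thesis unfolding diffs_def
      by (simp add: field_simps del: of_nat_Suc)
  qed
  then have "(\<Sum>n. diffs ?c n * w ^ n) = (\<Sum>n. (- 1 / 2) * ((- 1) ^ n / fact (2 * n + 1) * w ^ n))"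
    by (simp add: algebra_simps)
  also have "\<dots> = (- 1 / 2) * sinc_sqrt w"
    unfolding sinc_sqrt_def
    by (rule suminf_mult) (rule summable_alternating_over_fact, simp)
  ultimately show ?thesis by simp
qed

text \<open>The second claim is (x sinc x)' = cos x in the variable w = x^2: termwise, the factor 2
  n + 1 turns 1 / (2 n + 1)! into 1 / (2 n)!. It serves to eliminate the derivative of
  \<open>sinc_sqrt\<close> later on.\<close>

lemma sinc_sqrt_has_field_derivative:
  "(sinc_sqrt has_field_derivative deriv sinc_sqrt w) (at w)"
  and sinc_sqrt_deriv_eq: "sinc_sqrt w + 2 * w * deriv sinc_sqrt w = cos_sqrt w"
proof -
  let ?c = "\<lambda>n. (- 1) ^ n / fact (2 * n + 1) :: complex"
  have sm: "summable (\<lambda>n. ?c n * z ^ n)" for z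
    by (rule summable_alternating_over_fact) simp
  have D: "(sinc_sqrt has_field_derivative (\<Sum>n. diffs ?c n * w ^ n)) (at w)"
    unfolding sinc_sqrt_def[abs_def]
    by (rule termdiffs_strong_converges_everywhere) (rule sm)
  then show D': "(sinc_sqrt has_field_derivative deriv sinc_sqrt w) (at w)"
    by (simp add: DERIV_imp_deriv)
  have "(\<lambda>n. of_nat n * ?c n * w ^ (n - Suc 0)) sums (\<Sum>n. diffs ?c n * w ^ n)"
    by (rule diffs_equiv, rule termdiff_converges_all, rule sm)
  then have "(\<lambda>n. of_nat n * ?c n * w ^ (n - Suc 0)) sums deriv sinc_sqrt w"
    using DERIV_imp_deriv[OF D] by simp
  then have "(\<lambda>n. ?c n * w ^ n + 2 * w * (of_nat n * ?c n * w ^ (n - Suc 0)))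
      sums (sinc_sqrt w + 2 * w * deriv sinc_sqrt w)"
    unfolding sinc_sqrt_def by (intro sums_add sums_mult summable_sums sm)
  moreover have "?c n * w ^ n + 2 * w * (of_nat n * ?c n * w ^ (n - Suc 0)) =
      (- 1) ^ n / fact (2 * n) * w ^ n" for n
  proof -
    \<comment> \<open>The exponent \<open>n - Suc 0\<close> is truncated at n = 0, where the factor
      n removes the term; hence the case split.\<close>
    have "a * w ^ n + 2 * w * (of_nat n * a * w ^ (n - Suc 0)) = of_nat (2 * n + 1) * a * w ^ n" for a
      by (cases n) (auto simp: algebra_simps)
    then have "?c n * w ^ n + 2 * w * (of_nat n * ?c n * w ^ (n - Suc 0)) = of_nat (2 * n + 1) * ?c n * w ^ n" .
    also have "of_nat (2 * n + 1) * ?c n = (- 1) ^ n / fact (2 * n)"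
      using of_nat_neq_0[of "2 * n", where 'a = complex]
      by (simp add: fact_Suc del: of_nat_Suc)
    finally show ?thesis .
  qed
  ultimately show "sinc_sqrt w + 2 * w * deriv sinc_sqrt w = cos_sqrt w"
    unfolding cos_sqrt_def by (simp add: sums_iff)
qed

lemma cos_sqrt_holomorphic: "cos_sqrt holomorphic_on UNIV"
  and sinc_sqrt_holomorphic: "sinc_sqrt holomorphic_on UNIV"
  using cos_sqrt_has_field_derivative sinc_sqrt_has_field_derivative
  by (auto intro!: holomorphic_on_open[THEN iffD2])

text \<open>The derivative vanishes by the relation between the two functions, and w = 0 fixes the
  constant. This identity is what makes the transfer matrices unimodular.\<close>

lemma cos_sinc_sqrt_pythagoras: "(cos_sqrt w)\<^sup>2 + w * (sinc_sqrt w)\<^sup>2 = 1"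
proof -
  have "((\<lambda>w. (cos_sqrt w)\<^sup>2 + w * (sinc_sqrt w)\<^sup>2) has_field_derivative 0) (at z)" for z
  proof -
    have "((\<lambda>w. (cos_sqrt w)\<^sup>2 + w * (sinc_sqrt w)\<^sup>2) has_field_derivative
       - sinc_sqrt z * cos_sqrt z + (sinc_sqrt z + 2 * z * deriv sinc_sqrt z) * sinc_sqrt z) (at z)"
      by (rule derivative_eq_intros cos_sqrt_has_field_derivative
          sinc_sqrt_has_field_derivative refl)+ (simp add: algebra_simps power2_eq_square)
    then show ?thesis by (simp add: sinc_sqrt_deriv_eq)
  qed
  then obtain c where "\<And>z. (cos_sqrt z)\<^sup>2 + z * (sinc_sqrt z)\<^sup>2 = c"
    using has_field_derivative_zero_constant[of UNIV "\<lambda>w. (cos_sqrt w)\<^sup>2 + w * (sinc_sqrt w)\<^sup>2"]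
    by auto
  from this[of 0] this[of w] show ?thesis by simp
qed

lemma cos_sqrt_square_has_vector_derivative:
  "((\<lambda>y. cos_sqrt (k * (of_real (y - c))\<^sup>2)) has_vector_derivative
     - k * of_real (y - c) * sinc_sqrt (k * (of_real (y - c))\<^sup>2)) (at y)"
proof -
  have "((\<lambda>y. k * (of_real (y - c))\<^sup>2) has_vector_derivative 2 * k * of_real (y - c)) (at y)"
    unfolding of_real_diff
    by (rule derivative_eq_intros has_vector_derivative_real_field refl)+
       (simp add: algebra_simps)
  from field_vector_diff_chain_at[OF this cos_sqrt_has_field_derivative]
  show ?thesis by (simp add: o_def algebra_simps)
qed

lemma sinc_sqrt_square_has_vector_derivative:
  "((\<lambda>y. of_real (y - c) * sinc_sqrt (k * (of_real (y - c))\<^sup>2)) has_vector_derivative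
     cos_sqrt (k * (of_real (y - c))\<^sup>2)) (at y)"
proof -
  have D: "((\<lambda>y. k * (of_real (y - c))\<^sup>2) has_vector_derivative 2 * k * of_real (y - c)) (at y)"
    unfolding of_real_diff
    by (rule derivative_eq_intros has_vector_derivative_real_field refl)+
       (simp add: algebra_simps)
  have S: "((\<lambda>y. sinc_sqrt (k * (of_real (y - c))\<^sup>2)) has_vector_derivative
       2 * k * of_real (y - c) * deriv sinc_sqrt (k * (of_real (y - c))\<^sup>2)) (at y)"
    using field_vector_diff_chain_at[OF D sinc_sqrt_has_field_derivative]
    by (simp add: o_def algebra_simps)
  have I: "((\<lambda>y. of_real (y - c) :: complex) has_vector_derivative 1) (at y)"
    unfolding of_real_diff by (rule derivative_eq_intros refl)+ simp
  show ?thesis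
    using has_vector_derivative_mult[OF I S]
    by (rule has_vector_derivative_eq_rhs)
       (simp add: sinc_sqrt_deriv_eq[symmetric] power2_eq_square algebra_simps)
qed

section \<open>Waves in layered media\<close>

text \<open>The flow over a distance \<open>y\<close> of the system \<open>u' = a q, q' = - b u\<close>.\<close>

definition wave_step :: "complex \<Rightarrow> complex \<Rightarrow> real \<Rightarrow> complex \<times> complex \<Rightarrow> complex \<times> complex" where
  "wave_step a b y p =
     (cos_sqrt (a * b * (of_real y)\<^sup>2) * fst p + a * (of_real y * sinc_sqrt (a * b * (of_real y)\<^sup>2)) * snd p,
      cos_sqrt (a * b * (of_real y)\<^sup>2) * snd p - b * (of_real y * sinc_sqrt (a * b * (of_real y)\<^sup>2)) * fst p)"

lemma wave_step_0 [simp]: "wave_step a b 0 p = p"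
  by (simp add: wave_step_def)

text \<open>Applying the inverse of the flow to (u, q) gives two quantities whose derivatives vanish
  inside the layer; continuity carries their constancy to the endpoints, where the equations may
  fail. The Pythagorean identity then inverts the flow.\<close>

lemma wave_step_unique:
  assumes cont: "continuous_on {c..d} u" "continuous_on {c..d} q"
    and u': "\<And>x. x \<in> {c<..<d} \<Longrightarrow> (u has_vector_derivative a * q x) (at x)"
    and q': "\<And>x. x \<in> {c<..<d} \<Longrightarrow> (q has_vector_derivative - b * u x) (at x)"
    and x: "x \<in> {c..d}"
  shows "(u x, q x) = wave_step a b (x - c) (u c, q c)"
proof -
  define C where "C = (\<lambda>y. cos_sqrt (a * b * (of_real (y - c))\<^sup>2))"
  define S where "S = (\<lambda>y. of_real (y - c) * sinc_sqrt (a * b * (of_real (y - c))\<^sup>2))"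
  have C': "(C has_vector_derivative - (a * b) * S y) (at y)" for y
    using cos_sqrt_square_has_vector_derivative[of "a * b" c y] by (simp add: C_def S_def mult.assoc)
  have S': "(S has_vector_derivative C y) (at y)" for y
    using sinc_sqrt_square_has_vector_derivative[of c "a * b" y] by (simp add: C_def S_def)
  have CS: "continuous_on X C" "continuous_on X S" for X
    using C' S' by (meson continuous_at_imp_continuous_on has_vector_derivative_continuous)+
  have const: "f x = f c" if "continuous_on {c..d} f"
    and "\<And>y. y \<in> {c<..<d} \<Longrightarrow> (f has_vector_derivative 0) (at y)" for f :: "real \<Rightarrow> complex"
  proof (rule has_derivative_zero_unique_strong_interval[of "{c, d}"])
    fix y assume "y \<in> {c..d} - {c, d}"
    then have "(f has_vector_derivative 0) (at y)" by (intro that) auto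
    then show "(f has_derivative (\<lambda>h. 0)) (at y within {c..d})"
      by (auto simp: has_vector_derivative_def intro: has_derivative_at_withinI)
  qed (use that x in auto)
  have X: "C x * u x - a * S x * q x = C c * u c - a * S c * q c"
  proof (rule const)
    show "continuous_on {c..d} (\<lambda>y. C y * u y - a * S y * q y)"
      by (intro continuous_intros cont CS)
    fix y assume "y \<in> {c<..<d}"
    from has_vector_derivative_diff[OF has_vector_derivative_mult[OF C' u'[OF this]]
      has_vector_derivative_mult[OF has_vector_derivative_mult_right[OF S', of a] q'[OF this]]]
    show "((\<lambda>y. C y * u y - a * S y * q y) has_vector_derivative 0) (at y)"
      by (rule has_vector_derivative_eq_rhs) (simp add: algebra_simps)
  qed
  have Y: "C x * q x + b * S x * u x = C c * q c + b * S c * u c"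
  proof (rule const)
    show "continuous_on {c..d} (\<lambda>y. C y * q y + b * S y * u y)"
      by (intro continuous_intros cont CS)
    fix y assume "y \<in> {c<..<d}"
    from has_vector_derivative_add[OF has_vector_derivative_mult[OF C' q'[OF this]]
      has_vector_derivative_mult[OF has_vector_derivative_mult_right[OF S', of b] u'[OF this]]]
    show "((\<lambda>y. C y * q y + b * S y * u y) has_vector_derivative 0) (at y)"
      by (rule has_vector_derivative_eq_rhs) (simp add: algebra_simps)
  qed
  have c: "C c = 1" "S c = 0" by (auto simp: C_def S_def)
  have P: "C x * C x + a * b * S x * S x = 1"
    using cos_sinc_sqrt_pythagoras[of "a * b * (of_real (x - c))\<^sup>2"]
    by (simp add: C_def S_def power2_eq_square algebra_simps)
  have "u x = (C x * C x + a * b * S x * S x) * u x" unfolding P by simp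
  also have "\<dots> = C x * (C x * u x - a * S x * q x) + a * S x * (C x * q x + b * S x * u x)"
    by (simp add: algebra_simps)
  finally have ux: "u x = C x * u c + a * S x * q c" unfolding X Y c by simp
  have "q x = (C x * C x + a * b * S x * S x) * q x" unfolding P by simp
  also have "\<dots> = C x * (C x * q x + b * S x * u x) - b * S x * (C x * u x - a * S x * q x)"
    by (simp add: algebra_simps)
  finally have qx: "q x = C x * q c - b * S x * u c" unfolding X Y c by simp
  show ?thesis
    using ux qx by (simp add: wave_step_def C_def S_def)
qed

text \<open>The flow matrix has determinant 1.\<close>

lemma wave_step_wronskian:
  "fst (wave_step a b y p) * snd (wave_step a b y p') - fst (wave_step a b y p') * snd (wave_step a b y p) =
     fst p * snd p' - fst p' * snd p"
proof -
  define C where "C = cos_sqrt (a * b * (of_real y)\<^sup>2)"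
  define S where "S = of_real y * sinc_sqrt (a * b * (of_real y)\<^sup>2)"
  have P: "C * C + a * b * S * S = 1"
    using cos_sinc_sqrt_pythagoras[of "a * b * (of_real y)\<^sup>2"]
    by (simp add: C_def S_def power2_eq_square algebra_simps)
  have ws: "wave_step a b y p = (C * fst p + a * S * snd p, C * snd p - b * S * fst p)" for p
    by (simp add: wave_step_def C_def S_def)
  have "fst (wave_step a b y p) * snd (wave_step a b y p') - fst (wave_step a b y p') * snd (wave_step a b y p) =
    (C * C + a * b * S * S) * (fst p * snd p' - fst p' * snd p)"
    unfolding ws by (simp add: algebra_simps)
  then show ?thesis unfolding P by simp
qed

lemma wave_step_linear:
  "wave_step a b y (r * u + s * u', r * q + s * q') =
    (r * fst (wave_step a b y (u, q)) + s * fst (wave_step a b y (u', q')),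
     r * snd (wave_step a b y (u, q)) + s * snd (wave_step a b y (u', q')))"
  by (simp add: wave_step_def algebra_simps)

text \<open>Amplitude and flux are both continuous across an interface, so the state at the end of
  one layer is the initial state of the next and the transmission conditions are built in.\<close>

primrec layer_state ::
  "(nat \<Rightarrow> complex) \<Rightarrow> (nat \<Rightarrow> complex) \<Rightarrow> (nat \<Rightarrow> real) \<Rightarrow> complex \<times> complex \<Rightarrow> nat \<Rightarrow> complex \<times> complex" where
  "layer_state A B c p 0 = p"
| "layer_state A B c p (Suc k) = wave_step (A k) (B k) (c (Suc k) - c k) (layer_state A B c p k)"

definition layer_wave ::
  "(nat \<Rightarrow> complex) \<Rightarrow> (nat \<Rightarrow> complex) \<Rightarrow> (nat \<Rightarrow> real) \<Rightarrow> complex \<times> complex \<Rightarrow> nat \<Rightarrow> real \<Rightarrow> complex \<times> complex" where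
  "layer_wave A B c p k x = wave_step (A k) (B k) (x - c k) (layer_state A B c p k)"

lemma layer_state_wronskian:
  "fst (layer_state A B c p k) * snd (layer_state A B c p' k)
     - fst (layer_state A B c p' k) * snd (layer_state A B c p k) = fst p * snd p' - fst p' * snd p"
  by (induction k) (simp_all add: wave_step_wronskian)

lemma layer_state_linear:
  "layer_state A B c (r * u + s * u', r * q + s * q') k =
    (r * fst (layer_state A B c (u, q) k) + s * fst (layer_state A B c (u', q') k),
     r * snd (layer_state A B c (u, q) k) + s * snd (layer_state A B c (u', q') k))"
  by (induction k) (simp_all add: wave_step_linear)

text \<open>The states started at (1, 0) and (0, 1) are the columns of the transfer matrix.\<close>

lemma layer_state_decompose:
  "layer_state A B c (u, q) k =
    (u * fst (layer_state A B c (1, 0) k) + q * fst (layer_state A B c (0, 1) k),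
     u * snd (layer_state A B c (1, 0) k) + q * snd (layer_state A B c (0, 1) k))"
  using layer_state_linear[of A B c u 1 q 0 0 1 k] by simp

lemma layer_wave_scale:
  "layer_wave A B c (r * u, r * q) k x = (r * fst (layer_wave A B c (u, q) k x), r * snd (layer_wave A B c (u, q) k x))"
  using layer_state_linear[of A B c r u 0 0 q 0 k]
    wave_step_linear[of "A k" "B k" "x - c k" r "fst (layer_state A B c (u, q) k)" 0 0 "snd (layer_state A B c (u, q) k)" 0]
  by (simp add: layer_wave_def)

lemma layer_wave_unique:
  assumes cont: "continuous_on UNIV u" "continuous_on UNIV q"
    and c: "\<And>k. k < n \<Longrightarrow> c k < c (Suc k)"
    and u': "\<And>k x. k < n \<Longrightarrow> x \<in> {c k<..<c (Suc k)} \<Longrightarrow> (u has_vector_derivative A k * q x) (at x)"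
    and q': "\<And>k x. k < n \<Longrightarrow> x \<in> {c k<..<c (Suc k)} \<Longrightarrow> (q has_vector_derivative - B k * u x) (at x)"
  shows "k < n \<Longrightarrow> x \<in> {c k..c (Suc k)} \<Longrightarrow> (u x, q x) = layer_wave A B c (u (c 0), q (c 0)) k x"
    and "k \<le> n \<Longrightarrow> (u (c k), q (c k)) = layer_state A B c (u (c 0), q (c 0)) k"
proof -
  have step: "(u x, q x) = wave_step (A k) (B k) (x - c k) (u (c k), q (c k))"
    if "k < n" "x \<in> {c k..c (Suc k)}" for k x
    by (rule wave_step_unique[where d = "c (Suc k)"])
       (use that u' q' cont in \<open>auto intro: continuous_on_subset\<close>)
  have node: "(u (c k), q (c k)) = layer_state A B c (u (c 0), q (c 0)) k" if "k \<le> n" for k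
    using that
  proof (induction k)
    case (Suc k)
    then show ?case using step[of k "c (Suc k)"] c[of k] by simp
  qed simp
  show "k < n \<Longrightarrow> x \<in> {c k..c (Suc k)} \<Longrightarrow> (u x, q x) = layer_wave A B c (u (c 0), q (c 0)) k x"
    using step[of k x] node[of k] by (simp add: layer_wave_def)
  show "k \<le> n \<Longrightarrow> (u (c k), q (c k)) = layer_state A B c (u (c 0), q (c 0)) k"
    by (rule node)
qed

section \<open>Geometry of the unit cell and its four layers\<close>

definition cell_break :: "real \<Rightarrow> (int \<Rightarrow> real) \<Rightarrow> (int \<Rightarrow> real) \<Rightarrow> nat \<Rightarrow> real" where
  "cell_break L xL xR k = [0, xR 1, xL 2, xR 2, L] ! k"

lemma less_4_cases: "(k::nat) < 4 \<Longrightarrow> k = 0 \<or> k = 1 \<or> k = 2 \<or> k = 3"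
  by auto

lemma cell_break_simps [simp]:
  "cell_break L xL xR 0 = 0" "cell_break L xL xR (Suc 0) = xR 1"
  "cell_break L xL xR 2 = xL 2" "cell_break L xL xR 3 = xR 2" "cell_break L xL xR 4 = L"
  by (simp_all add: cell_break_def numeral_eq_Suc)

lemma cell_break_less:
  assumes "dimer_chain L xL xR" "k < 4"
  shows "cell_break L xL xR k < cell_break L xL xR (Suc k)"
  using assms(1) less_4_cases[OF assms(2)]
  by (auto simp: dimer_chain_def cell_break_def)

lemma cell_break_bounds:
  assumes "dimer_chain L xL xR" "k < 4"
  shows "0 \<le> cell_break L xL xR k" "cell_break L xL xR (Suc k) \<le> L"
  using assms(1) less_4_cases[OF assms(2)]
  by (auto simp: dimer_chain_def cell_break_def)

context
  fixes L :: real and xL xR :: "int \<Rightarrow> real"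
  assumes geometry: "dimer_chain L xL xR"
begin

lemma chain_order: "xL 1 = 0" "0 < xR 1" "xR 1 < xL 2" "xL 2 < xR 2" "xR 2 < L" "0 < L"
  using geometry by (auto simp: dimer_chain_def)

lemma chain_shift: "xL (i + 2 * n) = xL i + of_int n * L" "xR (i + 2 * n) = xR i + of_int n * L"
proof -
  have s: "xL (i + 2) = xL i + L" "xR (i + 2) = xR i + L" for i
    using geometry by (auto simp: dimer_chain_def)
  show "xL (i + 2 * n) = xL i + of_int n * L"
  proof (induction n rule: int_induct[of _ 0])
    case (step1 n) then show ?case using s(1)[of "i + 2 * n"] by (simp add: algebra_simps)
  next
    case (step2 n) then show ?case using s(1)[of "i + 2 * (n - 1)"] by (simp add: algebra_simps)
  qed simp
  show "xR (i + 2 * n) = xR i + of_int n * L"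
  proof (induction n rule: int_induct[of _ 0])
    case (step1 n) then show ?case using s(2)[of "i + 2 * n"] by (simp add: algebra_simps)
  next
    case (step2 n) then show ?case using s(2)[of "i + 2 * (n - 1)"] by (simp add: algebra_simps)
  qed simp
qed

text \<open>The residues are represented by 1 and 2 because these index the two resonators inside
  the cell from 0 to L.\<close>

lemma index_cases:
  obtains n where "i = 1 + 2 * n" | n where "i = 2 + 2 * (n::int)"
proof (cases "even i")
  case True
  then obtain m where "i = 2 * m" by blast
  then have "i = 2 + 2 * (m - 1)" by simp
  then show ?thesis using that by blast
next
  case False
  then obtain m where "i = 2 * m + 1" by (elim oddE)
  then show ?thesis using that by (simp add: add.commute)
qed

text \<open>Translates of [0, L) by nonzero multiples of L miss the open cell. This reduces all
  periodic data to the resonators 1 and 2.\<close>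

lemma shifted_in_cell:
  assumes "0 < x" "x < L" "y \<in> {0..<L}" "x = y + of_int n * L"
  shows "n = 0"
proof (rule ccontr)
  assume "n \<noteq> 0"
  then consider "n \<ge> 1" | "n \<le> -1" by linarith
  then show False
  proof cases
    case 1
    then have "1 * L \<le> of_int n * L" using chain_order by (intro mult_right_mono) auto
    then show False using assms(2,3) unfolding assms(4) atLeastLessThan_iff by linarith
  next
    case 2
    then have "of_int n \<le> (-1 :: real)" by linarith
    then have "of_int n * L \<le> -1 * L" using chain_order by (intro mult_right_mono) auto
    then show False using assms(1,3) unfolding assms(4) atLeastLessThan_iff by linarith
  qed
qed

lemma interface_in_cell:
  assumes "x \<in> interfaces xL xR" "0 < x" "x < L"
  shows "x = xR 1 \<or> x = xL 2 \<or> x = xR 2"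
proof -
  from assms(1) obtain i where i: "x = xL i \<or> x = xR i"
    by (auto simp: interfaces_def)
  show ?thesis
  proof (cases i rule: index_cases)
    case (1 n)
    then obtain y where y: "y = 0 \<or> y = xR 1" "x = y + of_int n * L"
      using i chain_shift[of 1 n] chain_order by auto
    then have "n = 0" using shifted_in_cell[OF assms(2,3), of y n] chain_order by auto
    then show ?thesis using y assms(2) by auto
  next
    case (2 n)
    then obtain y where y: "y = xL 2 \<or> y = xR 2" "x = y + of_int n * L"
      using i chain_shift[of 2 n] by auto
    then have "n = 0" using shifted_in_cell[OF assms(2,3), of y n] chain_order by auto
    then show ?thesis using y by auto
  qed
qed

lemma interface_shift: "x + L \<in> interfaces xL xR \<longleftrightarrow> x \<in> interfaces xL xR"
proof -
  have "x + L \<in> interfaces xL xR" if "x \<in> interfaces xL xR" for x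
    using that chain_shift[of _ 1] by (auto simp: interfaces_def) (metis rangeI)+
  moreover have "x - L \<in> interfaces xL xR" if "x \<in> interfaces xL xR" for x
    using that chain_shift[of _ "-1"] by (auto simp: interfaces_def) (metis rangeI)+
  ultimately show ?thesis by (metis add_diff_cancel_right')
qed

lemma shifted_resonator_in_cell:
  assumes "0 < x" "x < L" "i \<in> {1, 2}"
  shows "(\<exists>n::int. x - of_int n * L \<in> resonator xL xR i) \<longleftrightarrow> x \<in> resonator xL xR i"
proof
  assume "\<exists>n::int. x - of_int n * L \<in> resonator xL xR i"
  then obtain n :: int where n: "x - of_int n * L \<in> resonator xL xR i" by blast
  then have "x - of_int n * L \<in> {0..<L}"
    using assms(3) chain_order by (auto simp: resonator_def)
  then have "n = 0" using shifted_in_cell[OF assms(1,2), of "x - of_int n * L" n] by simp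
  with n show "x \<in> resonator xL xR i" by simp
next
  assume "x \<in> resonator xL xR i"
  then have "x - of_int 0 * L \<in> resonator xL xR i" by simp
  then show "\<exists>n::int. x - of_int n * L \<in> resonator xL xR i" by blast
qed

lemma resonators_in_cell:
  assumes "0 < x" "x < L"
  shows "x \<in> (\<Union>i. resonator xL xR i) \<longleftrightarrow> x \<in> resonator xL xR 1 \<union> resonator xL xR 2"
proof
  assume "x \<in> (\<Union>i. resonator xL xR i)"
  then obtain i where i: "x \<in> resonator xL xR i" by blast
  show "x \<in> resonator xL xR 1 \<union> resonator xL xR 2"
  proof (cases i rule: index_cases)
    case (1 n)
    then have "x - of_int n * L \<in> resonator xL xR 1"
      using i chain_shift[of 1 n] by (simp add: resonator_def algebra_simps)
    then show ?thesis using shifted_resonator_in_cell[OF assms, of 1] by blast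
  next
    case (2 n)
    then have "x - of_int n * L \<in> resonator xL xR 2"
      using i chain_shift[of 2 n] by (simp add: resonator_def algebra_simps)
    then show ?thesis using shifted_resonator_in_cell[OF assms, of 2] by blast
  qed
qed auto

lemma layer_of_cell_point:
  assumes "x \<in> {0..L}"
  shows "\<exists>k<4. x \<in> {cell_break L xL xR k..cell_break L xL xR (Suc k)}"
proof -
  consider "x \<in> {0..xR 1}" | "x \<in> {xR 1..xL 2}" | "x \<in> {xL 2..xR 2}" | "x \<in> {xR 2..L}"
    using assms by fastforce
  then show ?thesis
  proof cases
    case 1 then show ?thesis by (intro exI[of _ 0]) (simp add: cell_break_def)
  next
    case 2 then show ?thesis by (intro exI[of _ 1]) (simp add: cell_break_def)
  next
    case 3 then show ?thesis by (intro exI[of _ 2]) (simp add: cell_break_def)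
  next
    case 4 then show ?thesis by (intro exI[of _ 3]) (simp add: cell_break_def)
  qed
qed

lemma layer_not_interface:
  assumes "k < 4" "x \<in> {cell_break L xL xR k<..<cell_break L xL xR (Suc k)}"
  shows "x \<notin> interfaces xL xR"
proof
  assume x: "x \<in> interfaces xL xR"
  have "0 < x" "x < L" using assms cell_break_bounds[OF geometry assms(1)] by auto
  from interface_in_cell[OF x this] show False
    using assms(2) less_4_cases[OF assms(1)] chain_order by (auto simp: cell_break_def)
qed

lemma layer_density:
  assumes "k < 4" "x \<in> {cell_break L xL xR k<..<cell_break L xL xR (Suc k)}"
  shows "density_at xL xR rb r x = (if even k then rb else r)"
proof -
  have x: "0 < x" "x < L" using assms cell_break_bounds[OF geometry assms(1)] by auto
  show ?thesis
    using assms(2) less_4_cases[OF assms(1)] chain_order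
    unfolding density_at_def resonators_in_cell[OF x]
    by (auto simp: cell_break_def resonator_def)
qed

lemma layer_bulk:
  assumes "k < 4" "x \<in> {cell_break L xL xR k<..<cell_break L xL xR (Suc k)}"
  shows "bulk_at L xL xR k1 k2 k0 x = [k1, of_real k0, k2, of_real k0] ! k"
proof -
  have x: "0 < x" "x < L" using assms cell_break_bounds[OF geometry assms(1)] by auto
  show ?thesis
    using assms(2) less_4_cases[OF assms(1)] chain_order
    unfolding bulk_at_def shifted_resonator_in_cell[OF x, of 1, simplified]
      shifted_resonator_in_cell[OF x, of 2, simplified]
    by (auto simp: cell_break_def resonator_def)
qed

text \<open>Quasi-periodicity is assumed for u alone. On the first resonator and its translate the
  density is the same constant, so differentiating the relation for u and dividing by that constant
  gives the relation for the flux.\<close>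

lemma right_mode_flux:
  assumes "right_mode L (interfaces xL xR) (density_at xL xR rb r) \<kappa> \<alpha> \<omega> u" and "rb > 0"
  obtains p where "continuous_on UNIV u" "continuous_on UNIV p"
    "\<And>x. x \<notin> interfaces xL xR \<Longrightarrow> (u has_vector_derivative of_real (density_at xL xR rb r x) * p x) (at x)"
    "\<And>x. x \<notin> interfaces xL xR \<Longrightarrow> (p has_vector_derivative - (\<omega>\<^sup>2 / \<kappa> x) * u x) (at x)"
    "p L = exp (\<i> * of_real (\<alpha> * L)) * p 0"
proof -
  let ?z = "exp (\<i> * of_real (\<alpha> * L))"
  from assms(1) obtain p where p: "continuous_on UNIV u" "continuous_on UNIV p"
    and u': "\<And>x. x \<notin> interfaces xL xR \<Longrightarrow> (u has_vector_derivative of_real (density_at xL xR rb r x) * p x) (at x)"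
    and p': "\<And>x. x \<notin> interfaces xL xR \<Longrightarrow> (p has_vector_derivative - (\<omega>\<^sup>2 / \<kappa> x) * u x) (at x)"
    and qp: "\<And>x. u (x + L) = ?z * u x"
    unfolding right_mode_def wave_solution_def by blast
  have "p (x + L) = ?z * p x" if x: "x \<in> {0<..<xR 1}" for x
  proof -
    have nI: "x \<notin> interfaces xL xR" and nI': "x + L \<notin> interfaces xL xR"
      using layer_not_interface[of 0 x] x interface_shift[of x] by auto
    have d: "density_at xL xR rb r x = rb" using layer_density[of 0 x] x by auto
    have "x + L \<in> resonator xL xR 3"
      using x chain_shift[of 1 1] chain_order by (simp add: resonator_def)
    then have d': "density_at xL xR rb r (x + L) = rb" unfolding density_at_def by auto
    have "((u \<circ> (\<lambda>x. x + L)) has_vector_derivative 1 *\<^sub>R (of_real rb * p (x + L))) (at x)"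
      by (rule vector_diff_chain_at)
         (use u'[OF nI'] d' in \<open>auto intro!: derivative_eq_intros simp: has_vector_derivative_def\<close>)
    moreover have "((\<lambda>x. ?z * u x) has_vector_derivative ?z * (of_real rb * p x)) (at x)"
      using u'[OF nI] d by (intro has_vector_derivative_mult_right) simp
    moreover have "u \<circ> (\<lambda>x. x + L) = (\<lambda>x. ?z * u x)" using qp by auto
    ultimately have "of_real rb * p (x + L) = ?z * (of_real rb * p x)"
      using vector_derivative_unique_at by fastforce
    then show ?thesis using assms(2) by simp
  qed
  \<comment> \<open>The point 0 is an interface, where no derivative is available; it is reached as
    a limit of points of the first resonator.\<close>
  moreover have "closed {x. p (x + L) - ?z * p x = 0}"
    by (rule closed_Collect_eq)
       (auto intro!: continuous_intros continuous_on_compose2[OF p(2)])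
  ultimately have "closure {0<..<xR 1} \<subseteq> {x. p (x + L) - ?z * p x = 0}"
    by (intro closure_minimal) auto
  moreover have "0 \<in> closure {0<..<xR 1}"
    using chain_order by (simp add: closure_greaterThanLessThan)
  ultimately have "p L = ?z * p 0" by auto
  then show ?thesis using that p u' p' by blast
qed

text \<open>A mode is known to be nonzero only somewhere on the real line; shifting by floor(x / L)
  periods brings that point into the cell.\<close>

lemma quasi_periodic_eq_0:
  fixes u :: "real \<Rightarrow> complex"
  assumes qp: "\<And>x. u (x + L) = z * u x" and "z \<noteq> 0" and 0: "\<And>x. x \<in> {0..L} \<Longrightarrow> u x = 0"
  shows "u x = 0"
proof -
  have shift: "u (y + of_int n * L) = 0 \<longleftrightarrow> u y = 0" for n y
  proof (induction n rule: int_induct[of _ 0])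
    case (step1 n)
    then show ?case using qp[of "y + of_int n * L"] assms(2) by (simp add: algebra_simps)
  next
    case (step2 n)
    then show ?case using qp[of "y + of_int (n - 1) * L"] assms(2) by (simp add: algebra_simps)
  qed simp
  have "x - of_int \<lfloor>x / L\<rfloor> * L \<in> {0..L}"
    using chain_order floor_divide_lower[of L x] floor_divide_upper[of L x]
    by (auto simp: algebra_simps)
  then have "u (x - of_int \<lfloor>x / L\<rfloor> * L) = 0" by (rule 0)
  then show ?thesis using shift[of "x - of_int \<lfloor>x / L\<rfloor> * L" "\<lfloor>x / L\<rfloor>"] by simp
qed

text \<open>The flux is rescaled by the background density r: the resonator density is \<delta> r,
  so the coefficient of q becomes \<delta> in the resonators and 1 in the gaps, bounded as \<delta>
  tends to 0.\<close>

lemma right_mode_layers: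
  assumes mode: "right_mode L (interfaces xL xR) (density_at xL xR (\<delta> * r) r) (bulk_at L xL xR k1 k2 k0) \<alpha> \<omega> u"
    and pos: "r > 0" "\<delta> > 0"
    and A: "\<And>k. k < 4 \<Longrightarrow> A k = (if even k then of_real \<delta> else 1)"
    and B: "\<And>k. k < 4 \<Longrightarrow> B k = of_real r * \<omega>\<^sup>2 / ([k1, of_real k0, k2, of_real k0] ! k)"
  obtains q where "(u 0, q) \<noteq> (0, 0)"
    "\<And>k x. k < 4 \<Longrightarrow> x \<in> {cell_break L xL xR k..cell_break L xL xR (Suc k)} \<Longrightarrow>
       u x = fst (layer_wave A B (cell_break L xL xR) (u 0, q) k x)"
    "layer_state A B (cell_break L xL xR) (u 0, q) 4 =
       (exp (\<i> * of_real (\<alpha> * L)) * u 0, exp (\<i> * of_real (\<alpha> * L)) * q)"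
proof -
  let ?c = "cell_break L xL xR" and ?z = "exp (\<i> * of_real (\<alpha> * L))"
  have "\<delta> * r > 0" using pos by simp
  from right_mode_flux[OF mode this] obtain p where cont: "continuous_on UNIV u" "continuous_on UNIV p"
    and u': "\<And>x. x \<notin> interfaces xL xR \<Longrightarrow> (u has_vector_derivative of_real (density_at xL xR (\<delta> * r) r x) * p x) (at x)"
    and p': "\<And>x. x \<notin> interfaces xL xR \<Longrightarrow> (p has_vector_derivative - (\<omega>\<^sup>2 / bulk_at L xL xR k1 k2 k0 x) * u x) (at x)"
    and pL: "p L = ?z * p 0"
    by metis
  have qp: "\<And>x. u (x + L) = ?z * u x" and nz: "\<exists>x. u x \<noteq> 0"
    using mode unfolding right_mode_def by auto
  define q where "q = (\<lambda>x. of_real r * p x)"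
  have contq: "continuous_on UNIV q" unfolding q_def by (intro continuous_intros cont)
  note uniq = layer_wave_unique[where u = u and q = q and n = 4 and c = ?c and A = A and B = B]
  have U': "(u has_vector_derivative A k * q x) (at x)" if k: "k < 4" "x \<in> {?c k<..<?c (Suc k)}" for k x
    using u'[OF layer_not_interface[OF k]] layer_density[OF k] A[OF k(1)]
    by (auto simp: q_def mult_ac)
  have Q': "(q has_vector_derivative - B k * u x) (at x)" if k: "k < 4" "x \<in> {?c k<..<?c (Suc k)}" for k x
    using has_vector_derivative_mult_right[OF p'[OF layer_not_interface[OF k]], of "of_real r"]
      layer_bulk[OF k] B[OF k(1)]
    by (auto simp: q_def mult_ac)
  have wave: "(u x, q x) = layer_wave A B ?c (u 0, q 0) k x" if "k < 4" "x \<in> {?c k..?c (Suc k)}" for k x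
    using uniq(1)[OF cont(1) contq cell_break_less[OF geometry] U' Q' that] by simp
  have node: "(u (?c k), q (?c k)) = layer_state A B ?c (u 0, q 0) k" if "k \<le> 4" for k
    using uniq(2)[OF cont(1) contq cell_break_less[OF geometry] U' Q' that] by simp
  show thesis
  proof (rule that)
    show "u x = fst (layer_wave A B ?c (u 0, q 0) k x)" if "k < 4" "x \<in> {?c k..?c (Suc k)}" for k x
      using wave[OF that] by (metis fst_conv)
    show "layer_state A B ?c (u 0, q 0) 4 = (?z * u 0, ?z * q 0)"
    proof -
      have "u L = ?z * u 0" "q L = ?z * q 0" using qp[of 0] pL by (simp_all add: q_def)
      then show ?thesis using node[of 4] by simp
    qed
    show "(u 0, q 0) \<noteq> (0, 0)"
    proof
      assume 0: "(u 0, q 0) = (0, 0)"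
      have "u x = 0" if x: "x \<in> {0..L}" for x
      proof -
        obtain k where k: "k < 4" "x \<in> {?c k..?c (Suc k)}"
          using layer_of_cell_point[OF x] by blast
        \<comment> \<open>Zero data are written as products with 0 so that homogeneity applies with
          factor 0.\<close>
        have "u x = fst (layer_wave A B ?c (0 * 0, 0 * 0) k x)"
          using wave[OF k] 0 by (metis fst_conv mult_zero_left prod.inject)
        then show ?thesis unfolding layer_wave_scale by simp
      qed
      from quasi_periodic_eq_0[where z = ?z and u = u and x = x for x, OF qp _ this]
      have "u x = 0" for x by simp
      then show False using nz by blast
    qed
  qed
qed

end

section \<open>Conjugation of left modes and the dispersion relation\<close>

text \<open>Conjugation restores \<kappa> and \<omega> and inverts the Bloch factor, so left modes
  obey the same transfer matrix as right modes.\<close>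

lemma right_mode_cnj:
  assumes "right_mode L I \<rho> (\<lambda>x. cnj (\<kappa> x)) \<alpha> (cnj \<omega>) w"
  shows "right_mode L I \<rho> \<kappa> (- \<alpha>) \<omega> (\<lambda>x. cnj (w x))"
proof -
  from assms obtain p where p: "continuous_on UNIV w" "continuous_on UNIV p"
    and w': "\<And>x. x \<notin> I \<Longrightarrow> (w has_vector_derivative of_real (\<rho> x) * p x) (at x)"
    and p': "\<And>x. x \<notin> I \<Longrightarrow> (p has_vector_derivative - ((cnj \<omega>)\<^sup>2 / cnj (\<kappa> x)) * w x) (at x)"
    and qp: "\<And>x. w (x + L) = exp (\<i> * of_real (\<alpha> * L)) * w x" and nz: "\<exists>x. w x \<noteq> 0"
    unfolding right_mode_def wave_solution_def by blast
  have "wave_solution I \<rho> \<kappa> \<omega> (\<lambda>x. cnj (w x))"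
    unfolding wave_solution_def
  proof (intro conjI exI[of _ "\<lambda>x. cnj (p x)"] allI impI)
    fix x assume "x \<notin> I"
    from has_vector_derivative_cnj[OF w'[OF this]] has_vector_derivative_cnj[OF p'[OF this]]
    show "((\<lambda>x. cnj (w x)) has_vector_derivative of_real (\<rho> x) * cnj (p x)) (at x)"
      "((\<lambda>x. cnj (p x)) has_vector_derivative - (\<omega>\<^sup>2 / \<kappa> x) * cnj (w x)) (at x)"
      by auto
  qed (intro continuous_intros p)+
  moreover have "cnj (w (x + L)) = exp (\<i> * of_real (- \<alpha> * L)) * cnj (w x)" for x
    unfolding qp by (simp add: exp_cnj)
  ultimately show ?thesis using nz unfolding right_mode_def by auto
qed

text \<open>The characteristic polynomial at z annihilates both coordinates of the eigenvector, one
  of which is nonzero; determinant 1 turns its vanishing into the trace relation.\<close>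

lemma eigenvector_2x2:
  fixes z :: complex
  assumes eq: "t11 * u + t12 * q = z * u" "t21 * u + t22 * q = z * q"
    and nz: "(u, q) \<noteq> (0, 0)" and det: "t11 * t22 - t12 * t21 = 1" and z: "z \<noteq> 0"
  shows "t11 + t22 = z + 1 / z"
proof -
  have "((t11 - z) * (t22 - z) - t12 * t21) * u = 0" "((t11 - z) * (t22 - z) - t12 * t21) * q = 0"
    using eq by algebra+
  then have "(t11 - z) * (t22 - z) - t12 * t21 = 0" using nz by auto
  then have "(t11 + t22) * z = z * z + 1" using det by algebra
  then show ?thesis using z by (simp add: field_simps)
qed

section \<open>Families close to their limit\<close>

text \<open>The filter contains \<open>\<delta> = 0\<close> itself: the limit of a family \<open>F\<close> is its member \<open>F 0\<close>.\<close>

definition near0 :: "real filter" where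
  "near0 = inf (nhds 0) (principal {0..})"

lemma eventually_near0: "eventually P near0 \<longleftrightarrow> P 0 \<and> eventually P (at_right 0)"
proof
  assume "eventually P near0"
  then have *: "eventually (\<lambda>x. x \<in> {0..} \<longrightarrow> P x) (nhds 0)"
    by (simp add: near0_def eventually_inf_principal)
  then have "P 0" using eventually_nhds_x_imp_x by force
  moreover have "eventually P (at_right 0)"
    unfolding eventually_at_filter using * by (rule eventually_mono) auto
  ultimately show "P 0 \<and> eventually P (at_right 0)" ..
next
  assume *: "P 0 \<and> eventually P (at_right 0)"
  then have "eventually (\<lambda>x. x \<noteq> 0 \<longrightarrow> x \<in> {0<..} \<longrightarrow> P x) (nhds 0)"
    by (simp add: eventually_at_filter)
  then show "eventually P near0"
    unfolding near0_def eventually_inf_principal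
    by (rule eventually_mono) (use * in auto)
qed

lemma eventually_near0_nonneg: "\<forall>\<^sub>F \<delta> in near0. 0 \<le> \<delta>"
  by (simp add: near0_def eventually_inf_principal)

lemma eventually_near0_less:
  assumes "0 < e" shows "\<forall>\<^sub>F \<delta> in near0. K * \<delta> < e"
proof -
  have "((\<lambda>\<delta>. K * \<delta>) \<longlongrightarrow> K * 0) (at_right 0)" by (intro tendsto_intros)
  then have "\<forall>\<^sub>F \<delta> in at_right 0. K * \<delta> < e" using assms order_tendstoD(2) by fastforce
  then show ?thesis using assms by (simp add: eventually_near0)
qed

text \<open>The uniform bound belongs to the notion because the difference estimate for products
  relies on it.\<close>

definition O_close :: "'a set \<Rightarrow> 'b set \<Rightarrow> (real \<Rightarrow> 'a \<Rightarrow> 'b \<Rightarrow> complex) \<Rightarrow> bool" where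
  "O_close T X F \<longleftrightarrow> (\<exists>K. \<forall>\<^sub>F \<delta> in near0. \<forall>t\<in>T. \<forall>x\<in>X.
     norm (F \<delta> t x) \<le> K \<and> norm (F \<delta> t x - F 0 t x) \<le> K * \<delta>)"

text \<open>The condition at a single \<delta>, completed by the bound at \<delta> = 0, so that it
  can be combined with other eventual properties.\<close>

definition O_bound :: "real \<Rightarrow> 'a set \<Rightarrow> 'b set \<Rightarrow> (real \<Rightarrow> 'a \<Rightarrow> 'b \<Rightarrow> complex) \<Rightarrow> real \<Rightarrow> bool" where
  "O_bound K T X F \<delta> \<longleftrightarrow> 0 \<le> \<delta> \<and> (\<forall>t\<in>T. \<forall>x\<in>X.
     norm (F \<delta> t x) \<le> K \<and> norm (F \<delta> t x - F 0 t x) \<le> K * \<delta> \<and> norm (F 0 t x) \<le> K)"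

lemma O_closeE:
  assumes "O_close T X F"
  obtains K where "K > 0" "\<forall>\<^sub>F \<delta> in near0. O_bound K T X F \<delta>"
proof -
  from assms obtain K where K: "\<forall>\<^sub>F \<delta> in near0. \<forall>t\<in>T. \<forall>x\<in>X.
     norm (F \<delta> t x) \<le> K \<and> norm (F \<delta> t x - F 0 t x) \<le> K * \<delta>"
    unfolding O_close_def by blast
  then have K0: "\<forall>t\<in>T. \<forall>x\<in>X. norm (F 0 t x) \<le> K" by (simp add: eventually_near0)
  show thesis
  proof (rule that)
    show "\<bar>K\<bar> + 1 > 0" by simp
    show "\<forall>\<^sub>F \<delta> in near0. O_bound (\<bar>K\<bar> + 1) T X F \<delta>"
      unfolding O_bound_def using K eventually_near0_nonneg
    proof eventually_elim
      case (elim \<delta>)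
      have "K * \<delta> \<le> (\<bar>K\<bar> + 1) * \<delta>" using elim by (intro mult_right_mono) auto
      then show ?case using elim K0 by (fastforce intro: order_trans)
    qed
  qed
qed

lemma O_close_fixed:
  assumes "\<And>t x. t \<in> T \<Longrightarrow> x \<in> X \<Longrightarrow> norm (f t x) \<le> K"
  shows "O_close T X (\<lambda>\<delta>. f)"
  unfolding O_close_def
proof (rule exI[of _ "\<bar>K\<bar>"])
  show "\<forall>\<^sub>F \<delta> in near0. \<forall>t\<in>T. \<forall>x\<in>X. norm (f t x) \<le> \<bar>K\<bar> \<and> norm (f t x - f t x) \<le> \<bar>K\<bar> * \<delta>"
    using eventually_near0_nonneg by eventually_elim (use assms in fastforce)
qed

lemma O_close_const: "O_close T X (\<lambda>\<delta> t x. c)"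
  by (rule O_close_fixed) auto

lemma O_close_parameter: "O_close T X (\<lambda>\<delta> t x. of_real \<delta>)"
  unfolding O_close_def
  by (rule exI[of _ 1], use eventually_near0_nonneg eventually_near0_less[of 1 1, OF zero_less_one] in eventually_elim) auto

lemma O_close_add:
  assumes "O_close T X F" "O_close T X G"
  shows "O_close T X (\<lambda>\<delta> t x. F \<delta> t x + G \<delta> t x)"
proof -
  from O_closeE[OF assms(1)] obtain K where K: "K > 0" "\<forall>\<^sub>F \<delta> in near0. O_bound K T X F \<delta>" .
  from O_closeE[OF assms(2)] obtain M where M: "M > 0" "\<forall>\<^sub>F \<delta> in near0. O_bound M T X G \<delta>" .
  show ?thesis unfolding O_close_def
  proof (rule exI[of _ "K + M"], use K(2) M(2) in eventually_elim, intro ballI conjI)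
    fix \<delta> t x assume A: "t \<in> T" "x \<in> X"
    assume "O_bound K T X F \<delta>"
     "O_bound M T X G \<delta>"
    then have *: "norm (F \<delta> t x) \<le> K" "norm (F \<delta> t x - F 0 t x) \<le> K * \<delta>"
      "norm (G \<delta> t x) \<le> M" "norm (G \<delta> t x - G 0 t x) \<le> M * \<delta>" using A by (auto simp: O_bound_def)
    show "norm (F \<delta> t x + G \<delta> t x) \<le> K + M"
      using * norm_triangle_ineq[of "F \<delta> t x" "G \<delta> t x"] by linarith
    have "F \<delta> t x + G \<delta> t x - (F 0 t x + G 0 t x) = (F \<delta> t x - F 0 t x) + (G \<delta> t x - G 0 t x)" by simp
    then show "norm (F \<delta> t x + G \<delta> t x - (F 0 t x + G 0 t x)) \<le> (K + M) * \<delta>"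
      using * norm_triangle_ineq[of "F \<delta> t x - F 0 t x" "G \<delta> t x - G 0 t x"]
      by (simp add: algebra_simps)
  qed
qed

lemma O_close_mult:
  assumes "O_close T X F" "O_close T X G"
  shows "O_close T X (\<lambda>\<delta> t x. F \<delta> t x * G \<delta> t x)"
proof -
  from O_closeE[OF assms(1)] obtain K where K: "K > 0" "\<forall>\<^sub>F \<delta> in near0. O_bound K T X F \<delta>" .
  from O_closeE[OF assms(2)] obtain M where M: "M > 0" "\<forall>\<^sub>F \<delta> in near0. O_bound M T X G \<delta>" .
  show ?thesis unfolding O_close_def
  proof (rule exI[of _ "K * M + K * M"], use K(2) M(2) in eventually_elim, intro ballI conjI)
    fix \<delta> t x assume A: "t \<in> T" "x \<in> X"
    assume "O_bound K T X F \<delta>"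
     "O_bound M T X G \<delta>"
    then have *: "norm (F \<delta> t x) \<le> K" "norm (F \<delta> t x - F 0 t x) \<le> K * \<delta>" "norm (F 0 t x) \<le> K"
      "norm (G \<delta> t x) \<le> M" "norm (G \<delta> t x - G 0 t x) \<le> M * \<delta>" "\<delta> \<ge> 0" using A by (auto simp: O_bound_def)
    have "norm (F \<delta> t x * G \<delta> t x) \<le> K * M"
      unfolding norm_mult using * K(1) by (intro mult_mono) auto
    then show "norm (F \<delta> t x * G \<delta> t x) \<le> K * M + K * M"
      using mult_pos_pos[OF K(1) M(1)] by linarith
    have "F \<delta> t x * G \<delta> t x - F 0 t x * G 0 t x =
        (F \<delta> t x - F 0 t x) * G \<delta> t x + F 0 t x * (G \<delta> t x - G 0 t x)" by (simp add: algebra_simps)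
    also have "norm \<dots> \<le> norm (F \<delta> t x - F 0 t x) * norm (G \<delta> t x) + norm (F 0 t x) * norm (G \<delta> t x - G 0 t x)"
      unfolding norm_mult[symmetric] by (rule norm_triangle_ineq)
    also have "\<dots> \<le> (K * \<delta>) * M + K * (M * \<delta>)"
      using * K(1) M(1) by (intro add_mono mult_mono) auto
    finally show "norm (F \<delta> t x * G \<delta> t x - F 0 t x * G 0 t x) \<le> (K * M + K * M) * \<delta>"
      by (simp add: algebra_simps)
  qed
qed

lemma O_close_minus:
  "O_close T X F \<Longrightarrow> O_close T X (\<lambda>\<delta> t x. - F \<delta> t x)"
  using O_close_mult[OF O_close_const[of T X "-1"]] by simp

lemma O_close_sum:
  "(\<And>i. i \<in> I \<Longrightarrow> O_close T X (F i)) \<Longrightarrow> O_close T X (\<lambda>\<delta> t x. \<Sum>i\<in>I. F i \<delta> t x)"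
  by (induction I rule: infinite_finite_induct) (auto intro: O_close_const O_close_add)

lemma O_close_cnj: "O_close T X F \<Longrightarrow> O_close T X (\<lambda>\<delta> t x. cnj (F \<delta> t x))"
  unfolding O_close_def by (simp flip: complex_cnj_diff)

lemma O_close_inverse_bounds:
  assumes "O_close T X F" "c > 0" "\<forall>t\<in>T. \<forall>x\<in>X. norm (F 0 t x) \<ge> c"
  shows "\<forall>\<^sub>F \<delta> in near0. \<forall>t\<in>T. \<forall>x\<in>X. norm (F \<delta> t x) \<ge> c / 2"
proof -
  from O_closeE[OF assms(1)] obtain K where K: "K > 0" "\<forall>\<^sub>F \<delta> in near0. O_bound K T X F \<delta>" .
  have "c / 2 > 0" using assms(2) by simp
  from K(2) eventually_near0_less[OF this, of K] show ?thesis
  proof eventually_elim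
    case (elim \<delta>)
    show ?case
    proof (intro ballI)
      fix t x assume "t \<in> T" "x \<in> X"
      then have "norm (F \<delta> t x - F 0 t x) \<le> K * \<delta>" "norm (F 0 t x) \<ge> c" using elim assms(3) by (auto simp: O_bound_def)
      then show "norm (F \<delta> t x) \<ge> c / 2"
        using elim norm_triangle_ineq2[of "F 0 t x" "F \<delta> t x"] by (simp add: norm_minus_commute)
    qed
  qed
qed

lemma O_close_inverse:
  assumes "O_close T X F" "c > 0" "\<forall>t\<in>T. \<forall>x\<in>X. norm (F 0 t x) \<ge> c"
  shows "O_close T X (\<lambda>\<delta> t x. inverse (F \<delta> t x))"
proof -
  from O_closeE[OF assms(1)] obtain K where K: "K > 0" "\<forall>\<^sub>F \<delta> in near0. O_bound K T X F \<delta>" .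
  let ?C = "2 / c + 2 / c * K * (1 / c)"
  show ?thesis unfolding O_close_def
  proof (rule exI[of _ ?C], use K(2) O_close_inverse_bounds[OF assms] in eventually_elim, intro ballI conjI)
    fix \<delta> t x assume A: "t \<in> T" "x \<in> X"
    assume "O_bound K T X F \<delta>"
      "\<forall>t\<in>T. \<forall>x\<in>X. norm (F \<delta> t x) \<ge> c / 2"
    then have *: "norm (F \<delta> t x - F 0 t x) \<le> K * \<delta>" "norm (F \<delta> t x) \<ge> c / 2" "norm (F 0 t x) \<ge> c" "\<delta> \<ge> 0"
      using A assms(3) by (auto simp: O_bound_def)
    then have nz: "F \<delta> t x \<noteq> 0" "F 0 t x \<noteq> 0" using assms(2) by auto
    have i: "norm (inverse (F \<delta> t x)) \<le> 2 / c" "norm (inverse (F 0 t x)) \<le> 1 / c"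
      using le_imp_inverse_le[OF *(2)] le_imp_inverse_le[OF *(3)] assms(2)
      by (simp_all add: norm_inverse norm_divide inverse_eq_divide)
    have "0 \<le> 2 / c * K * (1 / c)" using assms(2) K(1) by simp
    with i(1) show "norm (inverse (F \<delta> t x)) \<le> ?C" by linarith
    have "inverse (F \<delta> t x) - inverse (F 0 t x) = inverse (F \<delta> t x) * (F 0 t x - F \<delta> t x) * inverse (F 0 t x)"
      using nz by (simp add: field_simps)
    also have "norm \<dots> \<le> 2 / c * (K * \<delta>) * (1 / c)"
      unfolding norm_mult using i * assms(2) K(1) by (intro mult_mono) (auto simp: norm_minus_commute)
    also have "\<dots> \<le> ?C * \<delta>" using assms(2) * by (simp add: algebra_simps)
    finally show "norm (inverse (F \<delta> t x) - inverse (F 0 t x)) \<le> ?C * \<delta>" .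
  qed
qed

text \<open>For small \<delta> the argument lies in the unit ball at distance O(\<delta>) from 0,
  its value at \<delta> = 0, and \<phi> is Lipschitz on the ball because its derivative is bounded
  there.\<close>

lemma O_close_entire:
  assumes "\<phi> holomorphic_on UNIV" "O_close T X F"
  shows "O_close T X (\<lambda>\<delta> t x. \<phi> (of_real \<delta> * F \<delta> t x))"
proof -
  from O_closeE[OF assms(2)] obtain K where K: "K > 0" "\<forall>\<^sub>F \<delta> in near0. O_bound K T X F \<delta>" .
  have "continuous_on (cball 0 1) (deriv \<phi>)"
    using holomorphic_deriv[OF assms(1)] holomorphic_on_imp_continuous_on holomorphic_on_subset by blast
  then have "bounded (deriv \<phi> ` cball 0 1)"
    by (intro compact_imp_bounded compact_continuous_image) auto
  then obtain M where M: "M > 0" "\<And>w. w \<in> cball 0 1 \<Longrightarrow> norm (deriv \<phi> w) \<le> M"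
    unfolding bounded_pos by auto
  have lip: "norm (\<phi> w - \<phi> 0) \<le> M * norm w" if "w \<in> cball 0 1" for w
  proof -
    have "norm (\<phi> w - \<phi> 0) \<le> M * norm (w - 0)"
    proof (rule field_differentiable_bound[of "cball 0 1" \<phi> "deriv \<phi>"])
      fix z :: complex assume "z \<in> cball 0 1"
      have "(\<phi> has_field_derivative deriv \<phi> z) (at z)"
        using holomorphic_derivI[OF assms(1)] by auto
      then show "(\<phi> has_field_derivative deriv \<phi> z) (at z within cball 0 1)"
        by (rule has_field_derivative_at_within)
    qed (use M that in auto)
    then show ?thesis by simp
  qed
  show ?thesis unfolding O_close_def
  proof (rule exI[of _ "norm (\<phi> 0) + M + M * K"], use K(2) eventually_near0_less[of 1 K, OF zero_less_one] in eventually_elim, intro ballI conjI)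
    fix \<delta> t x assume A: "t \<in> T" "x \<in> X"
    assume "O_bound K T X F \<delta>" "K * \<delta> < 1"
    then have *: "norm (F \<delta> t x) \<le> K" "\<delta> \<ge> 0" "K * \<delta> < 1" using A by (auto simp: O_bound_def)
    have n: "norm (of_real \<delta> * F \<delta> t x) \<le> K * \<delta>"
      using * mult_left_mono[OF *(1,2)] by (simp add: norm_mult algebra_simps)
    then have in1: "of_real \<delta> * F \<delta> t x \<in> cball 0 1" using * by simp
    have b: "norm (\<phi> (of_real \<delta> * F \<delta> t x) - \<phi> 0) \<le> M * (K * \<delta>)"
      using lip[OF in1] mult_left_mono[OF n, of M] M(1) by linarith
    also have "M * (K * \<delta>) \<le> (norm (\<phi> 0) + M + M * K) * \<delta>"
      using M(1) K(1) *(2) by (simp add: algebra_simps)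
    finally show "norm (\<phi> (of_real \<delta> * F \<delta> t x) - \<phi> (of_real 0 * F 0 t x)) \<le> (norm (\<phi> 0) + M + M * K) * \<delta>"
      by simp
    have "M * (K * \<delta>) \<le> M * 1" using *(3) M(1) by (intro mult_left_mono) auto
    moreover have "0 < M * K" using M(1) K(1) by simp
    ultimately show "norm (\<phi> (of_real \<delta> * F \<delta> t x)) \<le> norm (\<phi> 0) + M + M * K"
      using b norm_triangle_ineq2[of "\<phi> (of_real \<delta> * F \<delta> t x)" "\<phi> 0"] by linarith
  qed
qed

lemma O_close_integral:
  fixes F :: "real \<Rightarrow> 'a::topological_space \<Rightarrow> real \<Rightarrow> complex"
  assumes "O_close T {c..d} F" "c \<le> d"
    and "\<forall>\<^sub>F \<delta> in near0. continuous_on (T \<times> {c..d}) (\<lambda>(t, x). F \<delta> t x)"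
  shows "O_close T X (\<lambda>\<delta> t _. integral {c..d} (F \<delta> t))"
proof -
  from O_closeE[OF assms(1)] obtain K where K: "K > 0" "\<forall>\<^sub>F \<delta> in near0. O_bound K T {c..d} F \<delta>" .
  have C: "continuous_on {c..d} (F \<delta> t)"
    if "continuous_on (T \<times> {c..d}) (\<lambda>(t, x). F \<delta> t x)" "t \<in> T" for \<delta> t
  proof -
    have "continuous_on {c..d} ((\<lambda>(t, x). F \<delta> t x) \<circ> Pair t)"
      by (intro continuous_on_compose continuous_on_Pair continuous_on_const continuous_on_id
          continuous_on_subset[OF that(1)]) (use that(2) in auto)
    then show ?thesis by (simp add: o_def)
  qed
  have C0: "continuous_on (T \<times> {c..d}) (\<lambda>(t, x). F 0 t x)"
    using assms(3) by (simp add: eventually_near0)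
  show ?thesis unfolding O_close_def
  proof (rule exI[of _ "K * (d - c)"], use K(2) assms(3) in eventually_elim, intro ballI conjI)
    fix \<delta> t assume A: "t \<in> T"
    assume "O_bound K T {c..d} F \<delta>"
      "continuous_on (T \<times> {c..d}) (\<lambda>(t, x). F \<delta> t x)"
    then have *: "\<And>x. x \<in> {c..d} \<Longrightarrow> norm (F \<delta> t x) \<le> K"
      "\<And>x. x \<in> {c..d} \<Longrightarrow> norm (F \<delta> t x - F 0 t x) \<le> K * \<delta>"
      and c: "continuous_on {c..d} (F \<delta> t)" "continuous_on {c..d} (F 0 t)"
      using A C C0 by (auto simp: O_bound_def)
    show "norm (integral {c..d} (F \<delta> t)) \<le> K * (d - c)"
      using integral_bound[OF assms(2) c(1)] * by auto
    have "integral {c..d} (F \<delta> t) - integral {c..d} (F 0 t) = integral {c..d} (\<lambda>x. F \<delta> t x - F 0 t x)"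
      using c by (intro integral_diff[symmetric] integrable_continuous_interval)
    also have "norm \<dots> \<le> (K * \<delta>) * (d - c)"
      using * by (intro integral_bound[OF assms(2)] continuous_intros c)
    finally show "norm (integral {c..d} (F \<delta> t) - integral {c..d} (F 0 t)) \<le> K * (d - c) * \<delta>"
      by (simp add: algebra_simps)
  qed
qed

section \<open>Families close to their limit together with a derivative\<close>

text \<open>\<open>\<iota>\<close> is \<open>of_real\<close> for a real parameter \<open>t\<close> and the identity for a complex one.\<close>

definition C1_family ::
  "('a::real_normed_vector \<Rightarrow> complex) \<Rightarrow> 'a set \<Rightarrow> 'b::topological_space set
     \<Rightarrow> ('a \<Rightarrow> 'b \<Rightarrow> complex) \<Rightarrow> ('a \<Rightarrow> 'b \<Rightarrow> complex) \<Rightarrow> bool" where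
  "C1_family \<iota> T X F F' \<longleftrightarrow>
     continuous_on (T \<times> X) (\<lambda>(t, x). F t x) \<and> continuous_on (T \<times> X) (\<lambda>(t, x). F' t x) \<and>
     (\<forall>t\<in>T. \<forall>x\<in>X. ((\<lambda>s. F s x) has_derivative (\<lambda>h. \<iota> h * F' t x)) (at t))"

text \<open>The derivative must be O(\<delta>)-close as well because the Zak integrand contains it.
  Joint continuity in (t, x) keeps integrals over x continuous in t.\<close>

definition C1_close ::
  "('a::real_normed_vector \<Rightarrow> complex) \<Rightarrow> 'a set \<Rightarrow> 'b::topological_space set
     \<Rightarrow> (real \<Rightarrow> 'a \<Rightarrow> 'b \<Rightarrow> complex) \<Rightarrow> bool" where
  "C1_close \<iota> T X F \<longleftrightarrow> (\<exists>F'. (\<forall>\<^sub>F \<delta> in near0. C1_family \<iota> T X (F \<delta>) (F' \<delta>)) \<and>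
     O_close T X F \<and> O_close T X F')"

lemma C1_family_const: "C1_family \<iota> T X (\<lambda>t x. c) (\<lambda>t x. 0)"
  unfolding C1_family_def by auto

lemma C1_family_add:
  assumes "C1_family \<iota> T X F F'" "C1_family \<iota> T X G G'"
  shows "C1_family \<iota> T X (\<lambda>t x. F t x + G t x) (\<lambda>t x. F' t x + G' t x)"
  unfolding C1_family_def
proof (intro conjI ballI)
  fix t x assume "t \<in> T" "x \<in> X"
  then have "((\<lambda>s. F s x) has_derivative (\<lambda>h. \<iota> h * F' t x)) (at t)"
    "((\<lambda>s. G s x) has_derivative (\<lambda>h. \<iota> h * G' t x)) (at t)"
    using assms unfolding C1_family_def by auto
  from has_derivative_add[OF this]
  show "((\<lambda>s. F s x + G s x) has_derivative (\<lambda>h. \<iota> h * (F' t x + G' t x))) (at t)"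
    by (simp add: algebra_simps)
qed (use assms in \<open>auto simp: C1_family_def case_prod_unfold intro!: continuous_intros\<close>)

lemma C1_family_mult:
  assumes "C1_family \<iota> T X F F'" "C1_family \<iota> T X G G'"
  shows "C1_family \<iota> T X (\<lambda>t x. F t x * G t x) (\<lambda>t x. F t x * G' t x + F' t x * G t x)"
  unfolding C1_family_def
proof (intro conjI ballI)
  fix t x assume "t \<in> T" "x \<in> X"
  then have "((\<lambda>s. F s x) has_derivative (\<lambda>h. \<iota> h * F' t x)) (at t)"
    "((\<lambda>s. G s x) has_derivative (\<lambda>h. \<iota> h * G' t x)) (at t)"
    using assms unfolding C1_family_def by auto
  from has_derivative_mult[OF this]
  show "((\<lambda>s. F s x * G s x) has_derivative (\<lambda>h. \<iota> h * (F t x * G' t x + F' t x * G t x))) (at t)"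
    by (simp add: algebra_simps)
qed (use assms in \<open>auto simp: C1_family_def case_prod_unfold intro!: continuous_intros\<close>)

lemma C1_family_compose:
  assumes "C1_family \<iota> T X F F'"
    and "\<And>t x. t \<in> T \<Longrightarrow> x \<in> X \<Longrightarrow> (\<phi> has_field_derivative \<phi>' (F t x)) (at (F t x))"
    and "\<And>t x. t \<in> T \<Longrightarrow> x \<in> X \<Longrightarrow> isCont \<phi>' (F t x)"
  shows "C1_family \<iota> T X (\<lambda>t x. \<phi> (F t x)) (\<lambda>t x. \<phi>' (F t x) * F' t x)"
  unfolding C1_family_def
proof (intro conjI ballI)
  fix t x assume tx: "t \<in> T" "x \<in> X"
  then have "((\<lambda>s. F s x) has_derivative (\<lambda>h. \<iota> h * F' t x)) (at t)"
    using assms unfolding C1_family_def by auto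
  from has_derivative_compose[OF this has_field_derivative_imp_has_derivative[OF assms(2)[OF tx]]]
  show "((\<lambda>s. \<phi> (F s x)) has_derivative (\<lambda>h. \<iota> h * (\<phi>' (F t x) * F' t x))) (at t)"
    by (simp add: algebra_simps)
next
  have F: "continuous_on (T \<times> X) (\<lambda>p. F (fst p) (snd p))" "continuous_on (T \<times> X) (\<lambda>p. F' (fst p) (snd p))"
    using assms(1) by (auto simp: C1_family_def case_prod_unfold)
  have "continuous_on ((\<lambda>p. F (fst p) (snd p)) ` (T \<times> X)) \<phi>"
    by (rule continuous_at_imp_continuous_on) (use assms(2) DERIV_isCont in force)
  from continuous_on_compose2[OF this F(1)]
  show "continuous_on (T \<times> X) (\<lambda>(t, x). \<phi> (F t x))" by (auto simp: case_prod_unfold)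
  have "continuous_on ((\<lambda>p. F (fst p) (snd p)) ` (T \<times> X)) \<phi>'"
    by (rule continuous_at_imp_continuous_on) (use assms(3) in force)
  from continuous_on_compose2[OF this F(1)]
  show "continuous_on (T \<times> X) (\<lambda>(t, x). \<phi>' (F t x) * F' t x)"
    using F(2) by (auto simp: case_prod_unfold intro!: continuous_intros)
qed

lemma C1_closeE:
  assumes "C1_close \<iota> T X F"
  obtains F' where "\<forall>\<^sub>F \<delta> in near0. C1_family \<iota> T X (F \<delta>) (F' \<delta>)" "O_close T X F" "O_close T X F'"
  using assms unfolding C1_close_def by blast

lemma C1_closeI:
  assumes "\<forall>\<^sub>F \<delta> in near0. C1_family \<iota> T X (F \<delta>) (F' \<delta>)" "O_close T X F" "O_close T X F'"
  shows "C1_close \<iota> T X F"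
  using assms unfolding C1_close_def by blast

lemma C1_close_const: "C1_close \<iota> T X (\<lambda>\<delta> t x. c)"
  by (rule C1_closeI[where F' = "\<lambda>\<delta> t x. 0"])
     (intro always_eventually allI C1_family_const O_close_const)+

lemma C1_close_parameter: "C1_close \<iota> T X (\<lambda>\<delta> t x. of_real \<delta>)"
  by (rule C1_closeI[where F' = "\<lambda>\<delta> t x. 0"])
     (intro always_eventually allI C1_family_const O_close_const O_close_parameter)+

lemma C1_close_fixed:
  assumes "compact T" "compact X" "C1_family \<iota> T X F F'"
  shows "C1_close \<iota> T X (\<lambda>\<delta>. F)"
proof -
  have bdd: "\<exists>K. \<forall>t\<in>T. \<forall>x\<in>X. norm (G t x) \<le> K"
    if "continuous_on (T \<times> X) (\<lambda>(t, x). G t x)" for G :: "'a \<Rightarrow> 'b \<Rightarrow> complex"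
  proof -
    have "bounded ((\<lambda>(t, x). G t x) ` (T \<times> X))"
      by (intro compact_imp_bounded compact_continuous_image that compact_Times assms)
    then show ?thesis unfolding bounded_iff by auto
  qed
  from bdd[of F] bdd[of F'] assms(3) obtain K K' where
    "\<forall>t\<in>T. \<forall>x\<in>X. norm (F t x) \<le> K" "\<forall>t\<in>T. \<forall>x\<in>X. norm (F' t x) \<le> K'"
    by (auto simp: C1_family_def)
  then show ?thesis
    by (intro C1_closeI[where F' = "\<lambda>\<delta>. F'"] O_close_fixed[where K = K] O_close_fixed[where K = K'])
       (use assms(3) in auto)
qed

lemma C1_close_add:
  assumes "C1_close \<iota> T X F" "C1_close \<iota> T X G"
  shows "C1_close \<iota> T X (\<lambda>\<delta> t x. F \<delta> t x + G \<delta> t x)"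
proof -
  from C1_closeE[OF assms(1)] obtain F' where F: "\<forall>\<^sub>F \<delta> in near0. C1_family \<iota> T X (F \<delta>) (F' \<delta>)"
    "O_close T X F" "O_close T X F'" .
  from C1_closeE[OF assms(2)] obtain G' where G: "\<forall>\<^sub>F \<delta> in near0. C1_family \<iota> T X (G \<delta>) (G' \<delta>)"
    "O_close T X G" "O_close T X G'" .
  show ?thesis
    by (rule C1_closeI[where F' = "\<lambda>\<delta> t x. F' \<delta> t x + G' \<delta> t x"])
       (use F(1) G(1) in eventually_elim, (intro C1_family_add O_close_add F G; assumption)+)
qed

lemma C1_close_mult:
  assumes "C1_close \<iota> T X F" "C1_close \<iota> T X G"
  shows "C1_close \<iota> T X (\<lambda>\<delta> t x. F \<delta> t x * G \<delta> t x)"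
proof -
  from C1_closeE[OF assms(1)] obtain F' where F: "\<forall>\<^sub>F \<delta> in near0. C1_family \<iota> T X (F \<delta>) (F' \<delta>)"
    "O_close T X F" "O_close T X F'" .
  from C1_closeE[OF assms(2)] obtain G' where G: "\<forall>\<^sub>F \<delta> in near0. C1_family \<iota> T X (G \<delta>) (G' \<delta>)"
    "O_close T X G" "O_close T X G'" .
  show ?thesis
    by (rule C1_closeI[where F' = "\<lambda>\<delta> t x. F \<delta> t x * G' \<delta> t x + F' \<delta> t x * G \<delta> t x"])
       (use F(1) G(1) in eventually_elim, (intro C1_family_mult O_close_add O_close_mult F G; assumption)+)
qed

lemma C1_close_minus: "C1_close \<iota> T X F \<Longrightarrow> C1_close \<iota> T X (\<lambda>\<delta> t x. - F \<delta> t x)"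
  using C1_close_mult[OF C1_close_const[of \<iota> T X "-1"]] by simp

lemma C1_close_diff:
  "C1_close \<iota> T X F \<Longrightarrow> C1_close \<iota> T X G \<Longrightarrow> C1_close \<iota> T X (\<lambda>\<delta> t x. F \<delta> t x - G \<delta> t x)"
  using C1_close_add[OF _ C1_close_minus] by force

lemma C1_close_inverse:
  assumes "C1_close \<iota> T X F" "c > 0" "\<forall>t\<in>T. \<forall>x\<in>X. norm (F 0 t x) \<ge> c"
  shows "C1_close \<iota> T X (\<lambda>\<delta> t x. inverse (F \<delta> t x))"
proof -
  from C1_closeE[OF assms(1)] obtain F' where F: "\<forall>\<^sub>F \<delta> in near0. C1_family \<iota> T X (F \<delta>) (F' \<delta>)"
    "O_close T X F" "O_close T X F'" .
  note inv = O_close_inverse[OF F(2) assms(2,3)]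
  show ?thesis
  proof (rule C1_closeI[where F' = "\<lambda>\<delta> t x. (- (inverse (F \<delta> t x) * inverse (F \<delta> t x))) * F' \<delta> t x"])
    show "\<forall>\<^sub>F \<delta> in near0. C1_family \<iota> T X (\<lambda>t x. inverse (F \<delta> t x))
        (\<lambda>t x. (- (inverse (F \<delta> t x) * inverse (F \<delta> t x))) * F' \<delta> t x)"
      using F(1) O_close_inverse_bounds[OF F(2) assms(2,3), simplified]
    proof eventually_elim
      case (elim \<delta>)
      have "F \<delta> t x \<noteq> 0" if "t \<in> T" "x \<in> X" for t x
        using elim(2) that assms(2) by fastforce
      then show ?case
        by (intro C1_family_compose[OF elim(1), where \<phi>' = "\<lambda>w. - (inverse w * inverse w)"])
           (auto intro!: derivative_eq_intros continuous_intros)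
    qed
  qed (intro inv O_close_mult O_close_minus F)+
qed

lemma C1_close_entire:
  assumes "\<phi> holomorphic_on UNIV" "C1_close \<iota> T X F"
  shows "C1_close \<iota> T X (\<lambda>\<delta> t x. \<phi> (of_real \<delta> * F \<delta> t x))"
proof -
  from C1_closeE[OF C1_close_mult[OF C1_close_parameter assms(2)]] obtain F' where
    F: "\<forall>\<^sub>F \<delta> in near0. C1_family \<iota> T X (\<lambda>t x. of_real \<delta> * F \<delta> t x) (F' \<delta>)" "O_close T X F'" .
  have d: "deriv \<phi> holomorphic_on UNIV" using assms(1) by (auto intro: holomorphic_deriv)
  show ?thesis
  proof (rule C1_closeI[where F' = "\<lambda>\<delta> t x. deriv \<phi> (of_real \<delta> * F \<delta> t x) * F' \<delta> t x"])
    show "\<forall>\<^sub>F \<delta> in near0. C1_family \<iota> T X (\<lambda>t x. \<phi> (of_real \<delta> * F \<delta> t x))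
        (\<lambda>t x. deriv \<phi> (of_real \<delta> * F \<delta> t x) * F' \<delta> t x)"
      using F(1)
    proof eventually_elim
      case (elim \<delta>)
      show ?case
      proof (rule C1_family_compose[OF elim])
        show "(\<phi> has_field_derivative deriv \<phi> w) (at w)" for w
          using holomorphic_derivI[OF assms(1)] by auto
        show "isCont (deriv \<phi>) w" for w
          using holomorphic_on_imp_continuous_on[OF d] by (simp add: continuous_on_eq_continuous_at)
      qed
    qed
    have "O_close T X F" using assms(2) unfolding C1_close_def by blast
    from O_close_entire[OF assms(1) this] O_close_mult[OF O_close_entire[OF d this] F(2)]
    show "O_close T X (\<lambda>\<delta> t x. \<phi> (of_real \<delta> * F \<delta> t x))"
      "O_close T X (\<lambda>\<delta> t x. deriv \<phi> (of_real \<delta> * F \<delta> t x) * F' \<delta> t x)" .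
  qed
qed

lemma O_close_independent:
  "O_close T {y} G \<Longrightarrow> O_close T X (\<lambda>\<delta> t x. G \<delta> t y)"
  unfolding O_close_def by (elim exE, rule exI, erule eventually_mono) blast

text \<open>For a family without x the set X is a mere placeholder, so a one-point set
  decides.\<close>

lemma C1_close_independent:
  assumes "C1_close \<iota> T {y} (\<lambda>\<delta> t x. f \<delta> t)"
  shows "C1_close \<iota> T X (\<lambda>\<delta> t x. f \<delta> t)"
proof -
  from C1_closeE[OF assms] obtain F' where F: "\<forall>\<^sub>F \<delta> in near0. C1_family \<iota> T {y} (\<lambda>t x. f \<delta> t) (F' \<delta>)"
    "O_close T {y} (\<lambda>\<delta> t x. f \<delta> t)" "O_close T {y} F'" .
  show ?thesis
  proof (rule C1_closeI[where F' = "\<lambda>\<delta> t x. F' \<delta> t y"])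
    show "\<forall>\<^sub>F \<delta> in near0. C1_family \<iota> T X (\<lambda>t x. f \<delta> t) (\<lambda>t x. F' \<delta> t y)"
      using F(1)
    proof eventually_elim
      case (elim \<delta>)
      have "continuous_on T (\<lambda>t. G t y)" if "continuous_on (T \<times> {y}) (\<lambda>(t, x). G t x)" for G :: "'a \<Rightarrow> 'b \<Rightarrow> complex"
      proof -
        have "continuous_on T (\<lambda>t. (t, y))" by (intro continuous_intros)
        from continuous_on_compose2[OF that this] show ?thesis by (simp add: image_subset_iff)
      qed
      from this[of "\<lambda>t x. f \<delta> t"] this[of "F' \<delta>"] elim
      have c: "continuous_on T (f \<delta>)" "continuous_on T (\<lambda>t. F' \<delta> t y)" by (simp_all add: C1_family_def)
      have "continuous_on (T \<times> X) (\<lambda>p. f \<delta> (fst p))" "continuous_on (T \<times> X) (\<lambda>p. F' \<delta> (fst p) y)"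
        by (rule continuous_on_compose2[OF c(1) continuous_on_fst[OF continuous_on_id]], force)
           (rule continuous_on_compose2[OF c(2) continuous_on_fst[OF continuous_on_id]], force)
      then show ?case using elim by (auto simp: C1_family_def case_prod_unfold)
    qed
  qed (rule O_close_independent[OF F(2)] O_close_independent[OF F(3)])+
qed

text \<open>The flow depends on a and b beyond linear factors only through the product a b. Since it
  carries a factor \<delta>, the entire functions are evaluated near 0, where
  \<open>C1_close_entire\<close> applies.\<close>

lemma C1_close_wave_step:
  assumes "C1_close \<iota> T X a" "C1_close \<iota> T X b" "C1_close \<iota> T X (\<lambda>\<delta> t x. of_real (y x))"
    and ab: "\<And>\<delta> t x. a \<delta> t x * b \<delta> t x = of_real \<delta> * g \<delta> t x" and "C1_close \<iota> T X g"
    and "C1_close \<iota> T X (\<lambda>\<delta> t x. fst (p \<delta> t x))" "C1_close \<iota> T X (\<lambda>\<delta> t x. snd (p \<delta> t x))"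
  shows "C1_close \<iota> T X (\<lambda>\<delta> t x. fst (wave_step (a \<delta> t x) (b \<delta> t x) (y x) (p \<delta> t x)))"
    and "C1_close \<iota> T X (\<lambda>\<delta> t x. snd (wave_step (a \<delta> t x) (b \<delta> t x) (y x) (p \<delta> t x)))"
proof -
  have y2: "C1_close \<iota> T X (\<lambda>\<delta> t x. g \<delta> t x * (of_real (y x) * of_real (y x)))"
    by (intro C1_close_mult assms)
  note C = C1_close_entire[OF cos_sqrt_holomorphic y2] and S = C1_close_entire[OF sinc_sqrt_holomorphic y2]
  have eq: "wave_step (a \<delta> t x) (b \<delta> t x) (y x) (p \<delta> t x) =
    (cos_sqrt (of_real \<delta> * (g \<delta> t x * (of_real (y x) * of_real (y x)))) * fst (p \<delta> t x) +
       a \<delta> t x * (of_real (y x) * sinc_sqrt (of_real \<delta> * (g \<delta> t x * (of_real (y x) * of_real (y x))))) * snd (p \<delta> t x),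
     cos_sqrt (of_real \<delta> * (g \<delta> t x * (of_real (y x) * of_real (y x)))) * snd (p \<delta> t x) -
       b \<delta> t x * (of_real (y x) * sinc_sqrt (of_real \<delta> * (g \<delta> t x * (of_real (y x) * of_real (y x))))) * fst (p \<delta> t x))"
    for \<delta> t x
    unfolding wave_step_def ab by (simp add: power2_eq_square mult.assoc)
  show "C1_close \<iota> T X (\<lambda>\<delta> t x. fst (wave_step (a \<delta> t x) (b \<delta> t x) (y x) (p \<delta> t x)))"
    "C1_close \<iota> T X (\<lambda>\<delta> t x. snd (wave_step (a \<delta> t x) (b \<delta> t x) (y x) (p \<delta> t x)))"
    unfolding eq fst_conv snd_conv
    by (intro C1_close_add C1_close_diff C1_close_mult C S assms)+
qed

section \<open>Waves in the high-contrast cell\<close>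

text \<open>The layers of a cell with even index are resonators, those with odd index are gaps.\<close>

definition layer_a :: "real \<Rightarrow> nat \<Rightarrow> complex" where
  "layer_a \<delta> k = (if even k then of_real \<delta> else 1)"

definition layer_b :: "(nat \<Rightarrow> complex) \<Rightarrow> real \<Rightarrow> nat \<Rightarrow> complex" where
  "layer_b M \<delta> k = M k * (if even k then 1 else of_real \<delta>)"

text \<open>Exactly one of the two coefficients is small in each layer, which is the hypothesis on
  the product in \<open>C1_close_wave_step\<close>.\<close>

lemma layer_a_mult_b: "layer_a \<delta> k * (layer_b M \<delta> k * m) = of_real \<delta> * (M k * m)"
  by (simp add: layer_a_def layer_b_def)

lemma C1_close_layer_a: "C1_close \<iota> T X (\<lambda>\<delta> t x. layer_a \<delta> k)"
  by (cases "even k") (simp_all add: layer_a_def C1_close_parameter C1_close_const)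

lemma C1_close_layer_b: "C1_close \<iota> T X (\<lambda>\<delta> t x. layer_b M \<delta> k)"
  unfolding layer_b_def
  by (rule C1_close_mult[OF C1_close_const], cases "even k") (simp_all add: C1_close_parameter C1_close_const)

abbreviation medium_state where
  "medium_state M c \<delta> \<mu> \<equiv> layer_state (layer_a \<delta>) (\<lambda>k. layer_b M \<delta> k * \<mu>) c"

abbreviation medium_wave where
  "medium_wave M c \<delta> \<mu> \<equiv> layer_wave (layer_a \<delta>) (\<lambda>k. layer_b M \<delta> k * \<mu>) c"

lemma C1_close_medium_state:
  assumes "C1_close \<iota> T X (\<lambda>\<delta> t x. \<mu> \<delta> t)"
    and "C1_close \<iota> T X (\<lambda>\<delta> t x. u \<delta> t)" "C1_close \<iota> T X (\<lambda>\<delta> t x. q \<delta> t)"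
  shows "C1_close \<iota> T X (\<lambda>\<delta> t x. fst (medium_state M c \<delta> (\<mu> \<delta> t) (u \<delta> t, q \<delta> t) k))"
    and "C1_close \<iota> T X (\<lambda>\<delta> t x. snd (medium_state M c \<delta> (\<mu> \<delta> t) (u \<delta> t, q \<delta> t) k))"
proof (induction k)
  case (Suc k)
  case 1
  show ?case unfolding layer_state.simps
    by (rule C1_close_wave_step(1)[where g = "\<lambda>\<delta> t x. M k * \<mu> \<delta> t"])
       (intro C1_close_layer_a C1_close_layer_b C1_close_mult C1_close_const assms Suc layer_a_mult_b)+
  case 2
  show ?case unfolding layer_state.simps
    by (rule C1_close_wave_step(2)[where g = "\<lambda>\<delta> t x. M k * \<mu> \<delta> t"])
       (intro C1_close_layer_a C1_close_layer_b C1_close_mult C1_close_const assms Suc layer_a_mult_b)+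
qed (simp_all add: assms)

lemma C1_close_medium_wave:
  assumes "compact T" "compact X" "C1_close \<iota> T X (\<lambda>\<delta> t x. \<mu> \<delta> t)"
    and "C1_close \<iota> T X (\<lambda>\<delta> t x. u \<delta> t)" "C1_close \<iota> T X (\<lambda>\<delta> t x. q \<delta> t)"
  shows "C1_close \<iota> T X (\<lambda>\<delta> t x. fst (medium_wave M c \<delta> (\<mu> \<delta> t) (u \<delta> t, q \<delta> t) k x))"
proof -
  have "C1_family \<iota> T X (\<lambda>t x. of_real (x - c k)) (\<lambda>t x. 0)"
    unfolding C1_family_def by (auto simp: case_prod_unfold intro!: continuous_intros)
  then have y: "C1_close \<iota> T X (\<lambda>\<delta> t x. of_real (x - c k))"
    by (rule C1_close_fixed[OF assms(1,2)])
  show ?thesis unfolding layer_wave_def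
    by (rule C1_close_wave_step(1)[where g = "\<lambda>\<delta> t x. M k * \<mu> \<delta> t" and y = "\<lambda>x. x - c k"])
       (intro C1_close_layer_a C1_close_layer_b C1_close_mult C1_close_const assms y layer_a_mult_b
         C1_close_medium_state)+
qed

section \<open>The band as a simple root of the dispersion relation\<close>

lemma has_vector_derivative_iff_tendsto:
  fixes f :: "real \<Rightarrow> complex"
  shows "(f has_vector_derivative D) (at t) \<longleftrightarrow> ((\<lambda>s. (f s - f t) / of_real (s - t)) \<longlongrightarrow> D) (at t)"
  by (simp only: has_vector_derivative_complex_iff has_field_derivative_iff tendsto_complex_iff
      Re_divide_of_real Im_divide_of_real minus_complex.sel)

text \<open>Only continuity of m is known beforehand. Caratheodory's factorisation \<phi> z - \<phi>
  (m t) = g z (z - m t) allows the difference quotient of \<phi> o m to be divided by g (m s), which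
  tends to D.\<close>

lemma implicit_root_has_vector_derivative:
  fixes m :: "real \<Rightarrow> complex"
  assumes \<phi>: "(\<phi> has_field_derivative D) (at (m t))" and "D \<noteq> 0" and m: "isCont m t"
    and k: "((\<lambda>s. \<phi> (m s)) has_vector_derivative k') (at t)"
  shows "(m has_vector_derivative k' / D) (at t)"
proof -
  from \<phi> obtain g where g: "\<And>z. \<phi> z - \<phi> (m t) = g z * (z - m t)" "isCont g (m t)" "g (m t) = D"
    unfolding CARAT_DERIV by auto
  have "isCont (\<lambda>s. g (m s)) t" using isCont_o2[OF m g(2)] .
  then have gm: "((\<lambda>s. g (m s)) \<longlongrightarrow> D) (at t)" using g(3) by (simp add: isCont_def)
  have "\<forall>\<^sub>F s in at t. g (m s) \<noteq> 0"
    using tendsto_imp_eventually_ne[OF gm \<open>D \<noteq> 0\<close>] .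
  then have ev: "\<forall>\<^sub>F s in at t. (\<phi> (m s) - \<phi> (m t)) / of_real (s - t) / g (m s) = (m s - m t) / of_real (s - t)"
  proof eventually_elim
    case (elim s)
    show ?case unfolding g(1) using elim by simp
  qed
  have "((\<lambda>s. (\<phi> (m s) - \<phi> (m t)) / of_real (s - t) / g (m s)) \<longlongrightarrow> k' / D) (at t)"
    using k unfolding has_vector_derivative_iff_tendsto
    by (intro tendsto_divide gm \<open>D \<noteq> 0\<close>)
  then have "((\<lambda>s. (m s - m t) / of_real (s - t)) \<longlongrightarrow> k' / D) (at t)"
    using tendsto_cong[OF ev] by simp
  then show ?thesis unfolding has_vector_derivative_iff_tendsto .
qed

text \<open>
  By continuity in \<open>t\<close> a root of \<open>\<tau> \<delta> = \<kappa> t\<close> cannot jump from the neighbourhood of one root of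
  the limiting quadratic to the other one, which makes pointwise convergence at \<open>t0\<close> uniform.
\<close>

lemma C1_close_simple_root:
  fixes \<tau> :: "real \<Rightarrow> complex \<Rightarrow> complex" and m :: "real \<Rightarrow> real \<Rightarrow> complex" and X :: "real set"
  assumes t0: "t0 \<in> {a..b}"
    and \<tau>: "\<And>R. C1_close (\<lambda>z. z) (cball 0 R) {0::real} (\<lambda>\<delta> z x. \<tau> \<delta> z)"
    and factor: "\<And>t z. \<tau> 0 z - \<kappa> t = C * (z - m 0 t) * (z - m2 t)" and C: "C \<noteq> 0"
    and cont: "continuous_on UNIV (m 0)" "continuous_on UNIV m2" and ne: "\<And>t. m 0 t \<noteq> m2 t"
    and root: "\<forall>\<^sub>F \<delta> in at_right 0. continuous_on UNIV (m \<delta>) \<and> (\<forall>t. \<tau> \<delta> (m \<delta> t) = \<kappa> t)"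
    and lim: "((\<lambda>\<delta>. m \<delta> t0) \<longlongrightarrow> m 0 t0) (at_right 0)"
    and \<kappa>': "\<And>t. (\<kappa> has_vector_derivative \<kappa>' t) (at t)" "continuous_on UNIV \<kappa>'"
  shows "C1_close of_real {a..b} X (\<lambda>\<delta> t x. m \<delta> t)"
proof -
  define T where "T = {a..b}"
  have T: "compact T" "T \<noteq> {}" "t0 \<in> T" using t0 by (auto simp: T_def)
  have cT: "continuous_on T (m 0)" "continuous_on T m2" using cont continuous_on_subset by blast+
  obtain d where d: "d > 0" "\<And>t. t \<in> T \<Longrightarrow> d \<le> norm (m 0 t - m2 t)"
  proof -
    have "continuous_on T (\<lambda>t. norm (m 0 t - m2 t))" by (intro continuous_intros cT)
    from continuous_attains_inf[OF T(1,2) this] obtain s where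
      "s \<in> T" "\<And>t. t \<in> T \<Longrightarrow> norm (m 0 s - m2 s) \<le> norm (m 0 t - m2 t)" by blast
    then show thesis using that[of "norm (m 0 s - m2 s)"] ne[of s] by auto
  qed
  obtain R where R: "\<And>t. t \<in> T \<Longrightarrow> norm (m 0 t) \<le> R"
    using compact_imp_bounded[OF compact_continuous_image[OF cT(1) T(1)]] unfolding bounded_iff by auto
  define B where "B = cball (0::complex) (R + 1)"
  from C1_closeE[OF \<tau>[of "R + 1"]] obtain D0 where D0: "\<forall>\<^sub>F \<delta> in near0. C1_family (\<lambda>z. z) B {0::real} (\<lambda>z x. \<tau> \<delta> z) (D0 \<delta>)"
    "O_close B {0::real} (\<lambda>\<delta> z x. \<tau> \<delta> z)" "O_close B {0::real} D0" unfolding B_def .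
  define D where "D = (\<lambda>\<delta> z. D0 \<delta> z 0)"
  from O_closeE[OF D0(2)] obtain K1 where K1: "K1 > 0" "\<forall>\<^sub>F \<delta> in near0. O_bound K1 B {0::real} (\<lambda>\<delta> z x. \<tau> \<delta> z) \<delta>" .
  from O_closeE[OF D0(3)] obtain K2 where K2: "K2 > 0" "\<forall>\<^sub>F \<delta> in near0. O_bound K2 B {0::real} D0 \<delta>" .
  have \<tau>': "(\<tau> \<delta> has_field_derivative D \<delta> z) (at z)" and Dcont: "continuous_on B (D \<delta>)"
    if "C1_family (\<lambda>z. z) B {0::real} (\<lambda>z x. \<tau> \<delta> z) (D0 \<delta>)" "z \<in> B" for \<delta> z
  proof -
    show "(\<tau> \<delta> has_field_derivative D \<delta> z) (at z)"
    proof -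
      have "(\<tau> \<delta> has_derivative (\<lambda>h. h * D0 \<delta> z 0)) (at z)"
        using that by (auto simp: C1_family_def)
      also have "(\<lambda>h. h * D0 \<delta> z 0) = (*) (D \<delta> z)" by (auto simp: D_def mult.commute)
      finally show ?thesis unfolding has_field_derivative_def .
    qed
    have c: "continuous_on (B \<times> {0::real}) (\<lambda>(z, x). D0 \<delta> z x)"
      using that by (simp add: C1_family_def)
    have "continuous_on B (\<lambda>z. (z, 0::real))" by (intro continuous_intros)
    from continuous_on_compose2[OF c this]
    show "continuous_on B (D \<delta>)" by (simp add: image_subset_iff D_def)
  qed
  \<comment> \<open>Within distance r the root stays in B, of radius R + 1, and at distance at least
    d / 2 from the other root. Then |C| |m \<delta> t - m 0 t| d / 2 is at most K1 \<delta>, which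
    is the origin of K.\<close>
  define r where "r = min 1 (d / 2)"
  define K where "K = 2 * K1 / (norm C * d)"
  have r: "r > 0" "r \<le> 1" "r \<le> d / 2" using d by (auto simp: r_def)
  have K: "K > 0" using d K1 C by (auto simp: K_def)
  have root0: "\<forall>\<^sub>F \<delta> in near0. continuous_on UNIV (m \<delta>) \<and> (\<forall>t. \<tau> \<delta> (m \<delta> t) = \<kappa> t)"
    unfolding eventually_near0 using root cont factor[of "m 0 t" t for t] by auto
  have lim0: "\<forall>\<^sub>F \<delta> in near0. norm (m \<delta> t0 - m 0 t0) < r"
    unfolding eventually_near0 using tendstoD[OF lim r(1)] r(1) by (auto simp: dist_norm)
  have inB: "m \<delta> t \<in> B" if "t \<in> T" "norm (m \<delta> t - m 0 t) \<le> r" for \<delta> t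
    using R[OF that(1)] that(2) r(2) norm_triangle_ineq2[of "m \<delta> t" "m 0 t"] by (simp add: B_def)
  have close: "\<forall>\<^sub>F \<delta> in near0. \<forall>t\<in>T. norm (m \<delta> t - m 0 t) \<le> K * \<delta> \<and> norm (m \<delta> t - m 0 t) \<le> r"
    using root0 lim0 K1(2) eventually_near0_less[OF r(1), of K]
  proof eventually_elim
    case (elim \<delta>)
    have small: "norm (m \<delta> t - m 0 t) \<le> K * \<delta>" if t: "t \<in> T" "norm (m \<delta> t - m 0 t) \<le> r" for t
    proof -
      have "norm (\<tau> \<delta> (m \<delta> t) - \<tau> 0 (m \<delta> t)) \<le> K1 * \<delta>" using elim inB[OF t] by (auto simp: O_bound_def)
      then have "norm (\<tau> 0 (m \<delta> t) - \<kappa> t) \<le> K1 * \<delta>" using elim by (simp add: norm_minus_commute)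
      then have 1: "norm C * norm (m \<delta> t - m 0 t) * norm (m \<delta> t - m2 t) \<le> K1 * \<delta>"
        unfolding factor norm_mult .
      have "norm (m 0 t - m2 t) \<le> norm (m \<delta> t - m 0 t) + norm (m \<delta> t - m2 t)"
        using norm_triangle_ineq[of "m 0 t - m \<delta> t" "m \<delta> t - m2 t"] by (simp add: norm_minus_commute)
      then have "norm (m \<delta> t - m2 t) \<ge> d / 2" using d(2)[OF t(1)] t(2) r(3) by linarith
      then have "norm C * norm (m \<delta> t - m 0 t) * (d / 2) \<le> norm C * norm (m \<delta> t - m 0 t) * norm (m \<delta> t - m2 t)"
        by (intro mult_left_mono) auto
      with 1 have "norm C * norm (m \<delta> t - m 0 t) * (d / 2) \<le> K1 * \<delta>" by linarith
      then show ?thesis using d(1) C by (simp add: K_def field_simps)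
    qed
    \<comment> \<open>The distance is below r at t0. If it reached r anywhere, it would equal r at
      some s by connectedness, and there \<open>small\<close> would give r \<le> K \<delta> <
      r.\<close>
    have lt: "norm (m \<delta> t - m 0 t) < r" if t: "t \<in> T" for t
    proof (rule ccontr)
      assume nlt: "\<not> norm (m \<delta> t - m 0 t) < r"
      let ?h = "\<lambda>t. norm (m \<delta> t - m 0 t)"
      have "continuous_on T ?h"
        using elim cont by (intro continuous_intros) (auto intro: continuous_on_subset)
      then have "connected (?h ` T)"
        by (intro connected_continuous_image) (auto simp: T_def)
      then have "r \<in> ?h ` T"
        using connectedD_interval[of "?h ` T" "?h t0" "?h t" r] nlt elim(2) t T(3) by auto
      then obtain s where s: "s \<in> T" "?h s = r" by auto
      then show False using small[of s] elim(4) by simp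
    qed
    show ?case using lt small by (meson less_imp_le)
  qed
  have D0eq: "D 0 z = C * ((z - m 0 t) + (z - m2 t))" if "z \<in> B" for z t
  proof -
    have "\<tau> 0 = (\<lambda>z. C * (z - m 0 t) * (z - m2 t) + \<kappa> t)" using factor[of _ t] by (auto simp: algebra_simps)
    moreover have "((\<lambda>z. C * (z - m 0 t) * (z - m2 t) + \<kappa> t) has_field_derivative C * ((z - m 0 t) + (z - m2 t))) (at z)"
      by (auto intro!: derivative_eq_intros simp: algebra_simps)
    ultimately show ?thesis using \<tau>'[OF _ that, of 0] D0(1) DERIV_unique
      by (auto simp: eventually_near0)
  qed
  have OD: "O_close T {0::real} (\<lambda>\<delta> t x. D \<delta> (m \<delta> t))"
    unfolding O_close_def
  proof (rule exI[of _ "K2 + 2 * norm C * K"], use close K2(2) in eventually_elim, intro ballI conjI)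
    fix \<delta> t assume t: "t \<in> T"
    assume "\<forall>t\<in>T. norm (m \<delta> t - m 0 t) \<le> K * \<delta> \<and> norm (m \<delta> t - m 0 t) \<le> r"
      "O_bound K2 B {0::real} D0 \<delta>"
    then have *: "norm (m \<delta> t - m 0 t) \<le> K * \<delta>" "m \<delta> t \<in> B" "norm (D \<delta> (m \<delta> t)) \<le> K2"
      "norm (D \<delta> (m \<delta> t) - D 0 (m \<delta> t)) \<le> K2 * \<delta>" "\<delta> \<ge> 0"
      using t inB[OF t] by (auto simp: D_def O_bound_def)
    have "0 \<le> 2 * norm C * K" using K by simp
    then show "norm (D \<delta> (m \<delta> t)) \<le> K2 + 2 * norm C * K" using *(3) by linarith
    have m0: "m 0 t \<in> B" using inB[OF t, of 0] r(1) by simp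
    have "D 0 (m \<delta> t) - D 0 (m 0 t) = 2 * C * (m \<delta> t - m 0 t)"
      unfolding D0eq[OF *(2), of t] D0eq[OF m0, of t] by (simp add: algebra_simps)
    then have "norm (D 0 (m \<delta> t) - D 0 (m 0 t)) \<le> 2 * norm C * (K * \<delta>)"
      using *(1) by (simp add: norm_mult mult_left_mono)
    then show "norm (D \<delta> (m \<delta> t) - D 0 (m 0 t)) \<le> (K2 + 2 * norm C * K) * \<delta>"
      using *(4) norm_triangle_ineq[of "D \<delta> (m \<delta> t) - D 0 (m \<delta> t)" "D 0 (m \<delta> t) - D 0 (m 0 t)"]
      by (simp add: algebra_simps)
  qed
  \<comment> \<open>At the root m 0 t the derivative of the limiting quadratic is C (m 0 t - m2 t):
    simplicity of the root is the lower bound.\<close>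
  have lower: "norm C * d > 0" "\<forall>t\<in>T. \<forall>x\<in>{0::real}. norm (D 0 (m 0 t)) \<ge> norm C * d"
  proof -
    show "norm C * d > 0" using C d by simp
    show "\<forall>t\<in>T. \<forall>x\<in>{0::real}. norm (D 0 (m 0 t)) \<ge> norm C * d"
    proof (intro ballI)
      fix t assume t: "t \<in> T"
      have "m 0 t \<in> B" using inB[OF t, of 0] r(1) by simp
      from D0eq[OF this, of t] show "norm (D 0 (m 0 t)) \<ge> norm C * d"
        using d(2)[OF t] by (simp add: norm_mult mult_left_mono)
    qed
  qed
  have \<kappa>'b: "O_close T {0::real} (\<lambda>\<delta> t x. \<kappa>' t)"
  proof -
    obtain M where "\<And>t. t \<in> T \<Longrightarrow> norm (\<kappa>' t) \<le> M"
      using compact_imp_bounded[OF compact_continuous_image[OF continuous_on_subset[OF \<kappa>'(2)] T(1)]]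
      unfolding bounded_iff by auto
    then show ?thesis by (rule O_close_fixed)
  qed
  show ?thesis unfolding T_def[symmetric]
  proof (rule C1_close_independent[where y = 0], rule C1_closeI[where F' = "\<lambda>\<delta> t x. \<kappa>' t * inverse (D \<delta> (m \<delta> t))"])
    show "O_close T {0::real} (\<lambda>\<delta> t x. \<kappa>' t * inverse (D \<delta> (m \<delta> t)))"
      by (rule O_close_mult[OF \<kappa>'b O_close_inverse[OF OD lower]])
    show "O_close T {0::real} (\<lambda>\<delta> t x. m \<delta> t)" unfolding O_close_def
    proof (rule exI[of _ "\<bar>R\<bar> + 1 + K"], use close eventually_near0_nonneg in eventually_elim, intro ballI conjI)
      fix \<delta> t :: real assume t: "t \<in> T" and \<delta>: "0 \<le> \<delta>"
      assume "\<forall>t\<in>T. norm (m \<delta> t - m 0 t) \<le> K * \<delta> \<and> norm (m \<delta> t - m 0 t) \<le> r"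
      then have *: "norm (m \<delta> t - m 0 t) \<le> K * \<delta>" "m \<delta> t \<in> B" using t inB[OF t] by auto
      show "norm (m \<delta> t) \<le> \<bar>R\<bar> + 1 + K" using *(2) K by (auto simp: B_def)
      have "K * \<delta> \<le> (\<bar>R\<bar> + 1 + K) * \<delta>" using \<delta> by (intro mult_right_mono) auto
      with * show "norm (m \<delta> t - m 0 t) \<le> (\<bar>R\<bar> + 1 + K) * \<delta>" by linarith
    qed
    show "\<forall>\<^sub>F \<delta> in near0. C1_family of_real T {0::real} (\<lambda>t x. m \<delta> t) (\<lambda>t x. \<kappa>' t * inverse (D \<delta> (m \<delta> t)))"
      using O_close_inverse_bounds[OF OD lower] root0 close D0(1)
    proof eventually_elim
      case (elim \<delta>)
      have in_B: "m \<delta> t \<in> B" if "t \<in> T" for t using elim(3) inB[OF that] that by blast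
      have nz: "D \<delta> (m \<delta> t) \<noteq> 0" if "t \<in> T" for t using elim(1) that lower(1) by fastforce
      have mT: "continuous_on T (m \<delta>)" using elim(2) continuous_on_subset by blast
      \<comment> \<open>Some point of B is required to instantiate \<open>Dcont\<close>.\<close>
      have B0: "(0::complex) \<in> B" using R[OF T(3)] norm_ge_zero[of "m 0 t0"] unfolding B_def
        by (simp del: norm_ge_zero)
      have "continuous_on T (\<lambda>t. D \<delta> (m \<delta> t))"
        by (rule continuous_on_compose2[OF Dcont[OF elim(4) B0] mT]) (use in_B in auto)
      then have F': "continuous_on T (\<lambda>t. \<kappa>' t * inverse (D \<delta> (m \<delta> t)))"
        using nz continuous_on_subset[OF \<kappa>'(2)] by (intro continuous_intros) auto
      have pr: "continuous_on (T \<times> {0::real}) (\<lambda>(t, x). g t)" if "continuous_on T g" for g :: "real \<Rightarrow> complex"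
        unfolding case_prod_unfold
        by (rule continuous_on_compose2[OF that continuous_on_fst[OF continuous_on_id]]) auto
      have "(m \<delta> has_derivative (\<lambda>h. of_real h * (\<kappa>' t * inverse (D \<delta> (m \<delta> t))))) (at t)" if t: "t \<in> T" for t
      proof -
        have "isCont (m \<delta>) t" using elim(2) by (simp add: continuous_on_eq_continuous_at)
        moreover have "((\<lambda>s. \<tau> \<delta> (m \<delta> s)) has_vector_derivative \<kappa>' t) (at t)"
          using elim(2) \<kappa>'(1) by simp
        ultimately have "(m \<delta> has_vector_derivative \<kappa>' t / D \<delta> (m \<delta> t)) (at t)"
          by (rule implicit_root_has_vector_derivative[where \<phi> = "\<tau> \<delta>" and m = "m \<delta>" and t = t, OF \<tau>'[OF elim(4) in_B[OF t]] nz[OF t]])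
        then show ?thesis
          by (simp add: has_vector_derivative_def scaleR_conv_of_real divide_inverse)
      qed
      then show ?case using pr[OF mT] pr[OF F'] by (simp add: C1_family_def)
    qed
  qed
qed

section \<open>The Zak phase of layered modes\<close>

text \<open>With G the running integral of g' / g, the product g exp(-G) is constant; as g takes
  equal values at both ends, exp(G b) = 1.\<close>

lemma integral_logarithmic_derivative_closed:
  fixes g g' :: "real \<Rightarrow> complex"
  assumes "a \<le> b" and g': "\<And>t. t \<in> {a..b} \<Longrightarrow> (g has_vector_derivative g' t) (at t within {a..b})"
    and cont: "continuous_on {a..b} g'" and nz: "\<And>t. t \<in> {a..b} \<Longrightarrow> g t \<noteq> 0" and "g a = g b"
  shows "\<exists>n::int. integral {a..b} (\<lambda>t. g' t / g t) = of_real (2 * pi * of_int n) * \<i>"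
proof -
  have cg: "continuous_on {a..b} g"
    using g' has_vector_derivative_continuous continuous_on_eq_continuous_within by blast
  have cq: "continuous_on {a..b} (\<lambda>t. g' t / g t)" using nz by (intro continuous_intros cont cg) auto
  define G where "G = (\<lambda>t. integral {a..t} (\<lambda>t. g' t / g t))"
  define E where "E = (\<lambda>t. g t * exp (- G t))"
  have "(E has_vector_derivative 0) (at t within {a..b})" if t: "t \<in> {a..b}" for t
  proof -
    have "(G has_vector_derivative g' t / g t) (at t within {a..b})"
      unfolding G_def by (rule integral_has_vector_derivative[OF cq t])
    from field_vector_diff_chain_within[OF has_vector_derivative_minus[OF this] DERIV_exp[THEN has_field_derivative_at_within]]
    have "((\<lambda>t. exp (- G t)) has_vector_derivative - (g' t / g t) * exp (- G t)) (at t within {a..b})"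
      by (simp add: o_def)
    from has_vector_derivative_mult[OF g'[OF t] this]
    have "(E has_vector_derivative g t * (- (g' t / g t) * exp (- G t)) + g' t * exp (- G t)) (at t within {a..b})"
      unfolding E_def .
    also have "g t * (- (g' t / g t) * exp (- G t)) + g' t * exp (- G t) = 0" using nz[OF t] by simp
    finally show ?thesis .
  qed
  then obtain c where "\<And>t. t \<in> {a..b} \<Longrightarrow> E t = c"
    using has_vector_derivative_zero_constant[of "{a..b}" E] by auto
  then have "E b = E a" using assms(1) by auto
  then have "exp (- G b) = 1" using nz[of a] assms(1,5) by (simp add: E_def G_def)
  then have "exp (G b) = 1" by (simp add: exp_minus)
  then obtain n :: int where "Re (G b) = 0" "Im (G b) = of_int (2 * n) * pi" unfolding exp_eq_1 by auto
  then have "G b = of_real (2 * pi * of_int n) * \<i>" by (simp add: complex_eq_iff)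
  then show ?thesis unfolding G_def by blast
qed

text \<open>The values stay in the right half-plane, where the principal logarithm gives a
  primitive.\<close>

lemma integral_logarithmic_derivative_near_1:
  fixes g g' :: "real \<Rightarrow> complex"
  assumes "a \<le> b" and g': "\<And>t. t \<in> {a..b} \<Longrightarrow> (g has_vector_derivative g' t) (at t within {a..b})"
    and near: "\<And>t. t \<in> {a..b} \<Longrightarrow> norm (g t - 1) < 1" and "g a = g b"
  shows "integral {a..b} (\<lambda>t. g' t / g t) = 0"
proof -
  have "((\<lambda>t. g' t / g t) has_integral Ln (g b) - Ln (g a)) {a..b}"
  proof (rule fundamental_theorem_of_calculus[OF assms(1)])
    fix t assume t: "t \<in> {a..b}"
    have "Re (g t) > 0" using near[OF t] abs_Re_le_cmod[of "g t - 1"] by simp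
    then have "g t \<notin> \<real>\<^sub>\<le>\<^sub>0" by (auto simp: complex_nonpos_Reals_iff)
    from field_vector_diff_chain_within[OF g'[OF t] has_field_derivative_Ln[OF this, THEN has_field_derivative_at_within]]
    show "((\<lambda>t. Ln (g t)) has_vector_derivative g' t / g t) (at t within {a..b})"
      by (simp add: o_def divide_inverse)
  qed
  then show ?thesis using assms(4) by (simp add: integral_unique)
qed

lemma integral_odd_eq_0:
  fixes f :: "real \<Rightarrow> 'a::euclidean_space"
  assumes "\<And>x. x \<in> {- c..c} \<Longrightarrow> f (- x) = - f x"
  shows "integral {- c..c} f = 0"
proof -
  have "integral {- c..c} f = integral {- c..c} (\<lambda>x. f (- x))"
    using Henstock_Kurzweil_Integration.integral_reflect_real[of c "- c" f] by simp
  also have "\<dots> = integral {- c..c} (\<lambda>x. - f x)"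
    by (rule Henstock_Kurzweil_Integration.integral_cong) (rule assms)
  also have "\<dots> = - integral {- c..c} f" by (rule integral_neg)
  finally show ?thesis by (simp add: eq_neg_iff_add_eq_0 flip: scaleR_2)
qed

text \<open>Agreement is required only inside the layers: left modes may jump at interfaces together
  with the bulk modulus. The endpoints form a finite set.\<close>

lemma has_integral_layers:
  fixes f :: "real \<Rightarrow> complex"
  assumes "\<And>k. k < n \<Longrightarrow> c k < c (Suc k)"
    and "\<And>k x. k < n \<Longrightarrow> x \<in> {c k<..<c (Suc k)} \<Longrightarrow> f x = F k x"
    and "\<And>k. k < n \<Longrightarrow> continuous_on {c k..c (Suc k)} (F k)"
  shows "(f has_integral (\<Sum>k<n. integral {c k..c (Suc k)} (F k))) {c 0..c n}"
  using assms
proof (induction n)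
  case (Suc n)
  have mono: "c 0 \<le> c m" if "m \<le> n" for m
    using that
  proof (induction m)
    case (Suc m)
    then show ?case using Suc.prems Suc.IH \<open>\<And>k. k < Suc n \<Longrightarrow> c k < c (Suc k)\<close>[of m] by simp
  qed simp
  have "(F n has_integral integral {c n..c (Suc n)} (F n)) {c n..c (Suc n)}"
    using Suc.prems(3) by (intro integrable_integral integrable_continuous_interval) auto
  then have "(f has_integral integral {c n..c (Suc n)} (F n)) {c n..c (Suc n)}"
    by (rule has_integral_spike_finite[of "{c n, c (Suc n)}", rotated 2]) (use Suc.prems(2) in auto)
  moreover have "(f has_integral (\<Sum>k<n. integral {c k..c (Suc k)} (F k))) {c 0..c n}"
    by (rule Suc.IH) (use Suc.prems in auto)
  ultimately have "(f has_integral (\<Sum>k<n. integral {c k..c (Suc k)} (F k)) + integral {c n..c (Suc n)} (F n)) {c 0..c (Suc n)}"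
    using mono[of n] Suc.prems(1)[of n] by (intro has_integral_combine[of "c 0" "c n" "c (Suc n)"]) auto
  then show ?case by simp
qed (simp add: has_integral_refl)

lemma C1_family_vector_derivative:
  assumes "C1_family of_real T X F F'" "t \<in> T" "x \<in> X"
  shows "((\<lambda>s. F s x) has_vector_derivative F' t x) (at t)"
  using assms by (simp add: C1_family_def has_vector_derivative_def scaleR_conv_of_real)

lemma continuous_on_slice:
  assumes "continuous_on (T \<times> X) (\<lambda>(t, x). F t x)" "t \<in> T"
  shows "continuous_on X (F t)"
proof -
  have "continuous_on X (\<lambda>x. (t, x))" by (intro continuous_intros)
  from continuous_on_compose2[OF assms(1) this] show ?thesis
    using assms(2) by (simp add: image_subset_iff)
qed

lemma continuous_on_integral_product:
  fixes F G :: "real \<Rightarrow> real \<Rightarrow> complex"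
  assumes "continuous_on (T \<times> {a..b}) (\<lambda>(t, x). F t x)" "continuous_on (T \<times> {a..b}) (\<lambda>(t, x). G t x)"
  shows "continuous_on T (\<lambda>t. integral {a..b} (\<lambda>x. F t x * G t x))"
  using integral_continuous_on_param[of T a b "\<lambda>t x. F t x * G t x"] assms
  by (simp add: case_prod_unfold continuous_on_mult)

section \<open>Pairings of layered modes and removal of the gauge\<close>

text \<open>Bilinear rather than sesquilinear: F stands for the wave part of the conjugated left
  mode, and the weights B k carry the factor that divides by the bulk modulus.\<close>

definition layer_pairing ::
  "nat \<Rightarrow> (nat \<Rightarrow> real) \<Rightarrow> (nat \<Rightarrow> complex) \<Rightarrow> (nat \<Rightarrow> real \<Rightarrow> complex) \<Rightarrow> (nat \<Rightarrow> real \<Rightarrow> complex) \<Rightarrow> complex" where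
  "layer_pairing n c B F G = (\<Sum>k<n. B k * integral {c k..c (Suc k)} (\<lambda>x. F k x * G k x))"

text \<open>
  Factoring the values \<open>g\<close>, \<open>h\<close> at the origin out of the modes separates the gauge-dependent
  integrals of \<open>g'/g\<close> and \<open>h'/h\<close> from an integral over normalised modes.
\<close>

lemma zak_phase_normalised:
  fixes u v g h g' h' :: "_" and U V U' V' :: "nat \<Rightarrow> real \<Rightarrow> real \<Rightarrow> complex"
  assumes L: "L > 0" and c: "c 0 = 0" "c n = L" "\<And>k. k < n \<Longrightarrow> c k < c (Suc k)"
    and U: "\<And>k. k < n \<Longrightarrow> C1_family of_real {- (2 * pi / L)..2 * pi / L} {c k..c (Suc k)} (U k) (U' k)"
    and V: "\<And>k. k < n \<Longrightarrow> C1_family of_real {- (2 * pi / L)..2 * pi / L} {c k..c (Suc k)} (V k) (V' k)"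
    and g: "\<And>t. (g has_vector_derivative g' t) (at t)" "continuous_on UNIV g'"
    and h: "\<And>t. (h has_vector_derivative h' t) (at t)" "continuous_on UNIV h'"
    and u: "\<And>k t x. k < n \<Longrightarrow> t \<in> {- (2 * pi / L)..2 * pi / L} \<Longrightarrow> x \<in> {c k..c (Suc k)} \<Longrightarrow> u t x = g t * U k t x"
    and v: "\<And>k t x. k < n \<Longrightarrow> t \<in> {- (2 * pi / L)..2 * pi / L} \<Longrightarrow> x \<in> {c k<..<c (Suc k)} \<Longrightarrow>
      cnj (v t x) = h t * B k * V k t x"
    and ortho: "\<And>t. cell_inner L (v t) (u t) = 1"
  defines "P \<equiv> \<lambda>F G t. layer_pairing n c B (\<lambda>k. F k t) (\<lambda>k. G k t)"
  shows "\<And>t. t \<in> {- (2 * pi / L)..2 * pi / L} \<Longrightarrow> h t * g t * P V U t = 1"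
    and "zak_phase L u v = (\<i> / 2) * (integral {- (pi / L)..pi / L} (\<lambda>t. g' t / g t)
       + integral {- (pi / L)..pi / L} (\<lambda>t. cnj (h' t / h t))
       + integral {- (pi / L)..pi / L} (\<lambda>t. P V U' t / P V U t + cnj (P V' U t / P V U t)))"
proof -
  define T where "T = {- (2 * pi / L)..2 * pi / L}"
  define J where "J = {- (pi / L)..pi / L}"
  \<comment> \<open>Derivatives in t at the ends of J require the layer formulas on a neighbourhood;
    the doubled interval T provides it.\<close>
  have JT: "J \<subseteq> {- (2 * pi / L)<..<2 * pi / L}" and JT': "J \<subseteq> T"
    using L by (auto simp: J_def T_def field_simps) (use pi_gt_zero in linarith)+
  note U = U[folded T_def] and V = V[folded T_def] and u = u[folded T_def] and v = v[folded T_def]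
  have cU: "continuous_on (T \<times> {c k..c (Suc k)}) (\<lambda>(t, x). U k t x)"
      "continuous_on (T \<times> {c k..c (Suc k)}) (\<lambda>(t, x). U' k t x)"
      "continuous_on (T \<times> {c k..c (Suc k)}) (\<lambda>(t, x). V k t x)"
      "continuous_on (T \<times> {c k..c (Suc k)}) (\<lambda>(t, x). V' k t x)" if "k < n" for k
    using U[OF that] V[OF that] by (simp_all add: C1_family_def)
  \<comment> \<open>The product rule leaves two summands in each inner product, so combinations of
    two pairings cover all cases.\<close>
  have inner: "(f has_integral y1 * layer_pairing n c B F1 G1 + y2 * layer_pairing n c B F2 G2) {0..L}"
    if f: "\<And>k x. k < n \<Longrightarrow> x \<in> {c k<..<c (Suc k)} \<Longrightarrow> f x = B k * (y1 * (F1 k x * G1 k x) + y2 * (F2 k x * G2 k x))"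
      and cF: "\<And>k. k < n \<Longrightarrow> continuous_on {c k..c (Suc k)} (F1 k)" "\<And>k. k < n \<Longrightarrow> continuous_on {c k..c (Suc k)} (G1 k)"
        "\<And>k. k < n \<Longrightarrow> continuous_on {c k..c (Suc k)} (F2 k)" "\<And>k. k < n \<Longrightarrow> continuous_on {c k..c (Suc k)} (G2 k)"
    for f y1 y2 F1 G1 F2 G2
  proof -
    have "(f has_integral (\<Sum>k<n. integral {c k..c (Suc k)}
        (\<lambda>x. B k * (y1 * (F1 k x * G1 k x) + y2 * (F2 k x * G2 k x))))) {c 0..c n}"
      by (rule has_integral_layers) (use c f cF in \<open>auto intro!: continuous_intros\<close>)
    moreover have "integral {c k..c (Suc k)} (\<lambda>x. B k * (y1 * (F1 k x * G1 k x) + y2 * (F2 k x * G2 k x)))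
        = y1 * (B k * integral {c k..c (Suc k)} (\<lambda>x. F1 k x * G1 k x))
          + y2 * (B k * integral {c k..c (Suc k)} (\<lambda>x. F2 k x * G2 k x))" if "k < n" for k
    proof -
      have eq: "integral {c k..c (Suc k)} (\<lambda>x. y1 * (F1 k x * G1 k x) + y2 * (F2 k x * G2 k x))
        = integral {c k..c (Suc k)} (\<lambda>x. y1 * (F1 k x * G1 k x)) + integral {c k..c (Suc k)} (\<lambda>x. y2 * (F2 k x * G2 k x))"
        by (intro integral_add integrable_continuous_interval continuous_intros cF that)
      show ?thesis unfolding integral_mult_right eq by (simp add: distrib_left mult.left_commute)
    qed
    ultimately show ?thesis
      by (simp add: c layer_pairing_def sum_distrib_left sum.distrib)
  qed
  \<comment> \<open>Bi-orthogonality in normalised form; the second summand of \<open>inner\<close>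
    is switched off. It also shows that g, h and the pairing have no zeros.\<close>
  have one: "h t * g t * P V U t = 1" if t: "t \<in> T" for t
  proof -
    note sl = cU[THEN continuous_on_slice, OF _ t]
    have "((\<lambda>x. cnj (v t x) * u t x) has_integral (h t * g t) * P V U t + 0 * P V U t) {0..L}"
      unfolding P_def
      by (rule inner) (use sl u[OF _ t] v[OF _ t] in auto)
    then show ?thesis using ortho[of t] by (simp add: cell_inner_def integral_unique)
  qed
  then show "\<And>t. t \<in> {- (2 * pi / L)..2 * pi / L} \<Longrightarrow> h t * g t * P V U t = 1"
    by (simp add: T_def)
  have nz: "g t \<noteq> 0" "h t \<noteq> 0" "P V U t \<noteq> 0" if "t \<in> T" for t using one[OF that] by auto
  have du: "d_alpha u t x = g t * U' k t x + g' t * U k t x"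
    if "t \<in> J" "k < n" "x \<in> {c k<..<c (Suc k)}" for t k x
    unfolding d_alpha_def
  proof (rule vector_derivative_at, rule has_vector_derivative_transform_within_open)
    show "((\<lambda>t. g t * U k t x) has_vector_derivative g t * U' k t x + g' t * U k t x) (at t)"
      using that JT' by (intro has_vector_derivative_mult g C1_family_vector_derivative[OF U]) auto
    show "open {- (2 * pi / L)<..<2 * pi / L}" "t \<in> {- (2 * pi / L)<..<2 * pi / L}" using JT that by auto
    show "g s * U k s x = u s x" if "s \<in> {- (2 * pi / L)<..<2 * pi / L}" for s
      using u[of k s x] that \<open>k < n\<close> \<open>x \<in> _\<close> by (auto simp: T_def)
  qed
  have dv: "d_alpha v t x = cnj (B k * (h t * V' k t x + h' t * V k t x))"
    if "t \<in> J" "k < n" "x \<in> {c k<..<c (Suc k)}" for t k x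
    unfolding d_alpha_def
  proof (rule vector_derivative_at, rule has_vector_derivative_transform_within_open)
    show "((\<lambda>t. cnj (B k * (h t * V k t x))) has_vector_derivative cnj (B k * (h t * V' k t x + h' t * V k t x))) (at t)"
      using that JT' by (intro has_vector_derivative_cnj has_vector_derivative_mult_right
          has_vector_derivative_mult h C1_family_vector_derivative[OF V]) auto
    show "open {- (2 * pi / L)<..<2 * pi / L}" "t \<in> {- (2 * pi / L)<..<2 * pi / L}" using JT that by auto
    show "cnj (B k * (h s * V k s x)) = v s x" if "s \<in> {- (2 * pi / L)<..<2 * pi / L}" for s
    proof -
      have "cnj (v s x) = B k * (h s * V k s x)"
        using v[of k s x] that \<open>k < n\<close> \<open>x \<in> _\<close> by (auto simp: T_def)
      then show ?thesis by (metis complex_cnj_cnj)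
    qed
  qed
  have vu: "cell_inner L (v t) (d_alpha u t) = g' t / g t + P V U' t / P V U t" if t: "t \<in> J" for t
  proof -
    have tT: "t \<in> T" using t JT' by auto
    note sl = cU[THEN continuous_on_slice, OF _ tT]
    have "((\<lambda>x. cnj (v t x) * d_alpha u t x) has_integral h t * g t * P V U' t + h t * g' t * P V U t) {0..L}"
      unfolding P_def
      by (rule inner) (use sl v[OF _ tT] du[OF t] in \<open>auto simp: algebra_simps\<close>)
    then have "cell_inner L (v t) (d_alpha u t) = h t * g t * P V U' t + h t * g' t * P V U t"
      by (simp add: cell_inner_def integral_unique)
    also have "\<dots> = g' t / g t + P V U' t / P V U t"
    proof -
      have "h t * g t = 1 / P V U t" "h t * P V U t = 1 / g t"
        using one[OF tT] nz[OF tT] by (simp_all add: field_simps)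
      then have "h t * g t * P V U' t = P V U' t / P V U t" "g' t * (h t * P V U t) = g' t / g t" by simp_all
      then show ?thesis by (simp add: mult_ac)
    qed
    finally show ?thesis .
  qed
  \<comment> \<open>The integral is computed in conjugated form, where the left mode is a linear
    expression in h and V, and conjugated back afterwards.\<close>
  have uv: "cell_inner L (u t) (d_alpha v t) = cnj (h' t / h t) + cnj (P V' U t / P V U t)" if t: "t \<in> J" for t
  proof -
    have tT: "t \<in> T" using t JT' by auto
    note sl = cU[THEN continuous_on_slice, OF _ tT]
    have "((\<lambda>x. u t x * cnj (d_alpha v t x)) has_integral h t * g t * P V' U t + h' t * g t * P V U t) {0..L}"
      unfolding P_def
      by (rule inner) (use sl u[OF _ tT] dv[OF t] in \<open>auto simp: algebra_simps\<close>)
    from has_integral_linear[OF this bounded_linear_cnj]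
    have "((\<lambda>x. cnj (u t x) * d_alpha v t x) has_integral
        cnj (h t * g t * P V' U t + h' t * g t * P V U t)) {0..L}"
      by (simp add: o_def)
    then have "cell_inner L (u t) (d_alpha v t) = cnj (h t * g t * P V' U t + h' t * g t * P V U t)"
      by (simp add: cell_inner_def integral_unique)
    also have "h t * g t * P V' U t + h' t * g t * P V U t = h' t / h t + P V' U t / P V U t"
    proof -
      have "h t * g t = 1 / P V U t" "g t * P V U t = 1 / h t"
        using one[OF tT] nz[OF tT] by (simp_all add: field_simps)
      then have "h t * g t * P V' U t = P V' U t / P V U t" "h' t * (g t * P V U t) = h' t / h t" by simp_all
      then show ?thesis by (simp add: mult_ac)
    qed
    finally show ?thesis by simp
  qed
  have cP: "continuous_on J (P V U)" "continuous_on J (P V' U)" "continuous_on J (P V U')"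
    unfolding P_def layer_pairing_def
    by (intro continuous_on_sum continuous_on_mult continuous_on_const
        continuous_on_subset[OF continuous_on_integral_product JT'] cU; simp)+
  have cg: "continuous_on J g" "continuous_on J h" "continuous_on J g'" "continuous_on J h'"
    using g h by (auto intro: continuous_on_subset[OF g(2)] continuous_on_subset[OF h(2)]
        continuous_at_imp_continuous_on has_vector_derivative_continuous)
  have nzJ: "g t \<noteq> 0" "h t \<noteq> 0" "P V U t \<noteq> 0" if "t \<in> J" for t using nz that JT' by auto
  have "zak_phase L u v = (\<i> / 2) * integral J (\<lambda>t. (g' t / g t + cnj (h' t / h t))
      + (P V U' t / P V U t + cnj (P V' U t / P V U t)))"
    unfolding zak_phase_def J_def[symmetric]
    by (intro arg_cong2[where f = "(*)"] refl Henstock_Kurzweil_Integration.integral_cong) (simp add: vu uv)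
  also have "integral J (\<lambda>t. (g' t / g t + cnj (h' t / h t)) + (P V U' t / P V U t + cnj (P V' U t / P V U t)))
     = integral J (\<lambda>t. g' t / g t + cnj (h' t / h t)) + integral J (\<lambda>t. P V U' t / P V U t + cnj (P V' U t / P V U t))"
    unfolding J_def by (intro integral_add integrable_continuous_interval continuous_intros cP[unfolded J_def] cg[unfolded J_def])
      (use nzJ in \<open>auto simp: J_def\<close>)
  also have "integral J (\<lambda>t. g' t / g t + cnj (h' t / h t)) = integral J (\<lambda>t. g' t / g t) + integral J (\<lambda>t. cnj (h' t / h t))"
    unfolding J_def by (intro integral_add integrable_continuous_interval continuous_intros cg[unfolded J_def])
      (use nzJ in \<open>auto simp: J_def\<close>)
  finally show "zak_phase L u v = (\<i> / 2) * (integral {- (pi / L)..pi / L} (\<lambda>t. g' t / g t)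
       + integral {- (pi / L)..pi / L} (\<lambda>t. cnj (h' t / h t))
       + integral {- (pi / L)..pi / L} (\<lambda>t. P V U' t / P V U t + cnj (P V' U t / P V U t)))"
    unfolding J_def .
qed

lemma compact_bounded_below:
  fixes f :: "real \<Rightarrow> complex"
  assumes "compact T" "continuous_on T f" "\<And>t. t \<in> T \<Longrightarrow> f t \<noteq> 0"
  obtains c where "c > 0" "\<forall>t\<in>T. c \<le> norm (f t)"
proof (cases "T = {}")
  case False
  have "continuous_on T (\<lambda>t. norm (f t))" by (intro continuous_intros assms)
  from continuous_attains_inf[OF assms(1) False this] obtain s where
    "s \<in> T" "\<forall>t\<in>T. norm (f s) \<le> norm (f t)" by blast
  then show thesis using that[of "norm (f s)"] assms(3) by auto
qed (use that[of 1] in auto)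

lemma O_close_layer_pairing:
  fixes F G :: "nat \<Rightarrow> real \<Rightarrow> real \<Rightarrow> real \<Rightarrow> complex"
  assumes "\<And>k. k < n \<Longrightarrow> c k < c (Suc k)"
    and b: "\<And>k. k < n \<Longrightarrow> O_close T {0::real} (\<lambda>\<delta> t x. b \<delta> k)"
    and F: "\<And>k. k < n \<Longrightarrow> O_close T {c k..c (Suc k)} (F k)"
      "\<And>k. k < n \<Longrightarrow> \<forall>\<^sub>F \<delta> in near0. continuous_on (T \<times> {c k..c (Suc k)}) (\<lambda>(t, x). F k \<delta> t x)"
    and G: "\<And>k. k < n \<Longrightarrow> O_close T {c k..c (Suc k)} (G k)"
      "\<And>k. k < n \<Longrightarrow> \<forall>\<^sub>F \<delta> in near0. continuous_on (T \<times> {c k..c (Suc k)}) (\<lambda>(t, x). G k \<delta> t x)"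
  shows "O_close T {0::real} (\<lambda>\<delta> t x. layer_pairing n c (b \<delta>) (\<lambda>k. F k \<delta> t) (\<lambda>k. G k \<delta> t))"
    and "\<forall>\<^sub>F \<delta> in near0. continuous_on T (\<lambda>t. layer_pairing n c (b \<delta>) (\<lambda>k. F k \<delta> t) (\<lambda>k. G k \<delta> t))"
proof -
  show "O_close T {0::real} (\<lambda>\<delta> t x. layer_pairing n c (b \<delta>) (\<lambda>k. F k \<delta> t) (\<lambda>k. G k \<delta> t))"
    unfolding layer_pairing_def
  proof (rule O_close_sum)
    fix k assume "k \<in> {..<n}"
    then have k: "k < n" by simp
    have "\<forall>\<^sub>F \<delta> in near0. continuous_on (T \<times> {c k..c (Suc k)}) (\<lambda>(t, x). F k \<delta> t x * G k \<delta> t x)"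
      using F(2)[OF k] G(2)[OF k] by eventually_elim (auto simp: case_prod_unfold intro!: continuous_intros)
    from O_close_integral[OF O_close_mult[OF F(1)[OF k] G(1)[OF k]] less_imp_le[OF assms(1)[OF k]] this]
    show "O_close T {0::real} (\<lambda>\<delta> t x. b \<delta> k * integral {c k..c (Suc k)} (\<lambda>x. F k \<delta> t x * G k \<delta> t x))"
      by (rule O_close_mult[OF b[OF k]])
  qed
  have "\<forall>\<^sub>F \<delta> in near0. \<forall>k\<in>{..<n}. continuous_on T (\<lambda>t. integral {c k..c (Suc k)} (\<lambda>x. F k \<delta> t x * G k \<delta> t x))"
  proof (rule eventually_ball_finite[OF finite_lessThan], rule ballI)
    fix k assume "k \<in> {..<n}"
    then have k: "k < n" by simp
    show "\<forall>\<^sub>F \<delta> in near0. continuous_on T (\<lambda>t. integral {c k..c (Suc k)} (\<lambda>x. F k \<delta> t x * G k \<delta> t x))"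
      using F(2)[OF k] G(2)[OF k] by eventually_elim (rule continuous_on_integral_product)
  qed
  then show "\<forall>\<^sub>F \<delta> in near0. continuous_on T (\<lambda>t. layer_pairing n c (b \<delta>) (\<lambda>k. F k \<delta> t) (\<lambda>k. G k \<delta> t))"
    unfolding layer_pairing_def by eventually_elim (auto intro!: continuous_intros)
qed

lemma integral_near_constant_family:
  fixes E :: "real \<Rightarrow> real \<Rightarrow> complex"
  assumes "O_close {a..b} {0::real} (\<lambda>\<delta> t x. E \<delta> t)" "a \<le> b"
    and "\<forall>\<^sub>F \<delta> in near0. continuous_on {a..b} (E \<delta>)"
  shows "\<exists>K. \<forall>\<^sub>F \<delta> in near0. norm (integral {a..b} (E \<delta>) - integral {a..b} (E 0)) \<le> K * \<delta>"
proof -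
  \<comment> \<open>Integration is now over t, which moves into the place of x; a one-point set
    takes the place of the parameter.\<close>
  have "O_close {0::real} {a..b} (\<lambda>\<delta> t x. E \<delta> x)"
    using assms(1) unfolding O_close_def by simp
  moreover have "\<forall>\<^sub>F \<delta> in near0. continuous_on ({0::real} \<times> {a..b}) (\<lambda>(t, x). E \<delta> x)"
    using assms(3)
  proof eventually_elim
    case (elim \<delta>)
    have "continuous_on ({0::real} \<times> {a..b}) (\<lambda>p. E \<delta> (snd p))"
      by (rule continuous_on_compose2[OF elim continuous_on_snd[OF continuous_on_id]]) auto
    then show ?case by (simp add: case_prod_unfold)
  qed
  ultimately have "O_close {0::real} {0::real} (\<lambda>\<delta> t _. integral {a..b} (E \<delta>))"
    by (rule O_close_integral[OF _ assms(2)])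
  then show ?thesis unfolding O_close_def by (elim exE, intro exI, elim eventually_mono) auto
qed

text \<open>
  The integrals of the logarithmic derivatives of \<open>g\<close> and \<open>h\<close> are multiples of \<open>2 \<pi> \<i>\<close>.  They are
  opposite to each other because \<open>g h\<close> is close to the inverse of the pairing of the limiting
  modes, which has winding number 0.
\<close>

lemma zak_phase_expansion:
  fixes u v :: "real \<Rightarrow> real \<Rightarrow> real \<Rightarrow> complex"
    and U V :: "nat \<Rightarrow> real \<Rightarrow> real \<Rightarrow> real \<Rightarrow> complex"
    and U0' V0' :: "nat \<Rightarrow> real \<Rightarrow> real \<Rightarrow> complex"
    and b :: "real \<Rightarrow> nat \<Rightarrow> complex" and c :: "nat \<Rightarrow> real"
    and n :: nat and L :: real and P0' :: "real \<Rightarrow> complex"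
  defines "T \<equiv> {- (2 * pi / L)..2 * pi / L}" and "J \<equiv> {- (pi / L)..pi / L}"
  defines "P0 \<equiv> \<lambda>t. layer_pairing n c (b 0) (\<lambda>k. V k 0 t) (\<lambda>k. U k 0 t)"
    and "N0 \<equiv> \<lambda>t. layer_pairing n c (b 0) (\<lambda>k. V k 0 t) (\<lambda>k. U0' k t)"
    and "M0 \<equiv> \<lambda>t. layer_pairing n c (b 0) (\<lambda>k. V0' k t) (\<lambda>k. U k 0 t)"
  assumes L: "L > 0" and c: "c 0 = 0" "c n = L" "\<And>k. k < n \<Longrightarrow> c k < c (Suc k)"
    and U: "\<And>k. k < n \<Longrightarrow> C1_close of_real T {c k..c (Suc k)} (U k)"
    and V: "\<And>k. k < n \<Longrightarrow> C1_close of_real T {c k..c (Suc k)} (V k)"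
    and b: "\<And>k. k < n \<Longrightarrow> O_close T {0::real} (\<lambda>\<delta> t x. b \<delta> k)"
    and modes: "\<forall>\<^sub>F \<delta> in at_right 0. \<exists>g g' h h'.
      (\<forall>t. (g has_vector_derivative g' t) (at t)) \<and> continuous_on UNIV g' \<and> g (- (pi / L)) = g (pi / L) \<and>
      (\<forall>t. (h has_vector_derivative h' t) (at t)) \<and> continuous_on UNIV h' \<and> h (- (pi / L)) = h (pi / L) \<and>
      (\<forall>k<n. \<forall>t\<in>T. \<forall>x\<in>{c k..c (Suc k)}. u \<delta> t x = g t * U k \<delta> t x) \<and>
      (\<forall>k<n. \<forall>t\<in>T. \<forall>x\<in>{c k<..<c (Suc k)}. cnj (v \<delta> t x) = h t * b \<delta> k * V k \<delta> t x) \<and>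
      (\<forall>t. cell_inner L (v \<delta> t) (u \<delta> t) = 1)"
    and U0': "\<And>k t x. k < n \<Longrightarrow> t \<in> T \<Longrightarrow> x \<in> {c k..c (Suc k)} \<Longrightarrow>
      ((\<lambda>s. U k 0 s x) has_vector_derivative U0' k t x) (at t)"
    and V0': "\<And>k t x. k < n \<Longrightarrow> t \<in> T \<Longrightarrow> x \<in> {c k..c (Suc k)} \<Longrightarrow>
      ((\<lambda>s. V k 0 s x) has_vector_derivative V0' k t x) (at t)"
    and nz: "\<And>t. t \<in> T \<Longrightarrow> P0 t \<noteq> 0" and closed: "P0 (- (pi / L)) = P0 (pi / L)"
    and P0': "\<And>t. t \<in> J \<Longrightarrow> (P0 has_vector_derivative P0' t) (at t)" "continuous_on J P0'"
    and wind: "integral J (\<lambda>t. P0' t / P0 t) = 0"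
  shows "\<exists>m :: real \<Rightarrow> int. (\<lambda>\<delta>. zak_phase L (u \<delta>) (v \<delta>)
     - ((\<i> / 2) * integral J (\<lambda>t. N0 t / P0 t + cnj (M0 t / P0 t)) + of_real (2 * pi * of_int (m \<delta>))))
     \<in> O[at_right 0](\<lambda>\<delta>. complex_of_real \<delta>)"
proof -
  have JT: "J \<subseteq> T" using L by (auto simp: J_def T_def field_simps)
  have Jne: "- (pi / L) \<le> pi / L" using L by simp
  have cT: "compact T" by (simp add: T_def)
  have derivs: "\<exists>F'. \<forall>k<n. (\<forall>\<^sub>F \<delta> in near0. C1_family of_real T {c k..c (Suc k)} (F k \<delta>) (F' k \<delta>)) \<and>
      O_close T {c k..c (Suc k)} (F k) \<and> O_close T {c k..c (Suc k)} (F' k)"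
    if "\<And>k. k < n \<Longrightarrow> C1_close of_real T {c k..c (Suc k)} (F k)" for F
    using that unfolding C1_close_def by (intro choice) blast
  obtain U' where U': "\<And>k. k < n \<Longrightarrow> (\<forall>\<^sub>F \<delta> in near0. C1_family of_real T {c k..c (Suc k)} (U k \<delta>) (U' k \<delta>)) \<and>
      O_close T {c k..c (Suc k)} (U k) \<and> O_close T {c k..c (Suc k)} (U' k)" using derivs[OF U] by blast
  obtain V' where V': "\<And>k. k < n \<Longrightarrow> (\<forall>\<^sub>F \<delta> in near0. C1_family of_real T {c k..c (Suc k)} (V k \<delta>) (V' k \<delta>)) \<and>
      O_close T {c k..c (Suc k)} (V k) \<and> O_close T {c k..c (Suc k)} (V' k)" using derivs[OF V] by blast
  have cont: "\<forall>\<^sub>F \<delta> in near0. continuous_on (T \<times> {c k..c (Suc k)}) (\<lambda>(t, x). U k \<delta> t x)"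
     "\<forall>\<^sub>F \<delta> in near0. continuous_on (T \<times> {c k..c (Suc k)}) (\<lambda>(t, x). U' k \<delta> t x)"
     "\<forall>\<^sub>F \<delta> in near0. continuous_on (T \<times> {c k..c (Suc k)}) (\<lambda>(t, x). V k \<delta> t x)"
     "\<forall>\<^sub>F \<delta> in near0. continuous_on (T \<times> {c k..c (Suc k)}) (\<lambda>(t, x). V' k \<delta> t x)" if "k < n" for k
    using U'[OF that] V'[OF that] unfolding C1_family_def by (auto elim: eventually_mono)
  define PP where "PP = (\<lambda>(F :: nat \<Rightarrow> real \<Rightarrow> real \<Rightarrow> real \<Rightarrow> complex) G \<delta> t. layer_pairing n c (b \<delta>) (\<lambda>k. F k \<delta> t) (\<lambda>k. G k \<delta> t))"
  define P where "P = PP V U"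
  define N where "N = PP V U'"
  define M where "M = PP V' U"
  have P: "O_close T {0::real} (\<lambda>\<delta> t x. P \<delta> t)" "\<forall>\<^sub>F \<delta> in near0. continuous_on T (P \<delta>)"
    unfolding P_def PP_def using O_close_layer_pairing[of n c T b V U] c(3) b U' V' cont by auto
  have N: "O_close T {0::real} (\<lambda>\<delta> t x. N \<delta> t)" "\<forall>\<^sub>F \<delta> in near0. continuous_on T (N \<delta>)"
    unfolding N_def PP_def using O_close_layer_pairing[of n c T b V U'] c(3) b U' V' cont by auto
  have M: "O_close T {0::real} (\<lambda>\<delta> t x. M \<delta> t)" "\<forall>\<^sub>F \<delta> in near0. continuous_on T (M \<delta>)"
    unfolding M_def PP_def using O_close_layer_pairing[of n c T b V' U] c(3) b U' V' cont by auto
  \<comment> \<open>The derivatives provided by \<open>C1_close\<close> are abstract; uniqueness of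
    derivatives identifies them at \<delta> = 0 with the given ones.\<close>
  have at0: "P 0 t = P0 t" "N 0 t = N0 t" "M 0 t = M0 t" if t: "t \<in> T" for t
  proof -
    have "U' k 0 t x = U0' k t x" "V' k 0 t x = V0' k t x" if kx: "k < n" "x \<in> {c k..c (Suc k)}" for k x
    proof -
      have F: "C1_family of_real T {c k..c (Suc k)} (U k 0) (U' k 0)" "C1_family of_real T {c k..c (Suc k)} (V k 0) (V' k 0)"
        using U'[OF kx(1)] V'[OF kx(1)] by (auto simp: eventually_near0)
      show "U' k 0 t x = U0' k t x"
        by (rule vector_derivative_unique_at[OF C1_family_vector_derivative[OF F(1) t kx(2)] U0'[OF kx(1) t kx(2)]])
      show "V' k 0 t x = V0' k t x"
        by (rule vector_derivative_unique_at[OF C1_family_vector_derivative[OF F(2) t kx(2)] V0'[OF kx(1) t kx(2)]])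
    qed
    then show "P 0 t = P0 t" "N 0 t = N0 t" "M 0 t = M0 t"
      unfolding P_def N_def M_def PP_def P0_def N0_def M0_def layer_pairing_def
      by (auto intro!: sum.cong arg_cong2[where f = "(*)"] Henstock_Kurzweil_Integration.integral_cong)
  qed
  have "continuous_on T (P 0)" using P(2) by (simp add: eventually_near0)
  moreover have "P 0 t \<noteq> 0" if "t \<in> T" for t using at0(1)[OF that] nz[OF that] by simp
  ultimately obtain d where d: "d > 0" "\<forall>t\<in>T. d \<le> norm (P 0 t)"
    using compact_bounded_below[OF cT] by blast
  then have d': "\<forall>t\<in>T. \<forall>x\<in>{0::real}. d \<le> norm (P 0 t)" by auto
  define E where "E = (\<lambda>\<delta> t. N \<delta> t / P \<delta> t + cnj (M \<delta> t / P \<delta> t))"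
  have Pnz: "\<forall>\<^sub>F \<delta> in near0. \<forall>t\<in>T. norm (P \<delta> t) \<ge> d / 2"
    using O_close_inverse_bounds[OF P(1) d(1) d'] by simp
  have "O_close T {0::real} (\<lambda>\<delta> t x. E \<delta> t)"
    unfolding E_def divide_inverse
    by (intro O_close_add O_close_cnj O_close_mult N M O_close_inverse[OF P(1) d(1) d'])
  then have OE: "O_close J {0::real} (\<lambda>\<delta> t x. E \<delta> t)"
    unfolding O_close_def by (elim exE, intro exI, elim eventually_mono) (use JT in blast)
  have cE: "\<forall>\<^sub>F \<delta> in near0. continuous_on J (E \<delta>)"
    using P(2) N(2) M(2) Pnz
  proof eventually_elim
    case (elim \<delta>)
    have "P \<delta> t \<noteq> 0" if "t \<in> T" for t using elim(4) that d(1) by fastforce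
    then have "continuous_on T (E \<delta>)" unfolding E_def by (intro continuous_intros elim) auto
    then show ?case using JT continuous_on_subset by blast
  qed
  from integral_near_constant_family[OF OE[unfolded J_def] Jne cE[unfolded J_def]] obtain K where
    K: "\<forall>\<^sub>F \<delta> in near0. norm (integral J (E \<delta>) - integral J (E 0)) \<le> K * \<delta>" unfolding J_def by blast
  have E0: "integral J (E 0) = integral J (\<lambda>t. N0 t / P0 t + cnj (M0 t / P0 t))"
    by (rule Henstock_Kurzweil_Integration.integral_cong) (use JT at0 in \<open>auto simp: E_def\<close>)
  from O_closeE[OF P(1)] obtain KP where KP: "KP > 0" "\<forall>\<^sub>F \<delta> in near0. O_bound KP T {0::real} (\<lambda>\<delta> t x. P \<delta> t) \<delta>" .
  have fam: "\<forall>\<^sub>F \<delta> in near0. \<forall>k\<in>{..<n}. C1_family of_real T {c k..c (Suc k)} (U k \<delta>) (U' k \<delta>) \<and>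
      C1_family of_real T {c k..c (Suc k)} (V k \<delta>) (V' k \<delta>)"
    by (rule eventually_ball_finite) (use U' V' in \<open>auto simp: eventually_conj_iff\<close>)
  have d2: "d / 2 > 0" using d by simp
  \<comment> \<open>The last condition holds once KP \<delta> < d / 2, because d / 2 is a lower
    bound for the pairing. It will place P 0 / P \<delta> in the unit disc around 1.\<close>
  define good where "good = (\<lambda>\<delta>. (\<forall>k\<in>{..<n}. C1_family of_real T {c k..c (Suc k)} (U k \<delta>) (U' k \<delta>) \<and>
      C1_family of_real T {c k..c (Suc k)} (V k \<delta>) (V' k \<delta>)) \<and>
      norm (integral J (E \<delta>) - integral J (E 0)) \<le> K * \<delta> \<and>
      (\<forall>t\<in>T. norm (P \<delta> t - P 0 t) < norm (P \<delta> t)))"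
  have "\<forall>\<^sub>F \<delta> in near0. good \<delta>"
    unfolding good_def using fam K KP(2) Pnz eventually_near0_less[OF d2, of KP]
    by eventually_elim (fastforce simp: O_bound_def)
  then have "\<forall>\<^sub>F \<delta> in at_right 0. good \<delta>" by (simp add: eventually_near0)
  from this modes eventually_at_right_less[of 0]
  have main: "\<forall>\<^sub>F \<delta> in at_right 0. \<exists>m::int. norm (zak_phase L (u \<delta>) (v \<delta>) - ((\<i> / 2) * integral J (E 0) + of_real (2 * pi * of_int m)))
      \<le> K / 2 * norm (complex_of_real \<delta>)"
  proof eventually_elim
    case (elim \<delta>)
    then have C: "\<And>k. k < n \<Longrightarrow> C1_family of_real T {c k..c (Suc k)} (U k \<delta>) (U' k \<delta>)"
      "\<And>k. k < n \<Longrightarrow> C1_family of_real T {c k..c (Suc k)} (V k \<delta>) (V' k \<delta>)"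
      and KE: "norm (integral J (E \<delta>) - integral J (E 0)) \<le> K * \<delta>"
      and near: "\<And>t. t \<in> T \<Longrightarrow> norm (P \<delta> t - P 0 t) < norm (P \<delta> t)" by (auto simp: good_def)
    from elim(2) obtain g g' h h' where
      g: "\<And>t. (g has_vector_derivative g' t) (at t)" "continuous_on UNIV g'" "g (- (pi / L)) = g (pi / L)" and
      h: "\<And>t. (h has_vector_derivative h' t) (at t)" "continuous_on UNIV h'" "h (- (pi / L)) = h (pi / L)" and
      u: "\<And>k t x. k < n \<Longrightarrow> t \<in> T \<Longrightarrow> x \<in> {c k..c (Suc k)} \<Longrightarrow> u \<delta> t x = g t * U k \<delta> t x" and
      v: "\<And>k t x. k < n \<Longrightarrow> t \<in> T \<Longrightarrow> x \<in> {c k<..<c (Suc k)} \<Longrightarrow> cnj (v \<delta> t x) = h t * b \<delta> k * V k \<delta> t x" and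
      o: "\<And>t. cell_inner L (v \<delta> t) (u \<delta> t) = 1" by blast
    note zpn = zak_phase_normalised[where L = L and c = c and n = n and U = "\<lambda>k. U k \<delta>" and V = "\<lambda>k. V k \<delta>"
        and U' = "\<lambda>k. U' k \<delta>" and V' = "\<lambda>k. V' k \<delta>" and B = "b \<delta>" and u = "u \<delta>" and v = "v \<delta>"
        and g = g and h = h and g' = g' and h' = h',
        OF L c(1,2,3) C[unfolded T_def] g(1,2) h(1,2) u[unfolded T_def] v[unfolded T_def] o]
    have one: "h t * g t * P \<delta> t = 1" if "t \<in> T" for t
      using zpn(1)[of t] that by (simp add: P_def PP_def T_def)
    have zak: "zak_phase L (u \<delta>) (v \<delta>) = (\<i> / 2) * (integral J (\<lambda>t. g' t / g t) + integral J (\<lambda>t. cnj (h' t / h t))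
       + integral J (E \<delta>))"
      using zpn(2) by (simp add: P_def N_def M_def PP_def E_def J_def)
    have gh: "g t \<noteq> 0" "h t \<noteq> 0" if "t \<in> J" for t using one[of t] that JT by auto
    have "\<exists>k::int. integral J (\<lambda>t. g' t / g t) = of_real (2 * pi * of_int k) * \<i>"
      unfolding J_def
      by (rule integral_logarithmic_derivative_closed[OF Jne has_vector_derivative_at_within[OF g(1)]
          continuous_on_subset[OF g(2)] _ g(3)]) (use gh in \<open>auto simp: J_def\<close>)
    then obtain k1 :: int where k1: "integral J (\<lambda>t. g' t / g t) = of_real (2 * pi * of_int k1) * \<i>" ..
    have "\<exists>k::int. integral J (\<lambda>t. h' t / h t) = of_real (2 * pi * of_int k) * \<i>"
      unfolding J_def
      by (rule integral_logarithmic_derivative_closed[OF Jne has_vector_derivative_at_within[OF h(1)]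
          continuous_on_subset[OF h(2)] _ h(3)]) (use gh in \<open>auto simp: J_def\<close>)
    then obtain k2 :: int where k2: "integral J (\<lambda>t. h' t / h t) = of_real (2 * pi * of_int k2) * \<i>" ..
    \<comment> \<open>By g h P \<delta> = 1 this is P 0 / P \<delta>, so W has winding number 0. As
      P0 has winding number 0 too, those of g and h add up to 0.\<close>
    define W where "W = (\<lambda>t. g t * h t * P0 t)"
    define W' where "W' = (\<lambda>t. g t * h t * P0' t + (g t * h' t + g' t * h t) * P0 t)"
    have W': "(W has_vector_derivative W' t) (at t)" if "t \<in> J" for t
      unfolding W_def W'_def by (intro has_vector_derivative_mult g h P0' that)
    have "norm (W t - 1) < 1" if t: "t \<in> J" for t
    proof -
      have tT: "t \<in> T" using JT t by auto
      have Pn: "P \<delta> t \<noteq> 0" using one[OF tT] by auto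
      have "W t = P 0 t / P \<delta> t" using one[OF tT] Pn at0[OF tT] by (simp add: W_def field_simps)
      then have "W t - 1 = (P 0 t - P \<delta> t) / P \<delta> t" using Pn by (simp add: field_simps)
      then show ?thesis using near[OF tT] Pn by (simp add: norm_divide norm_minus_commute)
    qed
    moreover have "W (- (pi / L)) = W (pi / L)" unfolding W_def g(3) h(3) closed ..
    ultimately have "integral J (\<lambda>t. W' t / W t) = 0"
      using has_vector_derivative_at_within[OF W'] unfolding J_def
      by (intro integral_logarithmic_derivative_near_1[OF Jne])
    also have "integral J (\<lambda>t. W' t / W t) = integral J (\<lambda>t. (g' t / g t + h' t / h t) + P0' t / P0 t)"
      by (rule Henstock_Kurzweil_Integration.integral_cong)
         (use gh nz JT in \<open>auto simp: W'_def W_def field_simps\<close>)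
    also have "\<dots> = integral J (\<lambda>t. g' t / g t) + integral J (\<lambda>t. h' t / h t) + integral J (\<lambda>t. P0' t / P0 t)"
    proof -
      have cg: "continuous_on J g" "continuous_on J h" "continuous_on J g'" "continuous_on J h'" "continuous_on J P0"
        by (rule continuous_at_imp_continuous_on, use g h P0'(1) has_vector_derivative_continuous in blast
            | rule continuous_on_subset[OF g(2)] continuous_on_subset[OF h(2)], simp)+
      have i: "(\<lambda>t. g' t / g t) integrable_on J" "(\<lambda>t. h' t / h t) integrable_on J" "(\<lambda>t. P0' t / P0 t) integrable_on J"
        using gh nz JT unfolding J_def
        by (auto intro!: integrable_continuous_interval continuous_intros cg[unfolded J_def] P0'(2)[unfolded J_def])
      show ?thesis using i by (simp add: integral_add integrable_add)
    qed
    finally have "of_real (2 * pi * of_int k1) * \<i> + of_real (2 * pi * of_int k2) * \<i> = 0"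
      using wind k1 k2 by simp
    then have "2 * pi * (of_int k1 + of_int k2) = (0::real)"
      by (simp add: complex_eq_iff algebra_simps)
    then have k12: "k2 = - k1" by (simp del: of_int_add add: of_int_add[symmetric])
    \<comment> \<open>Conjugation changes the sign of the second winding, so with k2 = - k1 the two
      integrals add up to 4 \<pi> i k1; the prefactor i / 2 makes this -2 \<pi> k1.\<close>
    have "integral J (\<lambda>t. cnj (h' t / h t)) = cnj (integral J (\<lambda>t. h' t / h t))"
      by (simp add: integral_cnj)
    then have "zak_phase L (u \<delta>) (v \<delta>) = (\<i> / 2) * integral J (E \<delta>) + of_real (2 * pi * of_int (- k1))"
      unfolding zak k1 k2 k12 by (simp add: algebra_simps)
    then have "zak_phase L (u \<delta>) (v \<delta>) - ((\<i> / 2) * integral J (E 0) + of_real (2 * pi * of_int (- k1)))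
      = (\<i> / 2) * (integral J (E \<delta>) - integral J (E 0))" by (simp add: algebra_simps)
    then have "norm (zak_phase L (u \<delta>) (v \<delta>) - ((\<i> / 2) * integral J (E 0) + of_real (2 * pi * of_int (- k1))))
      = norm (\<i> / 2) * norm (integral J (E \<delta>) - integral J (E 0))" by (simp only: norm_mult)
    also have "\<dots> = norm (integral J (E \<delta>) - integral J (E 0)) / 2" by (simp add: norm_divide)
    also have "\<dots> \<le> K / 2 * norm (complex_of_real \<delta>)" using KE elim(3) by simp
    finally show ?case by blast
  qed
  \<comment> \<open>The winding of the gauge may change arbitrarily with \<delta>, so the integer is
    chosen for each \<delta> on its own.\<close>
  define m where "m = (\<lambda>\<delta>. SOME m::int. norm (zak_phase L (u \<delta>) (v \<delta>) - ((\<i> / 2) * integral J (E 0) + of_real (2 * pi * of_int m)))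
      \<le> K / 2 * norm (complex_of_real \<delta>))"
  have "\<forall>\<^sub>F \<delta> in at_right 0. norm (zak_phase L (u \<delta>) (v \<delta>) - ((\<i> / 2) * integral J (E 0) + of_real (2 * pi * of_int (m \<delta>))))
      \<le> K / 2 * norm (complex_of_real \<delta>)"
    using main by eventually_elim (unfold m_def, rule someI_ex)
  then show ?thesis unfolding E0[symmetric] by (intro exI[of _ m] bigoI)
qed

section \<open>The limit of vanishing contrast\<close>

text \<open>The product of the coefficients vanishes at \<delta> = 0, both series equal 1, and each
  layer becomes a shear: constant amplitude in resonators, constant flux in gaps.\<close>

lemma wave_step_limit:
  "wave_step (layer_a 0 k) (layer_b M 0 k * \<mu>) y p =
    (if even k then (fst p, snd p - M k * \<mu> * of_real y * fst p) else (fst p + of_real y * snd p, snd p))"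
  by (auto simp: wave_step_def layer_a_def layer_b_def prod_eq_iff)

section \<open>The transfer matrix at zero contrast\<close>

context
  fixes M :: "nat \<Rightarrow> complex" and c :: "nat \<Rightarrow> real" and l s1 s2 :: real
  assumes gaps: "c 1 - c 0 = l" "c 2 - c 1 = s1" "c 3 - c 2 = l" "c 4 - c 3 = s2"
begin

private lemma gaps_Suc:
  "c (Suc 0) - c 0 = l" "c (Suc (Suc 0)) - c (Suc 0) = s1" "c (Suc (Suc (Suc 0))) - c (Suc (Suc 0)) = l"
  "c (Suc (Suc (Suc (Suc 0)))) - c (Suc (Suc (Suc 0))) = s2"
  using gaps by (simp_all add: eval_nat_numeral)

private lemma limit_state_2:
  "medium_state M c 0 \<mu> (u, q) 2 = (u + s1 * (q - M 0 * \<mu> * l * u), q - M 0 * \<mu> * l * u)"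
proof -
  have 2: "2 = Suc (Suc (0::nat))" by simp
  show ?thesis
    unfolding 2 layer_state.simps wave_step_limit gaps_Suc by simp
qed

private lemma limit_state_4:
  "medium_state M c 0 \<mu> (u, q) 4 = (let (u', q') = medium_state M c 0 \<mu> (u, q) 2 in
     (u' + s2 * (q' - M 2 * \<mu> * l * u'), q' - M 2 * \<mu> * l * u'))"
proof -
  have 4: "4 = Suc (Suc (2::nat))" by simp
  have g: "c (Suc 2) - c 2 = l" "c (Suc (Suc 2)) - c (Suc 2) = s2"
    using gaps by (simp_all add: eval_nat_numeral)
  show ?thesis
    unfolding 4 layer_state.simps(2) wave_step_limit g by (simp add: case_prod_unfold Let_def)
qed

lemma limit_transmission:
  "fst (medium_state M c 0 \<mu> (0, 1) 4) = s1 + s2 - M 2 * \<mu> * l * s1 * s2"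
  unfolding limit_state_4 limit_state_2 by (simp add: algebra_simps)

lemma limit_trace:
  "fst (medium_state M c 0 \<mu> (1, 0) 4) + snd (medium_state M c 0 \<mu> (0, 1) 4) =
     2 - \<mu> * (s1 + s2) * (M 0 + M 2) * l + \<mu>\<^sup>2 * (s1 * s2) * (M 0 * M 2) * (of_real l)\<^sup>2"
  unfolding limit_state_4 limit_state_2 by (simp add: power2_eq_square algebra_simps)

lemma limit_wave_0: "fst (medium_wave M c 0 \<mu> (1, q) 0 x) = 1"
  unfolding layer_wave_def layer_state.simps wave_step_limit by simp

text \<open>The hypothesis is the Bloch condition for the amplitude at the end of the cell, cleared
  of the division by T12. The result s2 + z s1 equals s1 s2 (1/s1 + z/s2), so \<gamma> appears for z
  = exp(i L t).\<close>

lemma limit_wave_2: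
  fixes z :: complex
  assumes "q * fst (medium_state M c 0 \<mu> (0, 1) 4) = z - fst (medium_state M c 0 \<mu> (1, 0) 4)"
  shows "fst (medium_wave M c 0 \<mu> (1, q) 2 x) * fst (medium_state M c 0 \<mu> (0, 1) 4) = s2 + z * s1"
proof -
  have U: "fst (medium_wave M c 0 \<mu> (1, q) 2 x) = 1 + s1 * (q - M 0 * \<mu> * l)"
    unfolding layer_wave_def wave_step_limit limit_state_2 by simp
  have T: "fst (medium_state M c 0 \<mu> (1, 0) 4) =
     (1 - s1 * M 0 * \<mu> * l) - s2 * (M 0 * \<mu> * l + M 2 * \<mu> * l * (1 - s1 * M 0 * \<mu> * l))"
    unfolding limit_state_4 limit_state_2 by (simp add: algebra_simps)
  show ?thesis using assms unfolding U T limit_transmission of_real_add by algebra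
qed

end

section \<open>Limiting eigenvalues and the path gamma\<close>

text \<open>The capacitance matrix has trace a (v1^2 + v2^2) / l, and its characteristic polynomial
  has discriminant f / l^2; the sign follows the labelling of the eigenvectors.\<close>

definition limit_eigenvalue ::
  "real \<Rightarrow> real \<Rightarrow> real \<Rightarrow> real \<Rightarrow> complex \<Rightarrow> complex \<Rightarrow> (complex \<Rightarrow> complex) \<Rightarrow> nat \<Rightarrow> real \<Rightarrow> complex" where
  "limit_eigenvalue L l s1 s2 v1 v2 sqf i t =
     (cap_a s1 s2 * (v1\<^sup>2 + v2\<^sup>2) + (- 1) ^ i * sqf (gamma L s1 s2 t)) / (2 * of_real l)"

text \<open>
  With the value 1 on the first resonator, the limiting right and left modes take the values
  \<open>limit_ratio * gamma\<close> and \<open>limit_ratio * cnj gamma\<close> on the second one.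
\<close>

definition limit_ratio ::
  "real \<Rightarrow> real \<Rightarrow> real \<Rightarrow> real \<Rightarrow> complex \<Rightarrow> complex \<Rightarrow> (complex \<Rightarrow> complex) \<Rightarrow> nat \<Rightarrow> real \<Rightarrow> complex" where
  "limit_ratio L l s1 s2 v1 v2 sqf i t =
     1 / (cap_a s1 s2 - limit_eigenvalue L l s1 s2 v1 v2 sqf i t * of_real l / v2\<^sup>2)"

lemma cap_b_eq: "cnj (cap_b L s1 s2 t) = - gamma L s1 s2 t"
  by (simp add: cap_b_def gamma_def exp_cnj)

lemma gamma_reflect: "gamma L s1 s2 (- t) = cnj (gamma L s1 s2 t)"
  by (simp add: gamma_def exp_cnj)

lemma exp_phase_has_vector_derivative:
  fixes k :: complex
  shows "((\<lambda>t. exp (k * of_real (L * t))) has_vector_derivative k * L * exp (k * of_real (L * t))) (at t)"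
proof -
  have "((\<lambda>t. L * t) has_vector_derivative L) (at t)"
    by (auto intro!: derivative_eq_intros simp: has_real_derivative_iff_has_vector_derivative[symmetric])
  from has_vector_derivative_mult_right[OF bounded_linear.has_vector_derivative[OF bounded_linear_of_real this], of k]
  have "((\<lambda>t. k * of_real (L * t)) has_vector_derivative k * of_real L) (at t)" .
  from field_vector_diff_chain_at[OF this DERIV_exp] show ?thesis by (simp add: o_def)
qed

lemma gamma_has_vector_derivative:
  "(gamma L s1 s2 has_vector_derivative \<i> * L / s2 * exp (\<i> * of_real (L * t))) (at t)"
proof -
  note exp_phase_has_vector_derivative[of \<i> L t]
  from has_vector_derivative_add[OF has_vector_derivative_const has_vector_derivative_mult_right[OF this]]
  show ?thesis unfolding gamma_def[abs_def] by (rule has_vector_derivative_eq_rhs) simp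
qed

text \<open>\<gamma> has period 2 \<pi> / L, so any t may be replaced by the argument of exp(i L t)
  divided by L. This extends properties of the branch on the path to all real t.\<close>

lemma gamma_in_path_image:
  assumes "L > 0"
  shows "gamma L s1 s2 t \<in> path_image (gamma_path L s1 s2)"
proof -
  define s where "s = Arg (exp (\<i> * of_real (L * t))) / L"
  have s: "- (pi / L) \<le> s" "s \<le> pi / L"
    using Arg_bounded[of "exp (\<i> * of_real (L * t))"] assms by (auto simp: s_def field_simps)
  have "exp (\<i> * of_real (L * s)) = exp (\<i> * of_real (L * t))"
    using Arg_eq[of "exp (\<i> * of_real (L * t))"] assms by (simp add: s_def)
  then have "gamma L s1 s2 t = gamma L s1 s2 s" by (simp add: gamma_def)
  moreover have "s \<in> path_image (linepath (- (pi / L)) (pi / L))"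
    using s by (simp add: closed_segment_eq_real_ivl)
  ultimately show ?thesis unfolding gamma_path_def path_image_compose by auto
qed

lemma integral_affine_unit:
  fixes f :: "real \<Rightarrow> complex"
  assumes "a < b" "f integrable_on {a..b}"
  shows "integral {0..1} (\<lambda>x. f (linepath a b x) * of_real (b - a)) = integral {a..b} f"
proof -
  have I: "(f has_integral integral {a..b} f) {a..b}" using assms(2) by (rule integrable_integral)
  have "((\<lambda>x. f ((b - a) *\<^sub>R x + a)) has_integral (1 / \<bar>b - a\<bar> ^ DIM(real)) *\<^sub>R integral {a..b} f)
      ((\<lambda>x. (1 / (b - a)) *\<^sub>R x + - ((1 / (b - a)) *\<^sub>R a)) ` cbox a b)"
    using has_integral_affinity[of f "integral {a..b} f" a b "b - a" a] I assms(1) by simp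
  also have "(\<lambda>x. (1 / (b - a)) *\<^sub>R x + - ((1 / (b - a)) *\<^sub>R a)) ` cbox a b = {0..1}"
  proof -
    have "(\<lambda>x. (1 / (b - a)) *\<^sub>R x + - ((1 / (b - a)) *\<^sub>R a)) ` cbox a b =
      (\<lambda>x. (1 / (b - a)) * x + - ((1 / (b - a)) * a)) ` {a..b}" by simp
    also have "\<dots> = {0..1}"
    proof -
      have "1 / (b - a) * b + - (1 / (b - a) * a) = 1"
        using assms(1) by (simp add: diff_divide_distrib[symmetric])
      then show ?thesis
        using assms(1) by (subst image_affinity_atLeastAtMost) auto
    qed
    finally show ?thesis .
  qed
  finally have "((\<lambda>x. f ((b - a) *\<^sub>R x + a) * of_real (b - a)) has_integral
      (1 / \<bar>b - a\<bar> ^ DIM(real)) *\<^sub>R integral {a..b} f * of_real (b - a)) {0..1}"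
    by (rule has_integral_mult_left)
  moreover have "(1 / \<bar>b - a\<bar> ^ DIM(real)) *\<^sub>R integral {a..b} f * of_real (b - a) = integral {a..b} f"
    using assms(1) by (simp add: scaleR_conv_of_real field_simps)
  moreover have "linepath a b x = (b - a) *\<^sub>R x + a" for x
    by (simp add: linepath_def algebra_simps)
  ultimately have "((\<lambda>x. f (linepath a b x) * of_real (b - a)) has_integral integral {a..b} f) {0..1}"
    by (simp only:)
  then show ?thesis by (rule integral_unique)
qed

lemma contour_integral_gamma_path:
  assumes "L > 0" and "continuous_on UNIV (\<lambda>t. f (gamma L s1 s2 t))"
  shows "contour_integral (gamma_path L s1 s2) f =
     integral {- (pi / L)..pi / L} (\<lambda>t. f (gamma L s1 s2 t) * (\<i> * L / s2 * exp (\<i> * of_real (L * t))))"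
proof -
  let ?g = "\<lambda>t. \<i> * L / s2 * exp (\<i> * complex_of_real (L * t))"
  let ?a = "- (pi / L)" and ?b = "pi / L"
  have ab: "?a < ?b" using assms(1) by simp
  have d: "vector_derivative (gamma_path L s1 s2) (at x) = ?g (linepath ?a ?b x) * of_real (?b - ?a)" for x
  proof -
    have "(linepath ?a ?b has_vector_derivative ?b - ?a) (at x)"
      by (rule has_vector_derivative_linepath_within)
    from vector_diff_chain_at[OF this gamma_has_vector_derivative]
    have "(gamma_path L s1 s2 has_vector_derivative (?b - ?a) *\<^sub>R ?g (linepath ?a ?b x)) (at x)"
      unfolding gamma_path_def .
    then have "(gamma_path L s1 s2 has_vector_derivative ?g (linepath ?a ?b x) * of_real (?b - ?a)) (at x)"
      by (rule has_vector_derivative_eq_rhs) (simp only: scaleR_conv_of_real mult.commute)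
    then show ?thesis
      by (rule vector_derivative_at)
  qed
  have gp: "gamma_path L s1 s2 x = gamma L s1 s2 (linepath ?a ?b x)" for x
    by (simp add: gamma_path_def)
  have "continuous_on {?a..?b} (\<lambda>t. f (gamma L s1 s2 t) * ?g t)"
    by (intro continuous_intros continuous_on_subset[OF assms(2)]) auto
  then have i: "(\<lambda>t. f (gamma L s1 s2 t) * ?g t) integrable_on {?a..?b}"
    by (rule integrable_continuous_interval)
  have "contour_integral (gamma_path L s1 s2) f =
      integral {0..1} (\<lambda>x. f (gamma_path L s1 s2 x) * vector_derivative (gamma_path L s1 s2) (at x))"
    by (rule contour_integral_integral)
  also have "\<dots> = integral {0..1} (\<lambda>x. (\<lambda>t. f (gamma L s1 s2 t) * ?g t) (linepath ?a ?b x) * of_real (?b - ?a))"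
    by (rule Henstock_Kurzweil_Integration.integral_cong) (simp only: d gp mult.assoc)
  also have "\<dots> = integral {?a..?b} (\<lambda>t. f (gamma L s1 s2 t) * ?g t)"
    by (rule integral_affine_unit[OF ab i])
  finally show ?thesis .
qed

text \<open>This is the winding about 0 of the circle with centre 1/s1 and radius 1/s2, found from
  explicit primitives. For s1 < s2 the circle lies in the right half-plane and Ln o \<gamma> is a
  primitive.\<close>

lemma integral_log_derivative_gamma:
  assumes "L > 0" "s1 > 0" "s2 > 0" "s1 \<noteq> s2"
  shows "integral {- (pi / L)..pi / L} (\<lambda>t. (\<i> * L / s2 * exp (\<i> * of_real (L * t))) / gamma L s1 s2 t)
    = (if s2 < s1 then 2 * pi * \<i> else 0)"
proof -
  let ?e = "\<lambda>t. exp (\<i> * complex_of_real (L * t))"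
  let ?g = "\<lambda>t. \<i> * L / s2 * ?e t"
  let ?a = "- (pi / L)" and ?b = "pi / L"
  have ab: "?a \<le> ?b" using assms(1) by simp
  have eb: "?e ?b = -1" "?e ?a = -1" using assms(1) by (simp_all add: exp_minus)
  have ne: "norm (?e t) = 1" for t by simp
  show ?thesis
  proof (cases "s2 < s1")
    case False
    then have lt: "1 / s2 < 1 / s1" using assms by (simp add: field_simps)
    have "((\<lambda>t. ?g t / gamma L s1 s2 t) has_integral Ln (gamma L s1 s2 ?b) - Ln (gamma L s1 s2 ?a)) {?a..?b}"
    proof (rule fundamental_theorem_of_calculus[OF ab])
      fix t
      have "\<bar>Re (?e t / of_real s2)\<bar> \<le> 1 / s2"
        using abs_Re_le_cmod[of "?e t / of_real s2"] ne[of t] assms(3) by (simp add: norm_divide)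
      moreover have "Re (gamma L s1 s2 t) = 1 / s1 + Re (?e t / of_real s2)"
        by (simp add: gamma_def)
      ultimately have "Re (gamma L s1 s2 t) > 0" using lt by linarith
      then have "gamma L s1 s2 t \<notin> \<real>\<^sub>\<le>\<^sub>0" by (simp add: complex_nonpos_Reals_iff)
      from field_vector_diff_chain_at[OF gamma_has_vector_derivative[of L s1 s2 t] has_field_derivative_Ln[OF this]]
      show "((\<lambda>t. Ln (gamma L s1 s2 t)) has_vector_derivative ?g t / gamma L s1 s2 t) (at t within {?a..?b})"
        unfolding o_def divide_inverse[of "?g t"] by (rule has_vector_derivative_at_within)
    qed
    then show ?thesis using False eb by (simp add: gamma_def integral_unique)
  next
    case True
    then have lt: "s2 / s1 < 1" using assms by (simp add: field_simps)
    \<comment> \<open>When the circle surrounds the origin, \<gamma> = exp(i L t) / s2 times w, with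
      w in the right half-plane: the exponential carries the full turn and w none.\<close>
    define w where "w = (\<lambda>t. 1 + of_real (s2 / s1) * exp (- (\<i> * complex_of_real (L * t))))"
    have gw: "gamma L s1 s2 t = ?e t / of_real s2 * w t" for t
      using assms by (simp add: gamma_def w_def field_simps exp_minus)
    have "((\<lambda>t. ?g t / gamma L s1 s2 t) has_integral
       (\<i> * of_real (L * ?b) + Ln (w ?b)) - (\<i> * of_real (L * ?a) + Ln (w ?a))) {?a..?b}"
    proof (rule fundamental_theorem_of_calculus[OF ab])
      fix t
      let ?v = "of_real (s2 / s1) * exp (- (\<i> * complex_of_real (L * t)))"
      have "\<bar>Re ?v\<bar> \<le> s2 / s1"
        using abs_Re_le_cmod[of ?v] assms by (simp add: norm_mult norm_divide)
      moreover have "Re (w t) = 1 + Re ?v" by (simp only: w_def plus_complex.sel one_complex.sel)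
      ultimately have "Re (w t) > 0" using lt by linarith
      then have wn: "w t \<notin> \<real>\<^sub>\<le>\<^sub>0" by (simp add: complex_nonpos_Reals_iff)
      then have wn0: "w t \<noteq> 0" by auto
      have "((\<lambda>t. exp (- (\<i> * complex_of_real (L * t)))) has_vector_derivative - (\<i> * L) * exp (- (\<i> * of_real (L * t)))) (at t)"
        using exp_phase_has_vector_derivative[of "- \<i>" L t] by simp
      from has_vector_derivative_add[OF has_vector_derivative_const has_vector_derivative_mult_right[OF this]]
      have w': "(w has_vector_derivative - (\<i> * L) * ?v) (at t)"
        unfolding w_def by (rule has_vector_derivative_eq_rhs) (simp add: algebra_simps)
      have i: "((\<lambda>t. \<i> * complex_of_real (L * t)) has_vector_derivative \<i> * L) (at t)"
      proof -
        have "((\<lambda>t. L * t) has_vector_derivative L) (at t)"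
          by (auto intro!: derivative_eq_intros simp: has_real_derivative_iff_has_vector_derivative[symmetric])
        from has_vector_derivative_mult_right[OF bounded_linear.has_vector_derivative[OF bounded_linear_of_real this], of \<i>]
        show ?thesis .
      qed
      from has_vector_derivative_add[OF i field_vector_diff_chain_at[OF w' has_field_derivative_Ln[OF wn]]]
      have "((\<lambda>t. \<i> * of_real (L * t) + Ln (w t)) has_vector_derivative \<i> * L + - (\<i> * L) * ?v * inverse (w t)) (at t)"
        by (simp add: o_def)
      also have "\<i> * L + - (\<i> * L) * ?v * inverse (w t) = \<i> * L / w t"
      proof -
        have "k + - k * x * inverse (1 + x) = k / (1 + x)" if "1 + x \<noteq> 0" for k x :: complex
          using that by (simp add: field_simps)
        then show ?thesis using wn0 unfolding w_def by blast
      qed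
      also have "\<dots> = ?g t / gamma L s1 s2 t"
      proof -
        have "a / b * e / (e / b * x) = a / x" if "b \<noteq> 0" "e \<noteq> 0" for a b e x :: complex
          using that by simp
        then show ?thesis unfolding gw using assms(3) by simp
      qed
      finally show "((\<lambda>t. \<i> * of_real (L * t) + Ln (w t)) has_vector_derivative ?g t / gamma L s1 s2 t) (at t within {?a..?b})"
        by (rule has_vector_derivative_at_within)
    qed
    moreover have "w ?a = w ?b"
      using assms(1) by (simp add: w_def exp_minus)
    moreover have "\<i> * of_real (L * ?b) - \<i> * of_real (L * ?a) = 2 * pi * \<i>"
      using assms(1) by simp
    ultimately show ?thesis using True by (simp add: integral_unique)
  qed
qed

lemma has_vector_derivative_imp_continuous_on:
  assumes "\<And>t. (f has_vector_derivative f' t) (at t)"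
  shows "continuous_on S f"
  by (rule continuous_at_imp_continuous_on) (simp add: has_vector_derivative_continuous[OF assms])

lemma has_integral_of_real:
  "(f has_integral I) S \<Longrightarrow> ((\<lambda>x. complex_of_real (f x)) has_integral of_real I) S"
  using has_integral_linear[OF _ bounded_linear_of_real, of f I S] by (simp add: o_def)

lemma derivative_of_even:
  fixes f :: "real \<Rightarrow> complex"
  assumes "\<And>t. f (- t) = f t" "(f has_vector_derivative d) (at t)" "(f has_vector_derivative d') (at (- t))"
  shows "d' = - d"
proof -
  have "(uminus has_vector_derivative (-1::real)) (at t)"
    using has_vector_derivative_minus[OF has_vector_derivative_id[of "at t"]] by simp
  from vector_diff_chain_at[OF this assms(3)]
  have "((f \<circ> uminus) has_vector_derivative - d') (at t)" by simp
  moreover have "f \<circ> uminus = f" using assms(1) by auto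
  ultimately show ?thesis using vector_derivative_unique_at[OF assms(2)] by force
qed

section \<open>Parity and closed form of the limiting integrand\<close>

context
  fixes L l s1 s2 :: real and v1 v2 :: complex and sqf :: "complex \<Rightarrow> complex"
  assumes pos: "L > 0" "l > 0" "s1 > 0" "s2 > 0" and v: "v1 \<noteq> 0" "v2 \<noteq> 0"
    and zero_off_path: "0 \<notin> path_image (gamma_path L s1 s2)"
    and branch: "sqrt_branch L s1 s2 v1 v2 sqf"
    and sqf_nonzero: "\<And>t. sqf (gamma L s1 s2 t) \<noteq> 0"
begin

private abbreviation (input) "z \<equiv> gamma L s1 s2"
private abbreviation (input) "r t \<equiv> sqf (gamma L s1 s2 t)"
private abbreviation (input) "z' t \<equiv> \<i> * complex_of_real L / complex_of_real s2 * exp (\<i> * complex_of_real (L * t))"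
private abbreviation (input) "A \<equiv> cap_a s1 s2 * (v2\<^sup>2 - v1\<^sup>2)"

lemma gamma_nonzero: "z t \<noteq> 0"
  using zero_off_path gamma_in_path_image[OF pos(1), of s1 s2 t] by auto

lemma spacings_distinct: "s1 \<noteq> s2"
proof
  assume "s1 = s2"
  then have "z (pi / L) = 0" using pos by (simp add: gamma_def)
  then show False using gamma_nonzero by blast
qed

lemma gamma_continuous: "continuous_on S z"
  by (rule has_vector_derivative_imp_continuous_on) (rule gamma_has_vector_derivative)

lemma sqf_gamma_continuous: "continuous_on S (\<lambda>t. r t)"
  by (rule continuous_on_compose2[OF _ gamma_continuous])
     (use branch gamma_in_path_image[OF pos(1)] in \<open>auto simp: sqrt_branch_def\<close>)

lemma sqf_gamma_square:
  "(r t)\<^sup>2 = (cap_a s1 s2)\<^sup>2 * (v1\<^sup>2 - v2\<^sup>2)\<^sup>2 + 4 * v1\<^sup>2 * v2\<^sup>2 * (z t * cnj (z t))"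
  using branch gamma_in_path_image[OF pos(1), of s1 s2 t]
  unfolding sqrt_branch_def zak_f_def cap_a_def complex_norm_square by blast

text \<open>f depends on |z| only, and \<gamma>(-t) is the conjugate of \<gamma>(t), so the quotient
  of the two roots is 1 or -1 at each t. Being continuous with finite range it is constant, and it
  is 1 at t = 0.\<close>

lemma sqf_gamma_even: "r (- t) = r t"
proof -
  let ?q = "\<lambda>t. r (- t) / r t"
  have "z (- t) * cnj (z (- t)) = z t * cnj (z t)" for t
    by (simp add: gamma_reflect mult.commute)
  then have "(r (- t))\<^sup>2 = (r t)\<^sup>2" for t
    by (simp only: sqf_gamma_square)
  then have "(?q t)\<^sup>2 = 1" for t using sqf_nonzero[of t] by (simp add: power_divide)
  then have "?q t \<in> {1, - 1}" for t by (simp add: power2_eq_1_iff)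
  then have "finite (range ?q)" by (meson finite.emptyI finite.insertI finite_subset image_subsetI)
  moreover have "continuous_on UNIV ?q"
  proof -
    have "continuous_on UNIV (\<lambda>t. r (- t))"
      by (rule continuous_on_compose2[OF sqf_gamma_continuous[of UNIV] continuous_on_minus[OF continuous_on_id]]) auto
    then show ?thesis using sqf_gamma_continuous sqf_nonzero by (intro continuous_intros) auto
  qed
  ultimately have "?q constant_on UNIV"
    by (intro continuous_finite_range_constant) auto
  then obtain k where "\<And>t. ?q t = k" unfolding constant_on_def by auto
  then have "?q t = ?q 0" by metis
  then show ?thesis using sqf_nonzero[of 0] sqf_nonzero[of t] by simp
qed

text \<open>The branch is assumed continuous only; its square is smooth along \<gamma> and does not
  vanish, so the branch is a simple root of w^2 = f.\<close>

lemma sqf_gamma_differentiable: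
  obtains r' where "\<And>t. ((\<lambda>t. r t) has_vector_derivative r' t) (at t)" "continuous_on UNIV r'"
proof -
  define f' where "f' = (\<lambda>t. 4 * v1\<^sup>2 * v2\<^sup>2 * (z t * cnj (z' t) + z' t * cnj (z t)))"
  have "((\<lambda>t. r t) has_vector_derivative f' t / (2 * r t)) (at t)" for t
  proof (rule implicit_root_has_vector_derivative[where \<phi> = "\<lambda>w. w\<^sup>2"])
    show "((\<lambda>w. w\<^sup>2) has_field_derivative 2 * r t) (at (r t))"
      by (auto intro!: derivative_eq_intros)
    show "isCont (\<lambda>t. r t) t"
      using sqf_gamma_continuous[of UNIV] by (simp add: continuous_on_eq_continuous_at)
    show "((\<lambda>s. (r s)\<^sup>2) has_vector_derivative f' t) (at t)"
      unfolding sqf_gamma_square f'_def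
      using has_vector_derivative_add[OF has_vector_derivative_const has_vector_derivative_mult_right[OF
          has_vector_derivative_mult[OF gamma_has_vector_derivative[of L s1 s2 t]
            has_vector_derivative_cnj[OF gamma_has_vector_derivative[of L s1 s2 t]]]]]
      by simp
  qed (use sqf_nonzero in simp)
  moreover have "continuous_on UNIV (\<lambda>t. f' t / (2 * r t))"
    unfolding f'_def
    by (intro continuous_intros gamma_continuous sqf_gamma_continuous) (use sqf_nonzero in auto)
  ultimately show thesis by (rule that)
qed

context
  fixes i j :: nat
  assumes ij: "(i, j) = (1, 2) \<or> (i, j) = (2, 1)"
begin

private abbreviation (input) "\<mu> \<equiv> limit_eigenvalue L l s1 s2 v1 v2 sqf"
private abbreviation (input) "\<beta> \<equiv> limit_ratio L l s1 s2 v1 v2 sqf i"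

lemma limit_eigenvalue_continuous: "continuous_on UNIV (\<mu> k)"
  unfolding limit_eigenvalue_def
  by (intro continuous_intros sqf_gamma_continuous) (use pos in auto)

lemma limit_eigenvalues_distinct: "\<mu> i t \<noteq> \<mu> j t"
  using sqf_nonzero[of t] ij pos by (auto simp: limit_eigenvalue_def)

text \<open>Both sides are quadratics in w with the same leading coefficient C; by Vieta it remains
  to compare the sum and the product of the eigenvalues.\<close>

lemma limit_trace_factor:
  fixes w :: complex
  shows "2 - w * (s1 + s2) * (1 / v1\<^sup>2 + 1 / v2\<^sup>2) * l + w\<^sup>2 * (s1 * s2) * (1 / v1\<^sup>2 * (1 / v2\<^sup>2)) * (of_real l)\<^sup>2
    - (exp (\<i> * of_real (L * t)) + exp (- (\<i> * of_real (L * t)))) =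
   s1 * s2 * l\<^sup>2 / (v1\<^sup>2 * v2\<^sup>2) * (w - \<mu> i t) * (w - \<mu> j t)"
proof -
  define a where "a = cap_a s1 s2"
  define e where "e = exp (\<i> * complex_of_real (L * t))"
  define e' where "e' = exp (- (\<i> * complex_of_real (L * t)))"
  have nz: "complex_of_real s1 \<noteq> 0" "complex_of_real s2 \<noteq> 0" "complex_of_real l \<noteq> 0" "v1\<^sup>2 \<noteq> 0" "v2\<^sup>2 \<noteq> 0"
    using pos v by auto
  have ee: "e * e' = 1" by (simp add: e_def e'_def exp_minus)
  have a: "s1 * s2 * a = s1 + s2" using nz by (simp add: a_def cap_a_def field_simps)
  \<comment> \<open>With e + e' = 2 cos (L t), the value |\<gamma>|^2 falls short of a^2 by (2 - 2
    cos (L t)) / (s1 s2), which turns f into the Bloch term of the dispersion relation.\<close>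
  have zz: "z t * cnj (z t) = (1 / of_real s1 + e / of_real s2) * (1 / of_real s1 + e' / of_real s2)"
    by (simp add: gamma_def e_def e'_def exp_cnj)
  also have "\<dots> = a\<^sup>2 - (2 - (e + e')) / (s1 * s2)"
    using ee nz by (simp add: a_def cap_a_def power2_eq_square field_simps)
  finally have zz: "z t * cnj (z t) = a\<^sup>2 - (2 - (e + e')) / (s1 * s2)" .
  have sum: "\<mu> i t + \<mu> j t = a * (v1\<^sup>2 + v2\<^sup>2) / l"
    using ij nz by (auto simp: limit_eigenvalue_def a_def field_simps)
  have "\<mu> i t * \<mu> j t = (a\<^sup>2 * (v1\<^sup>2 + v2\<^sup>2)\<^sup>2 - (r t)\<^sup>2) / (4 * (of_real l)\<^sup>2)"
    using ij nz by (auto simp: limit_eigenvalue_def a_def power2_eq_square field_simps)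
  also have "a\<^sup>2 * (v1\<^sup>2 + v2\<^sup>2)\<^sup>2 - (r t)\<^sup>2 = 4 * (v1\<^sup>2 * v2\<^sup>2) * ((2 - (e + e')) / (s1 * s2))"
    unfolding sqf_gamma_square zz a_def by algebra
  finally have prod: "\<mu> i t * \<mu> j t = v1\<^sup>2 * v2\<^sup>2 * ((2 - (e + e')) / (s1 * s2)) / (of_real l)\<^sup>2"
    by (simp add: mult.assoc)
  define C where "C = s1 * s2 * l\<^sup>2 / (v1\<^sup>2 * v2\<^sup>2)"
  have "C * (\<mu> i t * \<mu> j t) = 2 - (e + e')"
    unfolding prod C_def using nz by (simp add: field_simps)
  moreover have "C * (\<mu> i t + \<mu> j t) = (s1 + s2) * (1 / v1\<^sup>2 + 1 / v2\<^sup>2) * l"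
  proof -
    have "C * (\<mu> i t + \<mu> j t) = (s1 * s2 * a) * (l * (v1\<^sup>2 + v2\<^sup>2) / (v1\<^sup>2 * v2\<^sup>2))"
      unfolding sum C_def using nz by (simp add: field_simps power2_eq_square)
    then show ?thesis unfolding a using nz by (simp add: field_simps)
  qed
  moreover have "C = (s1 * s2) * (1 / v1\<^sup>2 * (1 / v2\<^sup>2)) * (of_real l)\<^sup>2"
    by (simp add: C_def)
  moreover have "C * (w - \<mu> i t) * (w - \<mu> j t) = C * w\<^sup>2 - w * (C * (\<mu> i t + \<mu> j t)) + C * (\<mu> i t * \<mu> j t)"
    by (simp add: algebra_simps power2_eq_square)
  ultimately have "C * (w - \<mu> i t) * (w - \<mu> j t) =
     (s1 * s2) * (1 / v1\<^sup>2 * (1 / v2\<^sup>2)) * (of_real l)\<^sup>2 * w\<^sup>2 - w * ((s1 + s2) * (1 / v1\<^sup>2 + 1 / v2\<^sup>2) * l) + (2 - (e + e'))"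
    by metis
  note eq = this
  show ?thesis unfolding C_def[symmetric] e_def[symmetric] e'_def[symmetric] eq
    by (simp add: algebra_simps add_divide_distrib)
qed

private abbreviation (input) "\<sigma> \<equiv> (- 1 :: complex) ^ i"

private lemma sign_square: "\<sigma> * \<sigma> = 1"
  using ij by auto

text \<open>The product is A^2 - f, in which the part of f without \<gamma> cancels. Since \<gamma>
  has no zeros on the real line, neither factor vanishes.\<close>

private lemma signed_conjugates: "(A - \<sigma> * r t) * (A + \<sigma> * r t) = - 4 * v1\<^sup>2 * v2\<^sup>2 * (z t * cnj (z t))"
proof -
  have eq: "(A - \<sigma> * r t) * (A + \<sigma> * r t) = A\<^sup>2 - (\<sigma> * \<sigma>) * (r t)\<^sup>2"
    by (simp add: power2_eq_square algebra_simps)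
  show ?thesis unfolding eq sign_square sqf_gamma_square
    by (simp add: power_mult_distrib power2_commute[of "v1\<^sup>2" "v2\<^sup>2"])
qed

private lemma signed_nonzero: "A - \<sigma> * r t \<noteq> 0"
  using signed_conjugates[of t] gamma_nonzero[of t] v by auto

private lemma ratio_denominator:
  "cap_a s1 s2 - \<mu> i t * of_real l / v2\<^sup>2 = (A - \<sigma> * r t) / (2 * v2\<^sup>2)"
  using pos v by (simp add: limit_eigenvalue_def field_simps)

lemma limit_ratio_denominator_nonzero: "cap_a s1 s2 - \<mu> i t * of_real l / v2\<^sup>2 \<noteq> 0"
  unfolding ratio_denominator using signed_nonzero[of t] v by simp

private lemma ratio_eq: "\<beta> t = 2 * v2\<^sup>2 / (A - \<sigma> * r t)"
  unfolding limit_ratio_def ratio_denominator by simp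

lemma limit_ratio_even: "\<beta> (- t) = \<beta> t"
  unfolding ratio_eq sqf_gamma_even ..

lemma limit_ratio_differentiable:
  obtains \<beta>' where "\<And>t. (\<beta> has_vector_derivative \<beta>' t) (at t)" "continuous_on UNIV \<beta>'"
proof -
  obtain r' where r': "\<And>t. ((\<lambda>t. r t) has_vector_derivative r' t) (at t)" "continuous_on UNIV r'"
    using sqf_gamma_differentiable by blast
  define \<beta>' where "\<beta>' = (\<lambda>t. \<sigma> * r' t * (2 * v2\<^sup>2 / (A - \<sigma> * r t)\<^sup>2))"
  have "(\<beta> has_vector_derivative \<beta>' t) (at t)" for t
  proof -
    have "((\<lambda>w. 2 * v2\<^sup>2 / (A - \<sigma> * w)) has_field_derivative \<sigma> * (2 * v2\<^sup>2 / (A - \<sigma> * r t)\<^sup>2)) (at (r t))"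
      by (rule derivative_eq_intros refl signed_nonzero)+ (simp add: power2_eq_square)
    from field_vector_diff_chain_at[OF r'(1)[of t] this]
    show ?thesis unfolding \<beta>'_def by (simp add: o_def ratio_eq[abs_def] mult_ac)
  qed
  moreover have "continuous_on UNIV \<beta>'"
    unfolding \<beta>'_def
    by (intro continuous_intros r'(2) sqf_gamma_continuous) (use signed_nonzero in auto)
  ultimately show thesis by (rule that)
qed

private definition Pz where "Pz t = l * (1 / v1\<^sup>2 + 1 / v2\<^sup>2 * ((\<beta> t * cnj (z t)) * (\<beta> t * z t)))"

text \<open>With x = A - \<sigma> r and y = A + \<sigma> r the product x y eliminates |\<gamma>|^2,
  and the share of the second resonator in the pairing becomes y / (y - x). Of its two terms, 1
  leads to the winding of \<gamma> and A / (\<sigma> r) to the contour integral.\<close>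

private lemma pairing_eq: "Pz t = - 2 * l * \<sigma> * r t / (v1\<^sup>2 * (A - \<sigma> * r t))"
  and pairing_ratio: "l * (1 / v2\<^sup>2) * ((\<beta> t)\<^sup>2 * (z t * cnj (z t))) / Pz t = (1 + A / (\<sigma> * r t)) / 2"
proof -
  define x where "x = A - \<sigma> * r t"
  define y where "y = A + \<sigma> * r t"
  have nz: "x \<noteq> 0" "v1\<^sup>2 \<noteq> 0" "v2\<^sup>2 \<noteq> 0" "complex_of_real l \<noteq> 0" "\<sigma> * r t \<noteq> 0"
    using signed_nonzero[of t] v pos sqf_nonzero[of t] by (auto simp: x_def)
  have xy: "z t * cnj (z t) = - (x * y) / (4 * v1\<^sup>2 * v2\<^sup>2)"
    using signed_conjugates[of t] nz by (simp add: x_def y_def field_simps)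
  have b: "1 / v2\<^sup>2 * ((\<beta> t)\<^sup>2 * (z t * cnj (z t))) = - (y / (v1\<^sup>2 * x))"
    unfolding ratio_eq x_def[symmetric] xy using nz by (simp add: field_simps power2_eq_square)
  have "Pz t = l * (1 / v1\<^sup>2 + 1 / v2\<^sup>2 * ((\<beta> t)\<^sup>2 * (z t * cnj (z t))))"
    by (simp add: Pz_def power2_eq_square mult_ac)
  also have "\<dots> = l * ((x - y) / (v1\<^sup>2 * x))" unfolding b using nz by (simp add: field_simps)
  also have "x - y = - 2 * (\<sigma> * r t)" by (simp add: x_def y_def)
  finally have P: "Pz t = l * (- 2 * (\<sigma> * r t) / (v1\<^sup>2 * x))" .
  then show "Pz t = - 2 * l * \<sigma> * r t / (v1\<^sup>2 * (A - \<sigma> * r t))" by (simp add: x_def)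
  have "l * (1 / v2\<^sup>2) * ((\<beta> t)\<^sup>2 * (z t * cnj (z t))) / Pz t = l * (1 / v2\<^sup>2 * ((\<beta> t)\<^sup>2 * (z t * cnj (z t)))) / Pz t"
    by (simp only: mult.assoc)
  also have "\<dots> = l * (- (y / (v1\<^sup>2 * x))) / (l * (- 2 * (\<sigma> * r t) / (v1\<^sup>2 * x)))"
    unfolding b P ..
  also have "\<dots> = y / (2 * (\<sigma> * r t))" using nz by (simp add: field_simps)
  also have "\<dots> = (1 + A / (\<sigma> * r t)) / 2" using nz by (simp add: y_def add_divide_distrib)
  finally show "l * (1 / v2\<^sup>2) * ((\<beta> t)\<^sup>2 * (z t * cnj (z t))) / Pz t = (1 + A / (\<sigma> * r t)) / 2" .
qed

lemma limit_pairing_nonzero: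
  "l * (1 / v1\<^sup>2 + 1 / v2\<^sup>2 * ((\<beta> t * cnj (z t)) * (\<beta> t * z t))) \<noteq> 0"
  unfolding Pz_def[symmetric] pairing_eq using signed_nonzero[of t] v pos sqf_nonzero[of t] by simp

lemma limit_pairing_even:
  "l * (1 / v1\<^sup>2 + 1 / v2\<^sup>2 * ((\<beta> (- t) * cnj (z (- t))) * (\<beta> (- t) * z (- t)))) =
   l * (1 / v1\<^sup>2 + 1 / v2\<^sup>2 * ((\<beta> t * cnj (z t)) * (\<beta> t * z t)))"
  unfolding limit_ratio_even gamma_reflect by (simp add: mult_ac)

text \<open>
  The symmetric part of the integrand is the logarithmic derivative of the pairing; the
  antisymmetric part does not involve the derivative of \<open>limit_ratio\<close>.
\<close>

lemma limit_zak_integral: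
  fixes \<beta>' :: "real \<Rightarrow> complex"
  defines "P0 \<equiv> \<lambda>t. l * (1 / v1\<^sup>2 + 1 / v2\<^sup>2 * ((\<beta> t * cnj (z t)) * (\<beta> t * z t)))"
    and "N0 \<equiv> \<lambda>t. l * (1 / v2\<^sup>2) * ((\<beta> t * cnj (z t)) * (\<beta> t * z' t + \<beta>' t * z t))"
    and "M0 \<equiv> \<lambda>t. l * (1 / v2\<^sup>2) * ((\<beta> t * cnj (z' t) + \<beta>' t * cnj (z t)) * (\<beta> t * z t))"
    and "J \<equiv> {- (pi / L)..pi / L}"
  assumes \<beta>': "\<And>t. (\<beta> has_vector_derivative \<beta>' t) (at t)" "continuous_on UNIV \<beta>'"
  shows "(P0 has_vector_derivative N0 t + M0 t) (at t)"
    and "continuous_on S (\<lambda>t. N0 t + M0 t)"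
    and "integral J (\<lambda>t. (N0 t + M0 t) / P0 t) = 0"
    and "\<i> / 2 * integral J (\<lambda>t. N0 t / P0 t + cnj (M0 t / P0 t)) =
      of_real ((- 1) ^ (i + 1) * ((s1 + s2) / (2 * s1 * s2))
         * Im ((v2\<^sup>2 - v1\<^sup>2) * contour_integral (gamma_path L s1 s2) (\<lambda>z. 1 / (z * sqf z)))
       - pi * (if s2 < s1 then 1 else 0))"
proof -
  have P0: "P0 = Pz" by (auto simp: P0_def Pz_def)
  have nz: "P0 t \<noteq> 0" for t using limit_pairing_nonzero by (simp add: P0_def)
  have cb: "continuous_on S \<beta>" for S
    using \<beta>'(1) by (rule has_vector_derivative_imp_continuous_on)
  have cb': "continuous_on S \<beta>'" for S using \<beta>'(2) continuous_on_subset by blast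
  show P': "(P0 has_vector_derivative N0 t + M0 t) (at t)" for t
  proof -
    note bz = has_vector_derivative_mult[OF \<beta>'(1)[of t] gamma_has_vector_derivative[of L s1 s2 t]]
    note bc = has_vector_derivative_mult[OF \<beta>'(1)[of t] has_vector_derivative_cnj[OF gamma_has_vector_derivative[of L s1 s2 t]]]
    show ?thesis
      unfolding P0_def N0_def M0_def
      by (rule has_vector_derivative_eq_rhs[OF has_vector_derivative_mult_right[OF has_vector_derivative_add[OF
          has_vector_derivative_const has_vector_derivative_mult_right[OF has_vector_derivative_mult[OF bc bz]]]]])
         (simp add: algebra_simps)
  qed
  show cNM: "continuous_on S (\<lambda>t. N0 t + M0 t)" for S
    unfolding N0_def M0_def by (intro continuous_intros cb cb' gamma_continuous)
  have cP: "continuous_on S P0" for S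
    using P' by (rule has_vector_derivative_imp_continuous_on)
  show wind: "integral J (\<lambda>t. (N0 t + M0 t) / P0 t) = 0"
    unfolding J_def
  \<comment> \<open>The pairing is even in t, so its derivative N0 + M0 is odd.\<close>
  proof (rule integral_odd_eq_0)
    fix t
    have ev: "P0 (- t) = P0 t" for t unfolding P0_def by (rule limit_pairing_even)
    have "N0 (- t) + M0 (- t) = - (N0 t + M0 t)"
      by (rule derivative_of_even[where f = P0, OF ev P' P'])
    then show "(N0 (- t) + M0 (- t)) / P0 (- t) = - ((N0 t + M0 t) / P0 t)"
      by (simp add: ev minus_divide_left)
  qed
  define w where "w = (\<lambda>t. z' t / z t)"
  \<comment> \<open>For w = \<gamma>' / \<gamma> this says that the real part is odd and the
    imaginary part even.\<close>
  have w_reflect: "w (- t) = - cnj (w t)" for t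
    unfolding w_def gamma_reflect by (simp add: exp_cnj)
  have cw: "continuous_on S w" for S
    unfolding w_def using gamma_nonzero by (intro continuous_intros gamma_continuous) auto
  have cr: "continuous_on S (\<lambda>t. f / r t)" for S and f :: complex
    using sqf_nonzero by (intro continuous_intros sqf_gamma_continuous) auto
  \<comment> \<open>The terms with \<beta>' cancel in N0 - M0, and w - cnj w leaves only Im w,
    multiplied by the share of the second resonator.\<close>
  have anti: "(N0 t - M0 t) / P0 t = \<i> * of_real (Im (w t)) * (1 + A / (\<sigma> * r t))" for t
  proof -
    have "N0 t - M0 t = l * (1 / v2\<^sup>2) * (\<beta> t)\<^sup>2 * (cnj (z t) * z' t - cnj (z' t) * z t)"
      unfolding N0_def M0_def by (simp add: algebra_simps power2_eq_square)
    also have "cnj (z t) * z' t - cnj (z' t) * z t = (z t * cnj (z t)) * (w t - cnj (w t))"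
      unfolding w_def using gamma_nonzero[of t] by (simp add: field_simps)
    also have "w t - cnj (w t) = 2 * \<i> * of_real (Im (w t))"
      by (simp add: complex_eq_iff)
    finally have "(N0 t - M0 t) / P0 t = (l * (1 / v2\<^sup>2) * ((\<beta> t)\<^sup>2 * (z t * cnj (z t))) / Pz t) * (2 * \<i> * of_real (Im (w t)))"
      unfolding P0 by (simp add: mult_ac)
    then show ?thesis unfolding pairing_ratio by simp
  qed
  \<comment> \<open>For complex n and m, n + cnj m = Re (n + m) + i Im (n - m): the sum integrates
    to 0 and the difference is known in closed form.\<close>
  have split: "N0 t / P0 t + cnj (M0 t / P0 t) =
     of_real (Re ((N0 t + M0 t) / P0 t)) + \<i> * of_real (Im (w t) * (1 + Re (A / (\<sigma> * r t))))" for t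
  proof -
    have "Im ((N0 t - M0 t) / P0 t) = Im (w t) * (1 + Re (A / (\<sigma> * r t)))"
      unfolding anti by simp
    then show ?thesis
      by (simp add: complex_eq_iff add_divide_distrib diff_divide_distrib del: complex_cnj_divide)
  qed
  define S where "S = (s1 + s2) / (s1 * s2)"
  define X where "X = Im ((v2\<^sup>2 - v1\<^sup>2) * contour_integral (gamma_path L s1 s2) (\<lambda>z. 1 / (z * sqf z)))"
  define Q where "Q = (\<lambda>t. Im (w t) * (1 + Re (A / (\<sigma> * r t))))"
  have split': "N0 t / P0 t + cnj (M0 t / P0 t) =
     of_real (Re ((N0 t + M0 t) / P0 t)) + \<i> * of_real (Q t)" for t
    unfolding split Q_def ..
  have cS: "continuous_on J (\<lambda>t. (N0 t + M0 t) / P0 t)"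
    using nz by (intro continuous_on_divide cNM cP) auto
  have cAr: "continuous_on S (\<lambda>t. A / (\<sigma> * r t))" for S
    using cr[of S "A / \<sigma>"] by (simp add: divide_divide_eq_left)
  have cQ: "continuous_on J Q" unfolding Q_def by (intro continuous_intros cw cAr)
  have ReS: "integral J (\<lambda>t. complex_of_real (Re ((N0 t + M0 t) / P0 t))) = 0"
  proof -
    have "(\<lambda>t. (N0 t + M0 t) / P0 t) integrable_on J"
      using cS unfolding J_def by (rule integrable_continuous_interval)
    from has_integral_Re[OF integrable_integral[OF this]]
    have "((\<lambda>t. Re ((N0 t + M0 t) / P0 t)) has_integral 0) J" unfolding wind by simp
    from has_integral_of_real[OF this] show ?thesis by (simp add: integral_unique)
  qed
  have "integral J (\<lambda>t. N0 t / P0 t + cnj (M0 t / P0 t)) =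
     integral J (\<lambda>t. complex_of_real (Re ((N0 t + M0 t) / P0 t))) + integral J (\<lambda>t. \<i> * complex_of_real (Q t))"
    unfolding split' J_def
    by (intro integral_add integrable_continuous_interval continuous_intros cS[unfolded J_def] cQ[unfolded J_def])
  also have "\<dots> = \<i> * of_real (integral J Q)"
  proof -
    have "Q integrable_on J" using cQ unfolding J_def by (rule integrable_continuous_interval)
    from has_integral_of_real[OF integrable_integral[OF this]]
    show ?thesis unfolding ReS by (simp add: integral_unique)
  qed
  \<comment> \<open>The factor i / 2 meets the i of the surviving part, hence the sign in
    -1/2.\<close>
  finally have step1: "\<i> / 2 * integral J (\<lambda>t. N0 t / P0 t + cnj (M0 t / P0 t)) = of_real (- integral J Q / 2)"
    by simp
  have "integral J Q = integral J (\<lambda>t. Im (w t)) + integral J (\<lambda>t. Re (A / (\<sigma> * r t)) * Im (w t))"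
  proof -
    have "Q = (\<lambda>t. Im (w t) + Re (A / (\<sigma> * r t)) * Im (w t))" by (auto simp: Q_def algebra_simps)
    then show ?thesis unfolding J_def
      by (simp only:) (intro integral_add integrable_continuous_interval continuous_intros cw cAr)
  qed
  moreover have "integral J (\<lambda>t. Im (w t)) = (if s2 < s1 then 2 * pi else 0)"
  proof -
    have "w integrable_on J" using cw unfolding J_def by (rule integrable_continuous_interval)
    from has_integral_Im[OF integrable_integral[OF this]]
    have "integral J (\<lambda>t. Im (w t)) = Im (integral J w)" by (rule integral_unique)
    also have "integral J w = (if s2 < s1 then 2 * pi * \<i> else 0)"
      unfolding w_def J_def by (rule integral_log_derivative_gamma[OF pos(1,3,4) spacings_distinct])
    finally show ?thesis by simp
  qed
  moreover have "integral J (\<lambda>t. Re (A / (\<sigma> * r t)) * Im (w t)) =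
     (- 1) ^ i * ((s1 + s2) / (s1 * s2)) * Im ((v2\<^sup>2 - v1\<^sup>2) * contour_integral (gamma_path L s1 s2) (\<lambda>z. 1 / (z * sqf z)))"
  proof -
    have a: "cap_a s1 s2 = of_real ((s1 + s2) / (s1 * s2))" using pos by (simp add: cap_a_def field_simps)
    have cq: "continuous_on UNIV (\<lambda>t. 1 / (z t * r t))"
      using gamma_nonzero sqf_nonzero by (intro continuous_intros gamma_continuous sqf_gamma_continuous) auto
    have ci: "contour_integral (gamma_path L s1 s2) (\<lambda>z. 1 / (z * sqf z)) = integral J (\<lambda>t. w t / r t)"
      unfolding contour_integral_gamma_path[OF pos(1) cq] J_def w_def
      by (rule Henstock_Kurzweil_Integration.integral_cong) simp
    \<comment> \<open>The root is even and Re w odd, so the contour integral sees Im w only and can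
      be compared with the integral of Q.\<close>
    have "integral J (\<lambda>t. complex_of_real (Re (w t)) / r t) = 0"
      unfolding J_def by (rule integral_odd_eq_0) (simp add: w_reflect sqf_gamma_even)
    moreover have "integral J (\<lambda>t. w t / r t) =
        integral J (\<lambda>t. complex_of_real (Re (w t)) / r t) + integral J (\<lambda>t. \<i> * complex_of_real (Im (w t)) / r t)"
    proof -
      have "w t / r t = complex_of_real (Re (w t)) / r t + \<i> * complex_of_real (Im (w t)) / r t" for t
        by (subst complex_eq[of "w t"]) (simp add: add_divide_distrib)
      then show ?thesis unfolding J_def
        by (simp only:) (intro integral_add integrable_continuous_interval continuous_intros cw sqf_gamma_continuous; use sqf_nonzero in auto)
    qed
    ultimately have ci2: "contour_integral (gamma_path L s1 s2) (\<lambda>z. 1 / (z * sqf z)) =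
        integral J (\<lambda>t. \<i> * complex_of_real (Im (w t)) / r t)" unfolding ci by simp
    have ii: "(\<lambda>t. \<i> * complex_of_real (Im (w t)) / r t) integrable_on J"
      unfolding J_def
      by (intro integrable_continuous_interval continuous_intros cw sqf_gamma_continuous) (use sqf_nonzero in auto)
    from has_integral_Im[OF has_integral_mult_right[OF integrable_integral[OF ii], of "v2\<^sup>2 - v1\<^sup>2"]]
    have I: "((\<lambda>t. Im ((v2\<^sup>2 - v1\<^sup>2) * (\<i> * complex_of_real (Im (w t)) / r t))) has_integral
      Im ((v2\<^sup>2 - v1\<^sup>2) * contour_integral (gamma_path L s1 s2) (\<lambda>z. 1 / (z * sqf z)))) J"
      unfolding ci2 .
    have "Re (A / (\<sigma> * r t)) * Im (w t) = ((- 1) ^ i * ((s1 + s2) / (s1 * s2))) * Im ((v2\<^sup>2 - v1\<^sup>2) * (\<i> * complex_of_real (Im (w t)) / r t))" for t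
    proof -
      have s: "1 / \<sigma> = of_real ((- 1) ^ i)" using ij by auto
      have "A / (\<sigma> * r t) = 1 / \<sigma> * (cap_a s1 s2 * ((v2\<^sup>2 - v1\<^sup>2) / r t))" by simp
      then have "A / (\<sigma> * r t) = of_real ((- 1) ^ i * ((s1 + s2) / (s1 * s2))) * ((v2\<^sup>2 - v1\<^sup>2) / r t)"
        unfolding s a by (simp only: of_real_mult mult.assoc)
      then have "Re (A / (\<sigma> * r t)) = ((- 1) ^ i * ((s1 + s2) / (s1 * s2))) * Re ((v2\<^sup>2 - v1\<^sup>2) / r t)"
        by (simp only: Re_complex_of_real times_complex.sel Im_complex_of_real mult_zero_left diff_zero)
      moreover have "(v2\<^sup>2 - v1\<^sup>2) * (\<i> * complex_of_real (Im (w t)) / r t) = \<i> * (of_real (Im (w t)) * ((v2\<^sup>2 - v1\<^sup>2) / r t))"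
        by simp
      then have "Im ((v2\<^sup>2 - v1\<^sup>2) * (\<i> * complex_of_real (Im (w t)) / r t)) = Im (w t) * Re ((v2\<^sup>2 - v1\<^sup>2) / r t)"
        by (simp only: Im_i_times Re_complex_of_real times_complex.simps(1) Im_complex_of_real mult_zero_left diff_zero)
      ultimately show ?thesis by simp
    qed
    then have "integral J (\<lambda>t. Re (A / (\<sigma> * r t)) * Im (w t)) =
      integral J (\<lambda>t. ((- 1) ^ i * ((s1 + s2) / (s1 * s2))) * Im ((v2\<^sup>2 - v1\<^sup>2) * (\<i> * complex_of_real (Im (w t)) / r t)))"
      by presburger
    also have "\<dots> = ((- 1) ^ i * ((s1 + s2) / (s1 * s2))) * Im ((v2\<^sup>2 - v1\<^sup>2) * contour_integral (gamma_path L s1 s2) (\<lambda>z. 1 / (z * sqf z)))"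
      using has_integral_mult_right[OF I] by (rule integral_unique)
    finally show ?thesis .
  qed
  ultimately have "integral J Q = (if s2 < s1 then 2 * pi else 0) + (- 1) ^ i * S * X"
    unfolding S_def X_def by (simp only:)
  then have "- integral J Q / 2 = (- 1) ^ (i + 1) * (S / 2) * X - pi * (if s2 < s1 then 1 else 0)"
    by (simp add: add_divide_distrib)
  also have "S / 2 = (s1 + s2) / (2 * s1 * s2)" by (simp add: S_def)
  finally have "- integral J Q / 2 = (- 1) ^ (i + 1) * ((s1 + s2) / (2 * s1 * s2)) * X
      - pi * (if s2 < s1 then 1 else 0)" .
  then show "\<i> / 2 * integral J (\<lambda>t. N0 t / P0 t + cnj (M0 t / P0 t)) =
      of_real ((- 1) ^ (i + 1) * ((s1 + s2) / (2 * s1 * s2))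
         * Im ((v2\<^sup>2 - v1\<^sup>2) * contour_integral (gamma_path L s1 s2) (\<lambda>z. 1 / (z * sqf z)))
       - pi * (if s2 < s1 then 1 else 0))"
    unfolding step1 X_def by (simp only:)
qed

end

end

section \<open>Asymptotics of the Zak phase\<close>

definition wave_weights :: "complex \<Rightarrow> complex \<Rightarrow> real \<Rightarrow> nat \<Rightarrow> complex" where
  "wave_weights v1 v2 v k = [1 / v1\<^sup>2, 1 / of_real (v\<^sup>2), 1 / v2\<^sup>2, 1 / of_real (v\<^sup>2)] ! k"

lemma wave_weights_simps [simp]:
  "wave_weights v1 v2 v 0 = 1 / v1\<^sup>2" "wave_weights v1 v2 v (Suc 0) = 1 / of_real (v\<^sup>2)"
  "wave_weights v1 v2 v 2 = 1 / v2\<^sup>2" "wave_weights v1 v2 v 3 = 1 / of_real (v\<^sup>2)"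
  by (simp_all add: wave_weights_def)

text \<open>The wave speeds do not depend on the contrast, so its value 1 decides.\<close>

lemma high_contrast_nonzero:
  assumes "high_contrast_family v1 v2 v rho rho_b kappa kappa1 kappa2"
  shows "v1 \<noteq> 0" "v2 \<noteq> 0" "v \<noteq> 0"
proof -
  have "(1::real) > 0" by simp
  with assms have "rho 1 > 0 \<and> rho_b 1 > 0 \<and> kappa 1 > 0 \<and> kappa1 1 \<noteq> 0 \<and> kappa2 1 \<noteq> 0 \<and>
      v1\<^sup>2 = kappa1 1 / of_real (rho_b 1) \<and> v2\<^sup>2 = kappa2 1 / of_real (rho_b 1) \<and> v\<^sup>2 = kappa 1 / rho 1"
    unfolding high_contrast_family_def by blast
  then show "v1 \<noteq> 0" "v2 \<noteq> 0" "v \<noteq> 0" by auto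
qed

text \<open>In the gaps rho_b / kappa = \<delta> rho / kappa = \<delta> / v^2. The same weights
  occur in the wave equation and, through the left modes, in the pairing.\<close>

lemma layer_weight_eq:
  assumes "high_contrast_family v1 v2 v rho rho_b kappa kappa1 kappa2" "\<delta> > 0" "k < 4"
  shows "layer_b (wave_weights v1 v2 v) \<delta> k =
    of_real (rho_b \<delta>) / ([kappa1 \<delta>, of_real (kappa \<delta>), kappa2 \<delta>, of_real (kappa \<delta>)] ! k)"
proof -
  from assms(1,2) have m: "rho \<delta> > 0" "rho_b \<delta> > 0" "kappa \<delta> > 0" "kappa1 \<delta> \<noteq> 0" "kappa2 \<delta> \<noteq> 0"
    "rho_b \<delta> / rho \<delta> = \<delta>" "v1\<^sup>2 = kappa1 \<delta> / of_real (rho_b \<delta>)" "v2\<^sup>2 = kappa2 \<delta> / of_real (rho_b \<delta>)"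
    "v\<^sup>2 = kappa \<delta> / rho \<delta>"
    unfolding high_contrast_family_def by blast+
  have r: "rho_b \<delta> = \<delta> * rho \<delta>" using m by (simp add: field_simps)
  have "1 / v\<^sup>2 * \<delta> = rho_b \<delta> / kappa \<delta>" unfolding m(9) r using m by (simp add: field_simps)
  then have g: "1 / complex_of_real (v\<^sup>2) * of_real \<delta> = of_real (rho_b \<delta>) / of_real (kappa \<delta>)"
    by (metis of_real_1 of_real_divide of_real_mult)
  from less_4_cases[OF assms(3)] show ?thesis
    using g by (elim disjE) (simp_all add: layer_b_def m(7,8))
qed

text \<open>Bloch waves are eigenvectors of the unimodular transfer matrix, which gives the
  dispersion relation. The first row of the eigenvector equation expresses the initial flux through
  \<open>u 0\<close> as soon as T12 is nonzero, so \<open>u 0\<close> factors out of the whole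
  wave.\<close>

lemma right_mode_normalised:
  fixes v1 v2 \<omega> :: complex and v \<delta> \<alpha> L :: real and xL xR :: "int \<Rightarrow> real"
  defines "M \<equiv> wave_weights v1 v2 v" and "c \<equiv> cell_break L xL xR"
    and "\<mu> \<equiv> \<omega>\<^sup>2 / of_real \<delta>" and "\<zeta> \<equiv> exp (\<i> * of_real (\<alpha> * L))"
  assumes geometry: "dimer_chain L xL xR"
    and material: "high_contrast_family v1 v2 v rho rho_b kappa kappa1 kappa2" and \<delta>: "\<delta> > 0"
    and mode: "right_mode L (interfaces xL xR) (density_at xL xR (rho_b \<delta>) (rho \<delta>))
      (bulk_at L xL xR (kappa1 \<delta>) (kappa2 \<delta>) (kappa \<delta>)) \<alpha> \<omega> u"
  shows "fst (medium_state M c \<delta> \<mu> (1, 0) 4) + snd (medium_state M c \<delta> \<mu> (0, 1) 4) = \<zeta> + 1 / \<zeta>"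
    and "fst (medium_state M c \<delta> \<mu> (0, 1) 4) \<noteq> 0 \<Longrightarrow> k < 4 \<Longrightarrow> x \<in> {c k..c (Suc k)} \<Longrightarrow>
      u x = u 0 * fst (medium_wave M c \<delta> \<mu>
        (1, (\<zeta> - fst (medium_state M c \<delta> \<mu> (1, 0) 4)) * inverse (fst (medium_state M c \<delta> \<mu> (0, 1) 4))) k x)"
proof -
  let ?T11 = "fst (medium_state M c \<delta> \<mu> (1, 0) 4)" and ?T12 = "fst (medium_state M c \<delta> \<mu> (0, 1) 4)"
    and ?T21 = "snd (medium_state M c \<delta> \<mu> (1, 0) 4)" and ?T22 = "snd (medium_state M c \<delta> \<mu> (0, 1) 4)"
  from material \<delta> have m: "rho \<delta> > 0" "rho_b \<delta> / rho \<delta> = \<delta>"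
    unfolding high_contrast_family_def by blast+
  then have r: "rho_b \<delta> = \<delta> * rho \<delta>" by (simp add: field_simps)
  have A: "layer_a \<delta> k = (if even k then of_real \<delta> else 1)" for k by (simp add: layer_a_def)
  have B: "layer_b M \<delta> k * \<mu> = of_real (rho \<delta>) * \<omega>\<^sup>2 / ([kappa1 \<delta>, of_real (kappa \<delta>), kappa2 \<delta>, of_real (kappa \<delta>)] ! k)"
    if "k < 4" for k
    unfolding M_def layer_weight_eq[OF material \<delta> that] \<mu>_def r using \<delta> by simp
  from right_mode_layers[OF geometry mode[unfolded r] m(1) \<delta> A B] obtain q where
    q: "(u 0, q) \<noteq> (0, 0)"
    "\<And>k x. k < 4 \<Longrightarrow> x \<in> {c k..c (Suc k)} \<Longrightarrow> u x = fst (medium_wave M c \<delta> \<mu> (u 0, q) k x)"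
    "medium_state M c \<delta> \<mu> (u 0, q) 4 = (\<zeta> * u 0, \<zeta> * q)"
    unfolding c_def \<zeta>_def by metis
  have eq: "?T11 * u 0 + ?T12 * q = \<zeta> * u 0" "?T21 * u 0 + ?T22 * q = \<zeta> * q"
    using q(3) layer_state_decompose[of "layer_a \<delta>" "\<lambda>k. layer_b M \<delta> k * \<mu>" c "u 0" q 4]
    by (simp_all add: mult.commute)
  have det: "?T11 * ?T22 - ?T12 * ?T21 = 1"
    using layer_state_wronskian[of "layer_a \<delta>" "\<lambda>k. layer_b M \<delta> k * \<mu>" c "(1, 0)" 4 "(0, 1)"] by simp
  show "?T11 + ?T22 = \<zeta> + 1 / \<zeta>"
    by (rule eigenvector_2x2[OF eq q(1) det]) (simp add: \<zeta>_def)
  assume T12: "?T12 \<noteq> 0" and kx: "k < 4" "x \<in> {c k..c (Suc k)}"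
  have "q = u 0 * ((\<zeta> - ?T11) * inverse ?T12)"
    using eq(1) T12 by (simp add: field_simps)
  then have "u x = fst (medium_wave M c \<delta> \<mu> (u 0 * 1, u 0 * ((\<zeta> - ?T11) * inverse ?T12)) k x)"
    using q(2)[OF kx] by simp
  then show "u x = u 0 * fst (medium_wave M c \<delta> \<mu> (1, (\<zeta> - ?T11) * inverse ?T12) k x)"
    unfolding layer_wave_scale by simp
qed

lemma left_mode_cnj:
  assumes "left_mode L I \<rho> \<kappa> \<alpha> \<omega> v"
  shows "right_mode L I \<rho> \<kappa> (- \<alpha>) \<omega> (\<lambda>x. \<kappa> x * cnj (v x))"
  using right_mode_cnj[OF assms[unfolded left_mode_def]] by simp

text \<open>The second row of the eigenvector equation determines the eigenvalue: the second
  coordinate is a nonzero multiple of \<gamma>, which can be cancelled.\<close>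

lemma labelled_band_limit:
  assumes "labelled_band L l s1 s2 v1 v2 sqf i \<omega>" and "gamma L s1 s2 t \<noteq> 0" "v2 \<noteq> 0" "l \<noteq> 0"
  shows "((\<lambda>\<delta>. (\<omega> \<delta> t)\<^sup>2 / complex_of_real \<delta>) \<longlongrightarrow> limit_eigenvalue L l s1 s2 v1 v2 sqf i t) (at_right 0)"
proof -
  from assms(1) obtain \<mu> where
    eig: "cap_matrix L l s1 s2 v1 v2 t *v cap_vector L s1 s2 v1 v2 sqf i t = \<mu> *s cap_vector L s1 s2 v1 v2 sqf i t"
    and lim: "((\<lambda>\<delta>. (\<omega> \<delta> t)\<^sup>2 / complex_of_real \<delta>) \<longlongrightarrow> \<mu>) (at_right 0)"
    unfolding labelled_band_def by blast
  let ?b = "cnj (cap_b L s1 s2 t)"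
  let ?x = "- cap_a s1 s2 * (v2\<^sup>2 - v1\<^sup>2) + (- 1) ^ i * sqf (gamma L s1 s2 t)"
  have b: "?b \<noteq> 0" unfolding cap_b_eq using assms(2) by simp
  have "(cap_matrix L l s1 s2 v1 v2 t *v cap_vector L s1 s2 v1 v2 sqf i t) $ 2 = (\<mu> *s cap_vector L s1 s2 v1 v2 sqf i t) $ 2"
    unfolding eig ..
  then have "1 / l * (v2\<^sup>2 * ?b) * ?x + 1 / l * (v2\<^sup>2 * cap_a s1 s2) * (2 * v2\<^sup>2 * ?b) = \<mu> * (2 * v2\<^sup>2 * ?b)"
    by (simp add: matrix_vector_mult_def sum_2 cap_matrix_def cap_vector_def)
  then have "(1 / l * ?x + 1 / l * cap_a s1 s2 * (2 * v2\<^sup>2)) * (v2\<^sup>2 * ?b) = (2 * \<mu>) * (v2\<^sup>2 * ?b)"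
    by (simp only: mult_ac distrib_right distrib_left)
  then have "1 / l * ?x + 1 / l * cap_a s1 s2 * (2 * v2\<^sup>2) = 2 * \<mu>"
    using b assms(3) by (simp only: mult_cancel_right) auto
  then have "\<mu> = limit_eigenvalue L l s1 s2 v1 v2 sqf i t"
    using assms(4) by (simp add: limit_eigenvalue_def field_simps)
  with lim show ?thesis by simp
qed

lemma C1_family_exp_phase:
  "C1_family of_real T X (\<lambda>t x. exp (k * of_real (L * t))) (\<lambda>t x. k * L * exp (k * of_real (L * t)))"
  unfolding C1_family_def
proof (intro conjI ballI)
  fix t :: real and x
  show "((\<lambda>s. exp (k * of_real (L * s))) has_derivative (\<lambda>h. of_real h * (k * L * exp (k * of_real (L * t))))) (at t)"
    using exp_phase_has_vector_derivative[of k L t]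
    by (simp add: has_vector_derivative_def scaleR_conv_of_real)
qed (auto simp: case_prod_unfold intro!: continuous_intros)

lemma C1_close_medium_trace:
  "C1_close (\<lambda>z. z) (cball 0 R) {0::real}
     (\<lambda>\<delta> z x. fst (medium_state M c \<delta> z (1, 0) 4) + snd (medium_state M c \<delta> z (0, 1) 4))"
proof -
  have "C1_family (\<lambda>z. z) (cball 0 R) {0::real} (\<lambda>t x. t) (\<lambda>t x. 1 :: complex)"
    unfolding C1_family_def by (auto simp: case_prod_unfold intro!: continuous_intros)
  then have "C1_close (\<lambda>z. z) (cball 0 R) {0::real} (\<lambda>\<delta> t x. t)"
    by (intro C1_close_fixed) auto
  then show ?thesis
    by (intro C1_close_add C1_close_medium_state[where u = "\<lambda>\<delta> t. 1" and q = "\<lambda>\<delta> t. 0"]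
        C1_close_medium_state[where u = "\<lambda>\<delta> t. 0" and q = "\<lambda>\<delta> t. 1"] C1_close_const)
qed

text \<open>At zero contrast the gap weights vanish, and the products on the resonators are
  constant.\<close>

lemma limit_layer_pairing:
  assumes c: "c 1 - c 0 = l" "c 3 - c 2 = l" "l \<ge> 0"
    and p: "\<And>x. x \<in> {c 0..c 1} \<Longrightarrow> F 0 x * G 0 x = p" and q: "\<And>x. x \<in> {c 2..c 3} \<Longrightarrow> F 2 x * G 2 x = q"
  shows "layer_pairing 4 c (layer_b M 0) F G = of_real l * (M 0 * p + M 2 * q)"
proof -
  have 4: "{..<4} = {0, 1, 2, 3 :: nat}" by auto
  have "integral {c 0..c 1} (\<lambda>x. F 0 x * G 0 x) = integral {c 0..c 1} (\<lambda>x. p)"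
    by (rule Henstock_Kurzweil_Integration.integral_cong) (rule p)
  also have "\<dots> = of_real l * p" using c by (simp add: scaleR_conv_of_real)
  finally have i: "integral {c 0..c (Suc 0)} (\<lambda>x. F 0 x * G 0 x) = of_real l * p" by simp
  have "integral {c 2..c 3} (\<lambda>x. F 2 x * G 2 x) = integral {c 2..c 3} (\<lambda>x. q)"
    by (rule Henstock_Kurzweil_Integration.integral_cong) (rule q)
  also have "\<dots> = of_real l * q" using c by (simp add: scaleR_conv_of_real)
  finally have k: "integral {c 2..c 3} (\<lambda>x. F 2 x * G 2 x) = of_real l * q" .
  show ?thesis
    unfolding layer_pairing_def 4 using i k
    by (simp add: layer_b_def algebra_simps)
qed

theorem theorem6p4:
  fixes L v :: real and xL xR :: "int \<Rightarrow> real"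
    and v1 v2 :: complex
    and rho rho_b kappa :: "real \<Rightarrow> real" and kappa1 kappa2 :: "real \<Rightarrow> complex"
    and sqf :: "complex \<Rightarrow> complex"
    and \<omega> :: "nat \<Rightarrow> real \<Rightarrow> real \<Rightarrow> complex"
    and u w :: "nat \<Rightarrow> real \<Rightarrow> real \<Rightarrow> real \<Rightarrow> complex"
    and j :: nat
  defines "s1 \<equiv> spacing xL xR 1" and "s2 \<equiv> spacing xL xR 2"
    and "l1 \<equiv> res_length xL xR 1" and "l2 \<equiv> res_length xL xR 2"
    and "\<rho> \<equiv> \<lambda>\<delta>. density_at xL xR (rho_b \<delta>) (rho \<delta>)"
    and "\<kappa> \<equiv> \<lambda>\<delta>. bulk_at L xL xR (kappa1 \<delta>) (kappa2 \<delta>) (kappa \<delta>)"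
    and "I \<equiv> interfaces xL xR"
  assumes geometry: "dimer_chain L xL xR" and "l1 = l2"
    and material: "high_contrast_family v1 v2 v rho rho_b kappa kappa1 kappa2"
    and integrand_defined: "0 \<notin> path_image (gamma_path L s1 s2)"
    and branch: "sqrt_branch L s1 s2 v1 v2 sqf"
    and bands: "\<And>i. i \<in> {1, 2} \<Longrightarrow> subwavelength_band L I \<rho> \<kappa> (\<omega> i)"
    and labels: "\<And>i. i \<in> {1, 2} \<Longrightarrow> labelled_band L l1 s1 s2 v1 v2 sqf i (\<omega> i)"
    and nondegenerate: "nondegenerate_bands \<omega>"
    and modes: "\<forall>\<^sub>F \<delta> in at_right 0.
      biorthogonal_modes L I (\<rho> \<delta>) (\<kappa> \<delta>) (\<lambda>i. \<omega> i \<delta>) (\<lambda>i. u i \<delta>) (\<lambda>i. w i \<delta>)"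
    and "j \<in> {1, 2}"
  shows "\<exists>m :: real \<Rightarrow> int.
    (\<lambda>\<delta>. zak_phase L (u j \<delta>) (w j \<delta>)
        - complex_of_real
            ((- 1) ^ (j + 1) * ((s1 + s2) / (2 * s1 * s2))
               * Im ((v2\<^sup>2 - v1\<^sup>2) * contour_integral (gamma_path L s1 s2) (\<lambda>z. 1 / (z * sqf z)))
             + pi * (if s2 < s1 then 1 else 0)
             + 2 * pi * of_int (m \<delta>)))
      \<in> O[at_right 0](\<lambda>\<delta>. complex_of_real \<delta>)"
proof -
  define c where "c = cell_break L xL xR"
  define M where "M = wave_weights v1 v2 v"
  define T where "T = {- (2 * pi / L)..2 * pi / L}"
  note order = chain_order[OF geometry]
  \<comment> \<open>The second gap ends at the first resonator of the next cell.\<close>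
  have xL3: "xL 3 = L" using geometry order(1) chain_shift(1)[OF geometry, of 1 1] by simp
  have gaps: "c 1 - c 0 = l1" "c 2 - c 1 = s1" "c 3 - c 2 = l1" "c 4 - c 3 = s2"
    using \<open>l1 = l2\<close> order(1) xL3
    by (simp_all add: c_def l1_def l2_def s1_def s2_def spacing_def res_length_def)
  have pos: "L > 0" "l1 > 0" "s1 > 0" "s2 > 0"
    using order xL3 by (simp_all add: l1_def s1_def s2_def spacing_def res_length_def)
  have v: "v1 \<noteq> 0" "v2 \<noteq> 0" using high_contrast_nonzero[OF material] by auto
  have gz: "gamma L s1 s2 t \<noteq> 0" for t
    using integrand_defined gamma_in_path_image[OF pos(1), of s1 s2 t] by auto
  define ev where "ev = limit_eigenvalue L l1 s1 s2 v1 v2 sqf"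
  have ev_lim: "((\<lambda>\<delta>. (\<omega> i \<delta> t)\<^sup>2 / complex_of_real \<delta>) \<longlongrightarrow> ev i t) (at_right 0)" if "i \<in> {1, 2}" for i t
    unfolding ev_def by (rule labelled_band_limit[OF labels[OF that] gz]) (use v pos in auto)
  \<comment> \<open>A zero of the root would make the two limiting eigenvalues coincide, against the
    requirement that the bands do not merge in the limit.\<close>
  have sqn: "sqf (gamma L s1 s2 t) \<noteq> 0" for t
  proof
    assume "sqf (gamma L s1 s2 t) = 0"
    then have "ev 1 t - ev 2 t = 0" by (simp add: ev_def limit_eigenvalue_def)
    moreover have "((\<lambda>\<delta>. (\<omega> 1 \<delta> t)\<^sup>2 / complex_of_real \<delta> - (\<omega> 2 \<delta> t)\<^sup>2 / complex_of_real \<delta>) \<longlongrightarrow> ev 1 t - ev 2 t) (at_right 0)"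
      by (intro tendsto_diff ev_lim) auto
    ultimately have "((\<lambda>\<delta>. ((\<omega> 1 \<delta> t)\<^sup>2 - (\<omega> 2 \<delta> t)\<^sup>2) / complex_of_real \<delta>) \<longlongrightarrow> 0) (at_right 0)"
      by (simp add: diff_divide_distrib)
    then show False using nondegenerate unfolding nondegenerate_bands_def by blast
  qed
  note ctx = pos v integrand_defined branch sqn
  obtain j' :: nat where jj: "(j, j') = (1, 2) \<or> (j, j') = (2, 1)" using \<open>j \<in> {1, 2}\<close> by auto
  \<comment> \<open>The value at \<delta> = 0 is set to the limit, since closeness is measured
    against the member at 0; the plain quotient would be 0 there.\<close>
  define m where "m = (\<lambda>\<delta> t. if \<delta> = 0 then ev j t else (\<omega> j \<delta> t)\<^sup>2 / complex_of_real \<delta>)"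
  have m0: "m 0 t = ev j t" for t by (simp add: m_def)
  define e where "e = (\<lambda>k t. exp (k * complex_of_real (L * t)))"
  define \<tau> where "\<tau> = (\<lambda>\<delta> z. fst (medium_state M c \<delta> z (1, 0) 4) + snd (medium_state M c \<delta> z (0, 1) 4))"
  have rho_kappa: "\<rho> \<delta> = density_at xL xR (rho_b \<delta>) (rho \<delta>)"
    "\<kappa> \<delta> = bulk_at L xL xR (kappa1 \<delta>) (kappa2 \<delta>) (kappa \<delta>)" for \<delta>
    by (simp_all add: \<rho>_def \<kappa>_def)
  note normalised = right_mode_normalised[OF geometry material, folded rho_kappa I_def c_def M_def]
  \<comment> \<open>\<open>ev j\<close> and \<open>ev j'\<close> are the two roots of the limiting
    dispersion relation; convergence at t = 0 decides which of them the band follows on all of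
    T.\<close>
  have mT: "C1_close of_real T X (\<lambda>\<delta> t x. m \<delta> t)" for X :: "real set"
    unfolding T_def
  proof (rule C1_close_simple_root[where \<tau> = \<tau> and \<kappa> = "\<lambda>t. e \<i> t + e (- \<i>) t" and ?t0.0 = 0
        and C = "complex_of_real (s1 * s2 * l1\<^sup>2) / (v1\<^sup>2 * v2\<^sup>2)" and ?m2.0 = "ev j'"
        and \<kappa>' = "\<lambda>t. \<i> * L * e \<i> t + (- \<i>) * L * e (- \<i>) t"])
    show "0 \<in> {- (2 * pi / L)..2 * pi / L}" using pos by simp
    show "C1_close (\<lambda>z. z) (cball 0 R) {0::real} (\<lambda>\<delta> z x. \<tau> \<delta> z)" for R
      unfolding \<tau>_def by (rule C1_close_medium_trace)
    show "\<tau> 0 z - (e \<i> t + e (- \<i>) t) = complex_of_real (s1 * s2 * l1\<^sup>2) / (v1\<^sup>2 * v2\<^sup>2) * (z - m 0 t) * (z - ev j' t)" for t z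
      using limit_trace_factor[OF ctx jj, of z t]
      by (simp add: \<tau>_def limit_trace[OF gaps] M_def e_def m0 ev_def)
    show "complex_of_real (s1 * s2 * l1\<^sup>2) / (v1\<^sup>2 * v2\<^sup>2) \<noteq> 0" using pos v by simp
    show "continuous_on UNIV (m 0)" "continuous_on UNIV (ev j')"
      unfolding m0[abs_def] ev_def using limit_eigenvalue_continuous[OF ctx jj] by blast+
    show "m 0 t \<noteq> ev j' t" for t
      unfolding m0 ev_def by (rule limit_eigenvalues_distinct[OF ctx jj])
    show "((\<lambda>\<delta>. m \<delta> 0) \<longlongrightarrow> m 0 0) (at_right 0)"
    proof -
      have "\<forall>\<^sub>F \<delta> in at_right 0. (\<omega> j \<delta> 0)\<^sup>2 / complex_of_real \<delta> = m \<delta> 0"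
        using eventually_at_right_less[of 0] by eventually_elim (simp add: m_def)
      from tendsto_cong[OF this] show ?thesis using ev_lim[OF \<open>j \<in> {1, 2}\<close>, of 0] by (simp add: m0)
    qed
    show "\<forall>\<^sub>F \<delta> in at_right 0. continuous_on UNIV (m \<delta>) \<and> (\<forall>t. \<tau> \<delta> (m \<delta> t) = e \<i> t + e (- \<i>) t)"
    proof -
      have "\<forall>\<^sub>F \<delta> in at_right 0. continuous_on UNIV (\<omega> j \<delta>) \<and>
          (\<forall>\<alpha>. \<omega> j \<delta> (\<alpha> + 2 * pi / L) = \<omega> j \<delta> \<alpha> \<and> resonance L I (\<rho> \<delta>) (\<kappa> \<delta>) \<alpha> (\<omega> j \<delta> \<alpha>))"
        using bands[OF \<open>j \<in> {1, 2}\<close>] unfolding subwavelength_band_def by blast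
      then show ?thesis using eventually_at_right_less[of 0]
      proof eventually_elim
        case (elim \<delta>)
        have "m \<delta> = (\<lambda>t. (\<omega> j \<delta> t)\<^sup>2 / complex_of_real \<delta>)" using elim by (auto simp: m_def)
        moreover have "\<tau> \<delta> ((\<omega> j \<delta> t)\<^sup>2 / complex_of_real \<delta>) = e \<i> t + e (- \<i>) t" for t
        proof -
          from elim obtain y where "right_mode L I (\<rho> \<delta>) (\<kappa> \<delta>) t (\<omega> j \<delta> t) y"
            unfolding resonance_def by blast
          from normalised(1)[OF elim(2) this] show ?thesis
            by (simp add: \<tau>_def e_def exp_minus divide_inverse mult.commute[of L])
        qed
        ultimately show ?case using elim by (auto intro!: continuous_intros)
      qed
    qed
    show "((\<lambda>t. e \<i> t + e (- \<i>) t) has_vector_derivative \<i> * L * e \<i> t + (- \<i>) * L * e (- \<i>) t) (at t)" for t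
      unfolding e_def by (intro has_vector_derivative_add exp_phase_has_vector_derivative)
    show "continuous_on UNIV (\<lambda>t. \<i> * complex_of_real L * e \<i> t + - \<i> * complex_of_real L * e (- \<i>) t)"
      unfolding e_def by (intro continuous_intros)
  qed
  define T11 where "T11 = (\<lambda>\<delta> t. fst (medium_state M c \<delta> (m \<delta> t) (1, 0) 4))"
  define T12 where "T12 = (\<lambda>\<delta> t. fst (medium_state M c \<delta> (m \<delta> t) (0, 1) 4))"
  have cT11: "C1_close of_real T X (\<lambda>\<delta> t x. T11 \<delta> t)" and cT12: "C1_close of_real T X (\<lambda>\<delta> t x. T12 \<delta> t)"
    for X :: "real set"
    unfolding T11_def T12_def
    by (rule C1_close_medium_state(1)[where u = "\<lambda>\<delta> t. 1" and q = "\<lambda>\<delta> t. 0"] 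
          C1_close_medium_state(1)[where u = "\<lambda>\<delta> t. 0" and q = "\<lambda>\<delta> t. 1"], rule mT, (rule C1_close_const)+)+
  define \<beta> where "\<beta> = limit_ratio L l1 s1 s2 v1 v2 sqf j"
  have \<beta>nz: "\<beta> t \<noteq> 0" and T12_0: "T12 0 t = s1 * s2 / \<beta> t" for t
  proof -
    have nz: "cap_a s1 s2 - ev j t * of_real l1 / v2\<^sup>2 \<noteq> 0"
      unfolding ev_def by (rule limit_ratio_denominator_nonzero[OF ctx jj])
    then show "\<beta> t \<noteq> 0" by (simp add: \<beta>_def limit_ratio_def ev_def)
    have "s1 * s2 / \<beta> t = s1 * s2 * (cap_a s1 s2 - ev j t * of_real l1 / v2\<^sup>2)"
      by (simp add: \<beta>_def limit_ratio_def ev_def)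
    also have "\<dots> = s1 + s2 - 1 / v2\<^sup>2 * ev j t * l1 * s1 * s2"
      using pos by (simp add: cap_a_def algebra_simps)
    finally show "T12 0 t = s1 * s2 / \<beta> t"
      unfolding T12_def limit_transmission[OF gaps] m0 by (simp add: M_def)
  qed
  obtain \<beta>' where \<beta>': "\<And>t. (\<beta> has_vector_derivative \<beta>' t) (at t)" "continuous_on UNIV \<beta>'"
    unfolding \<beta>_def using limit_ratio_differentiable[OF ctx jj] by blast
  have c\<beta>: "continuous_on S \<beta>" for S by (rule has_vector_derivative_imp_continuous_on[OF \<beta>'(1)])
  \<comment> \<open>The limit of T12 is s1 s2 / \<beta>, continuous and without zeros, so
    compactness of T bounds it away from 0.\<close>
  obtain d where d: "d > 0" "\<forall>t\<in>T. d \<le> norm (T12 0 t)"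
  proof (rule compact_bounded_below[of T "T12 0"])
    show "continuous_on T (T12 0)"
      unfolding T12_0[abs_def] by (intro continuous_intros c\<beta>) (use \<beta>nz in auto)
  qed (use T12_0 \<beta>nz pos in \<open>auto simp: T_def\<close>)
  have T12nz: "\<forall>\<^sub>F \<delta> in at_right 0. \<forall>t\<in>T. T12 \<delta> t \<noteq> 0"
  proof -
    have "O_close T {0::real} (\<lambda>\<delta> t x. T12 \<delta> t)" using cT12[of "{0}"] unfolding C1_close_def by blast
    from O_close_inverse_bounds[OF this d(1)] d(2)
    have "\<forall>\<^sub>F \<delta> in near0. \<forall>t\<in>T. d / 2 \<le> norm (T12 \<delta> t)" by simp
    then have "\<forall>\<^sub>F \<delta> in at_right 0. \<forall>t\<in>T. d / 2 \<le> norm (T12 \<delta> t)" by (simp add: eventually_near0)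
    then show ?thesis by eventually_elim (use d(1) in fastforce)
  qed
  \<comment> \<open>The initial flux of the wave with value 1 at the origin. The choice k = i gives
    the right modes, k = -i the conjugated left modes, whose Bloch factor is inverted.\<close>
  define Q where "Q = (\<lambda>k \<delta> t. (e k t - T11 \<delta> t) * inverse (T12 \<delta> t))"
  define W where "W = (\<lambda>k n \<delta> t x. fst (medium_wave M c \<delta> (m \<delta> t) (1, Q k \<delta> t) n x))"
  have cW: "C1_close of_real T {c n..c (Suc n)} (W k n)" for k n
  proof -
    have "C1_close of_real T X (\<lambda>\<delta> t x. e k t)" if "compact X" for X :: "real set"
      unfolding e_def by (rule C1_close_fixed[OF _ that C1_family_exp_phase]) (simp add: T_def)
    then have "C1_close of_real T {c n..c (Suc n)} (\<lambda>\<delta> t x. Q k \<delta> t)"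
      unfolding Q_def
      by (intro C1_close_mult C1_close_diff C1_close_inverse[OF _ d(1)] cT11 cT12) (use d(2) in auto)
    then show ?thesis
      unfolding W_def by (intro C1_close_medium_wave[where u = "\<lambda>\<delta> t. 1"] mT C1_close_const) (auto simp: T_def)
  qed
  have W0: "W k 0 0 t x = 1" for k t x
    unfolding W_def by (rule limit_wave_0[OF gaps])
  have W2: "W k 2 0 t x = \<beta> t * (1 / of_real s1 + e k t / of_real s2)" for k t x
  proof -
    have T: "T12 0 t \<noteq> 0" unfolding T12_0 using \<beta>nz pos by simp
    have "W k 2 0 t x * T12 0 t = s2 + e k t * s1"
      unfolding W_def T12_def
      by (rule limit_wave_2[OF gaps]) (use T in \<open>simp add: Q_def T11_def T12_def\<close>)
    then have "W k 2 0 t x * (s1 * s2) = (s2 + e k t * s1) * \<beta> t"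
      unfolding T12_0 using \<beta>nz[of t] by (simp add: field_simps)
    then show ?thesis using pos by (simp add: field_simps)
  qed
  define z where "z = gamma L s1 s2"
  define z' where "z' = (\<lambda>t. \<i> * complex_of_real L / complex_of_real s2 * exp (\<i> * complex_of_real (L * t)))"
  have z': "(z has_vector_derivative z' t) (at t)" for t
    unfolding z_def z'_def by (rule gamma_has_vector_derivative)
  have W2i: "W \<i> 2 0 t x = \<beta> t * z t" "W (- \<i>) 2 0 t x = \<beta> t * cnj (z t)" for t x
    unfolding W2 z_def gamma_def e_def by (simp_all add: exp_cnj)
  \<comment> \<open>An abstract derivative treats all layers alike; explicit values follow on the
    resonators, the layers that the limiting pairing sees.\<close>
  define dW where "dW = (\<lambda>k n t x. vector_derivative (\<lambda>s. W k n 0 s x) (at t))"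
  have dW: "((\<lambda>s. W k n 0 s x) has_vector_derivative dW k n t x) (at t)"
    if "t \<in> T" "x \<in> {c n..c (Suc n)}" for k n t x
  proof -
    from C1_closeE[OF cW[of n k]] obtain F' where "\<forall>\<^sub>F \<delta> in near0. C1_family of_real T {c n..c (Suc n)} (W k n \<delta>) (F' \<delta>)" by metis
    then have "C1_family of_real T {c n..c (Suc n)} (W k n 0) (F' 0)" by (simp add: eventually_near0)
    from C1_family_vector_derivative[OF this that]
    show ?thesis unfolding dW_def by (simp add: vector_derivative_at)
  qed
  have dW0: "dW k 0 t x = 0" for k t x
    unfolding dW_def W0 by simp
  have dW2: "dW \<i> 2 t x = \<beta> t * z' t + \<beta>' t * z t" "dW (- \<i>) 2 t x = \<beta> t * cnj (z' t) + \<beta>' t * cnj (z t)" for t x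
    unfolding dW_def W2i
    by (intro vector_derivative_at has_vector_derivative_mult \<beta>' z' has_vector_derivative_cnj)+
  define P0 where "P0 = (\<lambda>t. complex_of_real l1 * (1 / v1\<^sup>2 + 1 / v2\<^sup>2 * ((\<beta> t * cnj (z t)) * (\<beta> t * z t))))"
  define N0 where "N0 = (\<lambda>t. complex_of_real l1 * (1 / v2\<^sup>2) * ((\<beta> t * cnj (z t)) * (\<beta> t * z' t + \<beta>' t * z t)))"
  define M0 where "M0 = (\<lambda>t. complex_of_real l1 * (1 / v2\<^sup>2) * ((\<beta> t * cnj (z' t) + \<beta>' t * cnj (z t)) * (\<beta> t * z t)))"
  have lz: "(P0 has_vector_derivative N0 t + M0 t) (at t)" "continuous_on S (\<lambda>t. N0 t + M0 t)"
    "integral {- (pi / L)..pi / L} (\<lambda>t. (N0 t + M0 t) / P0 t) = 0"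
    "\<i> / 2 * integral {- (pi / L)..pi / L} (\<lambda>t. N0 t / P0 t + cnj (M0 t / P0 t)) =
      of_real ((- 1) ^ (j + 1) * ((s1 + s2) / (2 * s1 * s2))
         * Im ((v2\<^sup>2 - v1\<^sup>2) * contour_integral (gamma_path L s1 s2) (\<lambda>z. 1 / (z * sqf z)))
       - pi * (if s2 < s1 then 1 else 0))" for t S
    unfolding P0_def N0_def M0_def z'_def z_def \<beta>_def
    by (rule limit_zak_integral[OF ctx jj \<beta>'[unfolded \<beta>_def]])+
  have pairing: "layer_pairing 4 c (layer_b M 0) (\<lambda>n. W (- \<i>) n 0 t) (\<lambda>n. W \<i> n 0 t) = P0 t"
    "layer_pairing 4 c (layer_b M 0) (\<lambda>n. W (- \<i>) n 0 t) (\<lambda>n. dW \<i> n t) = N0 t"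
    "layer_pairing 4 c (layer_b M 0) (\<lambda>n. dW (- \<i>) n t) (\<lambda>n. W \<i> n 0 t) = M0 t" for t
  proof -
    note lp = limit_layer_pairing[OF gaps(1,3) less_imp_le[OF pos(2)], where M = M]
    show "layer_pairing 4 c (layer_b M 0) (\<lambda>n. W (- \<i>) n 0 t) (\<lambda>n. W \<i> n 0 t) = P0 t"
      by (subst lp[where p = 1 and q = "(\<beta> t * cnj (z t)) * (\<beta> t * z t)"])
         (simp_all add: W0 W2i P0_def M_def)
    show "layer_pairing 4 c (layer_b M 0) (\<lambda>n. W (- \<i>) n 0 t) (\<lambda>n. dW \<i> n t) = N0 t"
      by (subst lp[where p = 0 and q = "(\<beta> t * cnj (z t)) * (\<beta> t * z' t + \<beta>' t * z t)"])
         (simp_all add: W0 dW0 W2i dW2 N0_def M_def)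
    show "layer_pairing 4 c (layer_b M 0) (\<lambda>n. dW (- \<i>) n t) (\<lambda>n. W \<i> n 0 t) = M0 t"
      by (subst lp[where p = 0 and q = "(\<beta> t * cnj (z' t) + \<beta>' t * cnj (z t)) * (\<beta> t * z t)"])
         (simp_all add: W0 dW0 W2i dW2 M0_def M_def)
  qed
  have "\<exists>k :: real \<Rightarrow> int. (\<lambda>\<delta>. zak_phase L (u j \<delta>) (w j \<delta>)
     - ((\<i> / 2) * integral {- (pi / L)..pi / L} (\<lambda>t. N0 t / P0 t + cnj (M0 t / P0 t)) + of_real (2 * pi * of_int (k \<delta>))))
     \<in> O[at_right 0](\<lambda>\<delta>. complex_of_real \<delta>)"
  proof (rule zak_phase_expansion[where L = L and c = c and n = 4 and V = "W (- \<i>)" and U = "W \<i>" and b = "layer_b M" and P0' = "\<lambda>t. N0 t + M0 t"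
        and U0' = "dW \<i>" and V0' = "dW (- \<i>)", folded T_def, unfolded pairing])
    show "L > 0" by (rule pos)
    show "c 0 = 0" "c 4 = L" by (simp_all add: c_def)
    show "c k < c (Suc k)" if "k < 4" for k using cell_break_less[OF geometry that] by (simp add: c_def)
    show "C1_close of_real T {c k..c (Suc k)} (W \<i> k)" "C1_close of_real T {c k..c (Suc k)} (W (- \<i>) k)" for k
      by (rule cW)+
    show "O_close T {0::real} (\<lambda>\<delta> t x. layer_b M \<delta> k)" for k
      using C1_close_layer_b[of of_real T "{0}" M k] unfolding C1_close_def by blast
    show "((\<lambda>s. W \<i> k 0 s x) has_vector_derivative dW \<i> k t x) (at t)"
      "((\<lambda>s. W (- \<i>) k 0 s x) has_vector_derivative dW (- \<i>) k t x) (at t)"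
      if "t \<in> T" "x \<in> {c k..c (Suc k)}" for k t x
      using dW[OF that] by blast+
    show "P0 t \<noteq> 0" for t
      unfolding P0_def \<beta>_def z_def by (rule limit_pairing_nonzero[OF ctx jj])
    show "P0 (- (pi / L)) = P0 (pi / L)"
      unfolding P0_def \<beta>_def z_def by (rule limit_pairing_even[OF ctx jj])
    show "(P0 has_vector_derivative N0 t + M0 t) (at t)" for t by (rule lz(1))
    show "continuous_on {- (pi / L)..pi / L} (\<lambda>t. N0 t + M0 t)" by (rule lz(2))
    show "integral {- (pi / L)..pi / L} (\<lambda>t. (N0 t + M0 t) / P0 t) = 0" by (rule lz(3))
    show "\<forall>\<^sub>F \<delta> in at_right 0. \<exists>g g' h h'.
      (\<forall>t. (g has_vector_derivative g' t) (at t)) \<and> continuous_on UNIV g' \<and> g (- (pi / L)) = g (pi / L) \<and>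
      (\<forall>t. (h has_vector_derivative h' t) (at t)) \<and> continuous_on UNIV h' \<and> h (- (pi / L)) = h (pi / L) \<and>
      (\<forall>k<4. \<forall>t\<in>T. \<forall>x\<in>{c k..c (Suc k)}. u j \<delta> t x = g t * W \<i> k \<delta> t x) \<and>
      (\<forall>k<4. \<forall>t\<in>T. \<forall>x\<in>{c k<..<c (Suc k)}. cnj (w j \<delta> t x) = h t * layer_b M \<delta> k * W (- \<i>) k \<delta> t x) \<and>
      (\<forall>t. cell_inner L (w j \<delta> t) (u j \<delta> t) = 1)"
      using modes T12nz eventually_at_right_less[of 0]
    proof eventually_elim
      case (elim \<delta>)
      have \<delta>: "\<delta> > 0" by (rule elim)
      have right: "right_mode L I (\<rho> \<delta>) (\<kappa> \<delta>) t (\<omega> j \<delta> t) (u j \<delta> t)"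
        and left: "left_mode L I (\<rho> \<delta>) (\<kappa> \<delta>) t (\<omega> j \<delta> t) (w j \<delta> t)"
        and period: "u j \<delta> (t + 2 * pi / L) = u j \<delta> t" "w j \<delta> (t + 2 * pi / L) = w j \<delta> t"
        and C1: "(\<lambda>t. u j \<delta> t x) C1_differentiable_on UNIV" "(\<lambda>t. w j \<delta> t x) C1_differentiable_on UNIV"
        and ortho: "cell_inner L (w j \<delta> t) (u j \<delta> t) = 1" for t x
        using elim(1) \<open>j \<in> {1, 2}\<close> unfolding biorthogonal_modes_def by auto
      obtain g' where g': "\<And>t. ((\<lambda>t. u j \<delta> t 0) has_vector_derivative g' t) (at t)" "continuous_on UNIV g'"
        using C1(1)[of 0] unfolding C1_differentiable_on_def by auto
      obtain w' where w': "\<And>t. ((\<lambda>t. w j \<delta> t 0) has_vector_derivative w' t) (at t)" "continuous_on UNIV w'"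
        using C1(2)[of 0] unfolding C1_differentiable_on_def by auto
      \<comment> \<open>The continuous function \<kappa> cnj w is the one that solves the wave
        equation, so its value at the interface 0 is the amplitude to factor out; dividing by rho_b
        leaves the weight rho_b / \<kappa> in each layer.\<close>
      define h where "h = (\<lambda>t. \<kappa> \<delta> 0 / of_real (rho_b \<delta>) * cnj (w j \<delta> t 0))"
      have md: "m \<delta> t = (\<omega> j \<delta> t)\<^sup>2 / of_real \<delta>" for t using \<delta> by (simp add: m_def)
      have per: "- (pi / L) + 2 * pi / L = pi / L" by (simp add: field_simps)
      show ?case
      proof (intro exI conjI allI impI ballI)
        show "((\<lambda>t. u j \<delta> t 0) has_vector_derivative g' t) (at t)" for t by (rule g')
        show "continuous_on UNIV g'" by (rule g')
        show "u j \<delta> (- (pi / L)) 0 = u j \<delta> (pi / L) 0" using period(1)[of "- (pi / L)"] per by simp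
        show "(h has_vector_derivative \<kappa> \<delta> 0 / of_real (rho_b \<delta>) * cnj (w' t)) (at t)" for t
          unfolding h_def by (intro has_vector_derivative_mult_right has_vector_derivative_cnj w')
        show "continuous_on UNIV (\<lambda>t. \<kappa> \<delta> 0 / of_real (rho_b \<delta>) * cnj (w' t))"
          by (intro continuous_intros w')
        show "h (- (pi / L)) = h (pi / L)" using period(2)[of "- (pi / L)"] per by (simp add: h_def)
        show "cell_inner L (w j \<delta> t) (u j \<delta> t) = 1" for t by (rule ortho)
      next
        fix k t x assume k: "k < 4" and t: "t \<in> T" and x: "x \<in> {c k..c (Suc k)}"
        have "T12 \<delta> t \<noteq> 0" using elim(2) t by blast
        from normalised(2)[OF \<delta> right[of t] this[unfolded T12_def md] k x]
        show "u j \<delta> t x = u j \<delta> t 0 * W \<i> k \<delta> t x"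
          by (simp add: W_def Q_def T11_def T12_def md e_def mult.commute[of L])
      next
        fix k t x assume k: "k < 4" and t: "t \<in> T" and x: "x \<in> {c k<..<c (Suc k)}"
        have "T12 \<delta> t \<noteq> 0" using elim(2) t by blast
        moreover have "x \<in> {c k..c (Suc k)}" using x by simp
        ultimately have eq: "\<kappa> \<delta> x * cnj (w j \<delta> t x) = \<kappa> \<delta> 0 * cnj (w j \<delta> t 0) * W (- \<i>) k \<delta> t x"
          using normalised(2)[OF \<delta> left_mode_cnj[OF left[of t]], of k x] k
          by (simp add: W_def Q_def T11_def T12_def md e_def mult.commute[of L])
        have \<kappa>x: "\<kappa> \<delta> x = [kappa1 \<delta>, of_real (kappa \<delta>), kappa2 \<delta>, of_real (kappa \<delta>)] ! k"
          unfolding rho_kappa using layer_bulk[OF geometry k] x by (simp add: c_def)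
        have nz: "kappa1 \<delta> \<noteq> 0" "kappa2 \<delta> \<noteq> 0" "kappa \<delta> > 0" "rho_b \<delta> > 0"
          using material \<delta> unfolding high_contrast_family_def by blast+
        have "\<kappa> \<delta> x \<noteq> 0" unfolding \<kappa>x using nz less_4_cases[OF k] by (elim disjE) simp_all
        then have "cnj (w j \<delta> t x) = \<kappa> \<delta> 0 * cnj (w j \<delta> t 0) * W (- \<i>) k \<delta> t x / \<kappa> \<delta> x"
          using eq by (simp add: field_simps)
        also have "\<dots> = h t * (of_real (rho_b \<delta>) / \<kappa> \<delta> x) * W (- \<i>) k \<delta> t x"
          using nz by (simp add: h_def)
        also have "of_real (rho_b \<delta>) / \<kappa> \<delta> x = layer_b M \<delta> k"
          unfolding \<kappa>x M_def by (rule layer_weight_eq[OF material \<delta> k, symmetric])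
        finally show "cnj (w j \<delta> t x) = h t * layer_b M \<delta> k * W (- \<i>) k \<delta> t x" .
      qed
    qed
  qed
  then obtain k :: "real \<Rightarrow> int" where k: "(\<lambda>\<delta>. zak_phase L (u j \<delta>) (w j \<delta>)
     - ((\<i> / 2) * integral {- (pi / L)..pi / L} (\<lambda>t. N0 t / P0 t + cnj (M0 t / P0 t)) + of_real (2 * pi * of_int (k \<delta>))))
     \<in> O[at_right 0](\<lambda>\<delta>. complex_of_real \<delta>)" by blast
  show ?thesis
  \<comment> \<open>The limiting integral contributes -\<pi> where +\<pi> is claimed; the difference
    2 \<pi> goes into the integer.\<close>
  proof (rule exI[of _ "\<lambda>\<delta>. k \<delta> - (if s2 < s1 then 1 else 0)"])
    show "(\<lambda>\<delta>. zak_phase L (u j \<delta>) (w j \<delta>)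
        - complex_of_real
            ((- 1) ^ (j + 1) * ((s1 + s2) / (2 * s1 * s2))
               * Im ((v2\<^sup>2 - v1\<^sup>2) * contour_integral (gamma_path L s1 s2) (\<lambda>z. 1 / (z * sqf z)))
             + pi * (if s2 < s1 then 1 else 0)
             + 2 * pi * of_int (k \<delta> - (if s2 < s1 then 1 else 0))))
      \<in> O[at_right 0](\<lambda>\<delta>. complex_of_real \<delta>)"
      using k unfolding lz(4) of_real_add[symmetric]
      by (simp only: of_int_diff if_distrib) (auto simp: algebra_simps split: if_splits)
  qed
qed

end
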